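(* Let $\Gamma$ be a compact connected Riemann surface of genus $g$ with divisors $P=P_1+\dots+P_n$, $D=\gamma_1+\dots+\gamma_{g+l}$, $R=r+r_1+\dots+r_l$, with local parameters $k_i^{-1}$ near $P_i$ (vanishing at $P_i$), $i=1,\dots,n$, and with $n+1$ further points $Q_1,\dots,Q_{n+1}\in\Gamma$. Let $\psi(u_1,\dots,u_n,S)$ be the $n$-point Baker--Akhiezer function of the spectral data $\{\Gamma,P_1,\dots,P_n,k_1,\dots,k_n,D,R\}$ with $\psi(r)=h$, where $h\neq 0$ is real, and $\psi(r_j)=0$ for $j=1,\dots,l$. Assume: (i) there is a holomorphic involution $\sigma:\Gamma\to\Gamma$ fixing each of $Q_1,\dots,Q_{n+1},P_1,\dots,P_n,r$ and acting near $P_i$ by $\sigma(k_i)=-k_i$, $i=1,\dots,n$; (ii) there is a meromorphic $1$-form $\Omega$ on $\Gamma$ with divisor $(\Omega)=D+\sigma D+P-Q_1-\dots-Q_{n+1}-R-\sigma r_1-\dots-\sigma r_l$; (iii) there is an antiholomorphic involution $\tau:\Gamma\to\Gamma$ fixing all the points of $P,D,R$ and the points $Q_1,\dots,Q_{n+1}$, and acting near $P_i$ by $\tau(k_i)=\overline{k_i}$, $i=1,\dots,n$. Put $A_k=\operatorname{Res}_{Q_k}\Omega$, $B=\operatorname{Res}_r\Omega$; let $C_i$ be defined by the expansion $\Omega=\big(C_ik_i^{-1}+\dots\big)dk_i^{-1}$ near $P_i$, and let $f_j(u_1,\dots,u_n)$ be the leading coefficient of $e^{-u_jk_j}\psi=f_j+\frac{g_j}{k_j}+\dots$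 near $P_j$. Assume that all $A_i$ are real, $A_i>0$ for all $i=1,\dots,n+1$, and $h^2B=-1$. Then the functions $$x^i(u_1,\dots,u_n)=\sqrt{A_i}\,\psi(u_1,\dots,u_n,Q_i),\qquad i=1,\dots,n+1,$$ give an orthogonal coordinate system in $S^n$. Moreover, the Lamé coefficients $$H_i=\sqrt{f_i^2C_i},\qquad i=1,\dots,n,$$ satisfy, with $\beta_{ij}=\frac{\partial_iH_j}{H_i}$ for $i\neq j$ and $\partial_i=\partial/\partial u_i$, the equations $$\partial_k\beta_{ij}=\beta_{ik}\beta_{kj}\quad (i,j,k \text{ pairwise distinct}),$$ $$\partial_i\beta_{ij}+\partial_j\beta_{ji}+\sum_{m\neq i,j}\beta_{mi}\beta_{mj}=-K H_iH_j\quad (i\neq j)$$ with $K=1$.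
   Context: Baker--Akhiezer function. Given $\Gamma$, $P$, the local parameters $k_i^{-1}$, a divisor $D=\gamma_1+\dots+\gamma_{g+l}$ and $R=r+r_1+\dots+r_l$, the $n$-point Baker--Akhiezer function $\psi(u_1,\dots,u_n,S)$ ($u_1,\dots,u_n$ real, $S\in\Gamma$) is the function such that: (1) near $P_j$, $\psi=e^{k_ju_j}\left(f_j(u)+\frac{g_j(u)}{k_j}+\dots\right)$, $j=1,\dots,n$, i.e. $e^{-k_ju_j}\psi$ is holomorphic near $P_j$; (2) $\psi$ is meromorphic in $S$ on $\Gamma\setminus\{P_1,\dots,P_n\}$ with at most simple poles at $\gamma_1,\dots,\gamma_{g+l}$ and no other poles; (3) $\psi(u,r)=h$, a nonzero constant, and $\psi(u,r_j)=0$ for $j=1,\dots,l$. Conventions. The points $P_1,\dots,P_n,\gamma_1,\dots,\gamma_{g+l},r,r_1,\dots,r_l,Q_1,\dots,Q_{n+1}$ are pairwise distinct. The spectral data are in general position, so that for all $u=(u_1,\dots,u_n)$ in a connected open set $U\subset\mathbb R^n$ the function $\psi$ exists, is unique, and depends smoothly on $u$ (with the expansions near the $P_j$ differentiable term by term in $u$). $\sigma$ acts on divisors pointwise. $S^n=\{(x^1)^2+\dots+(x^{n+1})^2=1\}\subset\mathbb R^{n+1}$ with the induced metric. "The functions $x^i$ give an orthogonal coordinate system in $S^n$" means: the $x^i$ are real-valued, $(x^1)^2+\dots+(x^{n+1})^2=1$, and $\sum_{m=1}^{n+1}x^m_{u_i}x^m_{u_j}=0$ for $i\neq j$; the induced metric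 is then $ds^2=H_1^2du_1^2+\dots+H_n^2du_n^2$ with $H_i$ the Lamé coefficients, and $u_1,\dots,u_n$ are local coordinates wherever all $H_i\ne0$. Statements involving the $\beta_{ij}$ are understood on the open set of $u\in U$ where all $f_i(u)\neq0$. *)

theory Defs
  imports
    "HOL-Analysis.Analysis"
    "HOL-Complex_Analysis.Complex_Analysis"
    "HOL-Homology.Homology"
begin

section \<open>Riemann surfaces\<close>

text \<open>
  The underlying space is a whole Hausdorff type \<open>'a\<close>.  A chart is a pair of its open domain and the
  coordinate function on it; values of the coordinate function outside the domain are irrelevant.
\<close>

type_synonym 'a chart = "'a set \<times> ('a \<Rightarrow> complex)"

definition chart_inv :: "'a chart \<Rightarrow> complex \<Rightarrow> 'a" where
  "chart_inv c = inv_into (fst c) (snd c)"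

definition is_chart :: "'a::t2_space chart \<Rightarrow> bool" where
  "is_chart c \<longleftrightarrow> open (fst c) \<and> open (snd c ` fst c) \<and>
     homeomorphism (fst c) (snd c ` fst c) (snd c) (chart_inv c)"

definition transition :: "'a chart \<Rightarrow> 'a chart \<Rightarrow> complex \<Rightarrow> complex" where
  "transition c d = snd d \<circ> chart_inv c"

definition compatible :: "'a chart \<Rightarrow> 'a chart \<Rightarrow> bool" where
  "compatible c d \<longleftrightarrow>
     transition c d holomorphic_on snd c ` (fst c \<inter> fst d) \<and>
     transition d c holomorphic_on snd d ` (fst c \<inter> fst d)"

text \<open>
  A Riemann surface structure is a maximal complex atlas, so its members are exactly the local
  holomorphic coordinates.
\<close>

definition riemann_surface :: "'a::t2_space chart set \<Rightarrow> bool" where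
  "riemann_surface \<A> \<longleftrightarrow>
     (\<forall>c\<in>\<A>. is_chart c) \<and> (\<Union>c\<in>\<A>. fst c) = UNIV \<and>
     (\<forall>c\<in>\<A>. \<forall>d\<in>\<A>. compatible c d) \<and>
     (\<forall>c. is_chart c \<and> (\<forall>d\<in>\<A>. compatible c d) \<longrightarrow> c \<in> \<A>)"

text \<open>The topological genus: the first homology group is free Abelian of rank \<open>2 g\<close>.\<close>

definition has_genus :: "'a topology \<Rightarrow> nat \<Rightarrow> bool" where
  "has_genus X g \<longleftrightarrow> homology_group 1 X \<cong> free_Abelian_group {..<2 * g}"

definition local_parameter_at ::
    "'a::t2_space chart set \<Rightarrow> 'a set \<Rightarrow> ('a \<Rightarrow> complex) \<Rightarrow> 'a \<Rightarrow> bool" where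
  "local_parameter_at \<A> W z p \<longleftrightarrow> (W, z) \<in> \<A> \<and> p \<in> W \<and> z p = 0"

definition holomorphic_fun_on :: "'a chart set \<Rightarrow> ('a \<Rightarrow> complex) \<Rightarrow> 'a set \<Rightarrow> bool" where
  "holomorphic_fun_on \<A> f S \<longleftrightarrow>
     (\<forall>c\<in>\<A>. (f \<circ> chart_inv c) holomorphic_on snd c ` (fst c \<inter> S))"

definition at_most_simple_pole_at :: "'a chart set \<Rightarrow> ('a \<Rightarrow> complex) \<Rightarrow> 'a \<Rightarrow> bool" where
  "at_most_simple_pole_at \<A> f p \<longleftrightarrow>
     (\<forall>c\<in>\<A>. p \<in> fst c \<longrightarrow>
        (f \<circ> chart_inv c) meromorphic_on {snd c p} \<and>
        (is_pole (f \<circ> chart_inv c) (snd c p) \<longrightarrow> zorder (f \<circ> chart_inv c) (snd c p) = -1))"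

definition holomorphic_map :: "'a::t2_space chart set \<Rightarrow> ('a \<Rightarrow> 'a) \<Rightarrow> bool" where
  "holomorphic_map \<A> F \<longleftrightarrow> continuous_on UNIV F \<and>
     (\<forall>c\<in>\<A>. \<forall>d\<in>\<A>. (snd d \<circ> F \<circ> chart_inv c) holomorphic_on snd c ` (fst c \<inter> F -` fst d))"

definition antiholomorphic_map :: "'a::t2_space chart set \<Rightarrow> ('a \<Rightarrow> 'a) \<Rightarrow> bool" where
  "antiholomorphic_map \<A> F \<longleftrightarrow> continuous_on UNIV F \<and>
     (\<forall>c\<in>\<A>. \<forall>d\<in>\<A>. (cnj \<circ> snd d \<circ> F \<circ> chart_inv c) holomorphic_on snd c ` (fst c \<inter> F -` fst d))"

definition involution :: "('a \<Rightarrow> 'a) \<Rightarrow> bool" where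
  "involution F \<longleftrightarrow> F \<circ> F = id"

section \<open>Meromorphic 1-forms\<close>

text \<open>
  A form is given by its coefficients: it equals \<open>\<omega> c w dw\<close> in the coordinate \<open>w\<close> of the chart \<open>c\<close>.
  Coefficients are normalised to be continuous at removable singularities and \<open>0\<close> at poles, so
  that the transformation law can be required at all points.
\<close>

type_synonym 'a form = "'a chart \<Rightarrow> complex \<Rightarrow> complex"

definition meromorphic_form :: "'a chart set \<Rightarrow> 'a form \<Rightarrow> bool" where
  "meromorphic_form \<A> \<omega> \<longleftrightarrow>
     (\<forall>c\<in>\<A>. \<omega> c nicely_meromorphic_on snd c ` fst c) \<and>
     (\<forall>c\<in>\<A>. \<forall>d\<in>\<A>. \<forall>w \<in> snd c ` (fst c \<inter> fst d).
        \<omega> c w = \<omega> d (transition c d w) * deriv (transition c d) w)"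

text \<open>
  Divisors are elements of the free Abelian group on the points.  The first conjunct excludes the
  zero form, for which \<open>zorder\<close> is meaningless.
\<close>

definition form_has_divisor :: "'a chart set \<Rightarrow> 'a form \<Rightarrow> ('a \<Rightarrow>\<^sub>0 int) \<Rightarrow> bool" where
  "form_has_divisor \<A> \<omega> E \<longleftrightarrow>
     (\<forall>c\<in>\<A>. \<forall>p\<in>fst c.
        (\<exists>\<^sub>F w in at (snd c p). \<omega> c w \<noteq> 0) \<and>
        zorder (\<omega> c) (snd c p) = Poly_Mapping.lookup E p)"

text \<open>The residue does not depend on the chart chosen.\<close>

definition form_residue :: "'a chart set \<Rightarrow> 'a form \<Rightarrow> 'a \<Rightarrow> complex" where
  "form_residue \<A> \<omega> p =
     (let c = (SOME c. c \<in> \<A> \<and> p \<in> fst c) in residue (\<omega> c) (snd c p))"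

section \<open>Partial derivatives\<close>

definition partial :: "'n::finite \<Rightarrow> (real^'n \<Rightarrow> 'b::real_normed_vector) \<Rightarrow> real^'n \<Rightarrow> 'b" where
  "partial i f u = vector_derivative (\<lambda>t. f (u + t *\<^sub>R axis i 1)) (at 0)"

fun iter_partial :: "'n::finite list \<Rightarrow> (real^'n \<Rightarrow> 'b::real_normed_vector) \<Rightarrow> real^'n \<Rightarrow> 'b" where
  "iter_partial [] f = f"
| "iter_partial (i # is) f = partial i (iter_partial is f)"

text \<open>Infinitely differentiable; meant for open \<open>U\<close>.\<close>

definition smooth_on :: "(real^'n::finite) set \<Rightarrow> (real^'n \<Rightarrow> 'b::real_normed_vector) \<Rightarrow> bool" where
  "smooth_on U f \<longleftrightarrow> (\<forall>is. \<forall>u\<in>U. iter_partial is f differentiable (at u))"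

section \<open>Baker--Akhiezer functions\<close>

text \<open>
  Here \<open>z j\<close> is the local parameter \<open>1/k\<^sub>j\<close> at \<open>P j\<close>, \<open>G\<close> is the set of allowed poles, \<open>Z\<close> is the
  set of prescribed zeros, and \<open>\<phi>\<close> is the candidate function on the surface for a fixed \<open>u\<close>.  Its
  values on \<open>range P \<union> G\<close> carry no meaning.
\<close>

definition ba_expansion ::
    "('n \<Rightarrow> 'a::t2_space) \<Rightarrow> ('n \<Rightarrow> 'a \<Rightarrow> complex) \<Rightarrow> real^'n::finite \<Rightarrow> ('a \<Rightarrow> complex) \<Rightarrow>
     'n \<Rightarrow> (nat \<Rightarrow> complex) \<Rightarrow> bool" where
  "ba_expansion P z u \<phi> j a \<longleftrightarrow>
     (\<forall>\<^sub>F S in at (P j). (\<lambda>m. a m * z j S ^ m) sums (exp (- (of_real (u $ j) / z j S)) * \<phi> S))"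

definition baker_akhiezer ::
    "'a::t2_space chart set \<Rightarrow> ('n \<Rightarrow> 'a) \<Rightarrow> ('n \<Rightarrow> 'a \<Rightarrow> complex) \<Rightarrow> 'a set \<Rightarrow> 'a \<Rightarrow> 'a set \<Rightarrow> complex \<Rightarrow>
     real^'n::finite \<Rightarrow> ('a \<Rightarrow> complex) \<Rightarrow> bool" where
  "baker_akhiezer \<A> P z G r Z h u \<phi> \<longleftrightarrow>
     (\<forall>j. \<exists>a. ba_expansion P z u \<phi> j a) \<and>
     holomorphic_fun_on \<A> \<phi> (- (range P \<union> G)) \<and>
     (\<forall>p\<in>G. at_most_simple_pole_at \<A> \<phi> p) \<and>
     \<phi> r = h \<and> (\<forall>p\<in>Z. \<phi> p = 0)"

text \<open>
  Smooth dependence on the parameter \<open>u \<in> U\<close> of functions on the surface defined off the closed set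
  \<open>E\<close>: all \<open>u\<close>-derivatives exist and are jointly continuous.
\<close>

definition smooth_family ::
    "(real^'n::finite) set \<Rightarrow> 'a::topological_space set \<Rightarrow> (real^'n \<Rightarrow> 'a \<Rightarrow> complex) \<Rightarrow> bool" where
  "smooth_family U E \<psi> \<longleftrightarrow>
     (\<forall>S\<in>-E. smooth_on U (\<lambda>u. \<psi> u S)) \<and>
     (\<forall>is. continuous_on (U \<times> (-E)) (\<lambda>(u, S). iter_partial is (\<lambda>v. \<psi> v S) u))"

text \<open>
  \<open>a j m\<close> is the coefficient of \<open>k\<^sub>j\<close> to the power \<open>-m\<close> at \<open>P j\<close>; every \<open>u\<close>-derivative of the
  expansion may be computed term by term.
\<close>

definition termwise_expansions ::
    "('n \<Rightarrow> 'a::t2_space) \<Rightarrow> ('n \<Rightarrow> 'a \<Rightarrow> complex) \<Rightarrow> (real^'n::finite) set \<Rightarrow>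
     (real^'n \<Rightarrow> 'a \<Rightarrow> complex) \<Rightarrow> ('n \<Rightarrow> nat \<Rightarrow> real^'n \<Rightarrow> complex) \<Rightarrow> bool" where
  "termwise_expansions P z U \<psi> a \<longleftrightarrow>
     (\<forall>j m. smooth_on U (a j m)) \<and>
     (\<forall>j is. \<forall>u\<in>U. \<forall>\<^sub>F S in at (P j).
        (\<lambda>m. iter_partial is (a j m) u * z j S ^ m) sums
          iter_partial is (\<lambda>v. exp (- (of_real (v $ j) / z j S)) * \<psi> v S) u)"

section \<open>Orthogonal coordinates on the sphere\<close>

text \<open>The map \<open>x\<close> takes values in the unit sphere and the induced metric is \<open>\<Sum>i. H i ^ 2 du\<^sub>i\<^sup>2\<close>.\<close>

definition orthogonal_sphere_coordinates ::
    "(real^'n::finite) set \<Rightarrow> (real^'n \<Rightarrow> real^'m::finite) \<Rightarrow> ('n \<Rightarrow> real^'n \<Rightarrow> real) \<Rightarrow> bool" where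
  "orthogonal_sphere_coordinates U x H \<longleftrightarrow>
     smooth_on U x \<and> x ` U \<subseteq> sphere 0 1 \<and>
     (\<forall>u\<in>U. \<forall>i j. i \<noteq> j \<longrightarrow> partial i x u \<bullet> partial j x u = 0) \<and>
     (\<forall>u\<in>U. \<forall>i. partial i x u \<bullet> partial i x u = (H i u)\<^sup>2)"

definition rotation_coeff ::
    "('n \<Rightarrow> real^'n::finite \<Rightarrow> real) \<Rightarrow> 'n \<Rightarrow> 'n \<Rightarrow> real^'n \<Rightarrow> real" where
  "rotation_coeff H i j u = partial i (H j) u / H i u"

definition lame_equations ::
    "real \<Rightarrow> (real^'n::finite) set \<Rightarrow> ('n \<Rightarrow> real^'n \<Rightarrow> real) \<Rightarrow> bool" where
  "lame_equations K V H \<longleftrightarrow>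
     (\<forall>i. smooth_on V (H i)) \<and> (\<forall>u\<in>V. \<forall>i. H i u \<noteq> 0) \<and>
     (let \<beta> = rotation_coeff H in \<forall>u\<in>V.
        (\<forall>i j k. i \<noteq> j \<longrightarrow> j \<noteq> k \<longrightarrow> i \<noteq> k \<longrightarrow> partial k (\<beta> i j) u = \<beta> i k u * \<beta> k j u) \<and>
        (\<forall>i j. i \<noteq> j \<longrightarrow>
           partial i (\<beta> i j) u + partial j (\<beta> j i) u + (\<Sum>m\<in>UNIV - {i, j}. \<beta> m i u * \<beta> m j u)
             = - K * H i u * H j u))"

end

theory Submission
  imports Defs
begin

text \<open>
  For fixed \<open>u\<close> the essential singularities of \<open>\<psi>(u, S) \<psi>(u, \<sigma> S)\<close> at the points \<open>P j\<close> cancel, because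
  \<open>\<sigma>\<close> changes the sign of \<open>k j\<close>; the divisor of \<open>\<Omega>\<close> is such that \<open>\<psi>(u, S) \<psi>(u, \<sigma> S) \<Omega>\<close> has poles only at
  the \<open>Q m\<close> and at \<open>r\<close>.  The vanishing of the sum of its residues says that \<open>x u\<close> lies on the sphere.
  Replacing \<open>\<psi>\<close> by its derivatives in \<open>u i\<close> and \<open>u k\<close> gives the metric: for \<open>i \<noteq> k\<close> there is no further pole,
  and for \<open>i = k\<close> there is one more, at \<open>P i\<close>, with residue \<open>- f\<^sub>i\<^sup>2 C\<^sub>i\<close>.  The functions are real at the
  \<open>Q m\<close> since \<open>cnj (\<psi>(u, \<tau> S))\<close> is a Baker--Akhiezer function of the same data.  The equations for the
  rotation coefficients hold for every orthogonal coordinate system on the sphere: they express that partial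
  derivatives commute on the orthonormal frame formed by \<open>x\<close> and the normalised \<open>\<partial>\<^sub>i x\<close>.

  The sum of the residues of a form \<open>\<omega>\<close> with simple poles on a compact surface vanishes by Stokes' theorem: for a
  partition of unity \<open>\<eta>\<close>, constant near the poles, the integrals of \<open>dbar \<eta> \<and> \<omega>\<close> add up to \<open>0\<close>, and the
  integral over a chart is a fixed nonzero multiple of the residue if \<open>\<eta>\<close> is a bump around a pole, and
  zero if \<open>\<eta>\<close> vanishes near the poles.
\<close>

unbundle no fps_syntax

section \<open>Smooth functions of real variables\<close>

text \<open>At \<open>P j\<close> two orders compete: a derivative in the variable
  \<open>u $ j\<close> multiplies \<psi> by k_j and costs one pole order, while \<Omega> has a
  simple zero there. Two such derivatives leave exactly a simple pole, so a residue theorem for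
  simple poles suffices throughout, and the minus sign of the residue is that of the one factor k_j
  on which \<sigma> acts.

  Stokes' theorem is reduced to Lebesgue integrals over compact subsets of charts. Under a
  transition map T the factor \<open>dbar \<eta>\<close> acquires the conjugate of T' and the
  coefficient of \<omega> acquires T'; the product of the two is the real Jacobian of T, which makes
  the integrals independent of the chart.

  The other obstacle is that the u-derivatives of \<psi> have to be meromorphic on the surface with
  the same poles as \<psi>, whereas smooth dependence gives only joint continuity away from the
  points \<open>P j\<close> and the poles. Cauchy's integral over a circle bridges this gap; around
  a pole it is applied to \<psi> times the local coordinate, on a disc chosen independently of
  u.\<close>

lemma partial_eq:
  assumes "(f has_derivative F) (at u)"
  shows "partial i f u = F (axis i 1)"
proof -
  have "((\<lambda>t::real. u + t *\<^sub>R axis i 1) has_derivative (\<lambda>t. t *\<^sub>R axis i 1)) (at 0)"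
    by (auto intro!: derivative_eq_intros)
  moreover have "(f has_derivative F) (at (u + 0 *\<^sub>R axis i 1))" using assms by simp
  ultimately have "((\<lambda>t. f (u + t *\<^sub>R axis i 1)) has_derivative (\<lambda>t. F (t *\<^sub>R axis i 1))) (at 0)"
    by (rule has_derivative_compose[where f = "\<lambda>t::real. u + t *\<^sub>R axis i 1" and s = UNIV, simplified])
  then have "((\<lambda>t. f (u + t *\<^sub>R axis i 1)) has_vector_derivative F (axis i 1)) (at 0)"
    using linear_scale[OF has_derivative_linear[OF assms]] by (simp add: has_vector_derivative_def)
  then show ?thesis unfolding partial_def by (rule vector_derivative_at)
qed

lemma has_vector_derivative_partial:
  assumes "f differentiable (at (u + s *\<^sub>R axis i 1))"
  shows "((\<lambda>t. f (u + t *\<^sub>R axis i 1)) has_vector_derivative partial i f (u + s *\<^sub>R axis i 1)) (at s)"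
proof -
  obtain F where F: "(f has_derivative F) (at (u + s *\<^sub>R axis i 1))"
    using assms by (auto simp: differentiable_def)
  have "((\<lambda>t::real. u + t *\<^sub>R axis i 1) has_derivative (\<lambda>t. t *\<^sub>R axis i 1)) (at s)"
    by (auto intro!: derivative_eq_intros)
  from has_derivative_compose[OF this F]
  have "((\<lambda>t. f (u + t *\<^sub>R axis i 1)) has_derivative (\<lambda>t. F (t *\<^sub>R axis i 1))) (at s)" .
  then show ?thesis
    using linear_scale[OF has_derivative_linear[OF F]] by (simp add: has_vector_derivative_def partial_eq[OF F])
qed

lemma partial_cong_open:
  assumes V: "open V" "u \<in> V" and eq: "\<And>v. v \<in> V \<Longrightarrow> f v = g v"
  shows "partial i f u = partial i g u"
proof -
  have "((\<lambda>t::real. u + t *\<^sub>R axis i 1) \<longlongrightarrow> u + 0 *\<^sub>R axis i 1) (nhds 0)"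
    by (intro tendsto_intros filterlim_ident)
  then have "\<forall>\<^sub>F t::real in nhds 0. u + t *\<^sub>R axis i 1 \<in> V"
    using V topological_tendstoD by fastforce
  then have "\<forall>\<^sub>F t::real in nhds 0. f (u + t *\<^sub>R axis i 1) = g (u + t *\<^sub>R axis i 1)"
    by (rule eventually_mono) (rule eq)
  then show ?thesis
    unfolding partial_def by (intro vector_derivative_cong_eq) (auto elim: eventually_mono)
qed

lemma iter_partial_cong_open:
  assumes V: "open V" and eq: "\<And>v. v \<in> V \<Longrightarrow> f v = g v"
  shows "u \<in> V \<Longrightarrow> iter_partial is f u = iter_partial is g u"
proof (induction "is" arbitrary: u)
  case (Cons i "is")
  then show ?case using partial_cong_open[OF V Cons.prems Cons.IH] by simp
qed (simp add: eq)

lemma iter_partial_append: "iter_partial (is @ js) f = iter_partial is (iter_partial js f)"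
  by (induction "is") auto

lemma differentiable_cong_open:
  assumes "open V" "u \<in> V" "\<And>v. v \<in> V \<Longrightarrow> f v = g v"
  shows "f differentiable (at u) \<longleftrightarrow> g differentiable (at u)"
  unfolding differentiable_def using has_derivative_transform_within_open[of f _ u UNIV V g]
    has_derivative_transform_within_open[of g _ u UNIV V f] assms by auto

section \<open>Closure properties of smooth functions, by induction on the order\<close>

text \<open>Closure of smooth functions under products cannot be proved by induction on a list of
  indices, since the derivative of a product is a sum of products of other functions. Induction on
  the order works. Order \<open>k\<close> means that the derivatives of order \<open>k\<close> are
  still differentiable, so order \<open>0\<close> is differentiability.\<close>

definition smooth_upto :: "nat \<Rightarrow> (real^'n::finite) set \<Rightarrow> (real^'n \<Rightarrow> 'b::real_normed_vector) \<Rightarrow> bool" where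
  "smooth_upto k V f \<longleftrightarrow> (\<forall>is. length is \<le> k \<longrightarrow> (\<forall>u\<in>V. iter_partial is f differentiable (at u)))"

lemma smooth_on_iff: "smooth_on V f \<longleftrightarrow> (\<forall>k. smooth_upto k V f)"
  by (auto simp: smooth_on_def smooth_upto_def)

lemma smooth_upto_0: "smooth_upto 0 V f \<longleftrightarrow> (\<forall>u\<in>V. f differentiable (at u))"
  by (simp add: smooth_upto_def)

lemma smooth_upto_Suc:
  fixes f :: "real^'n::finite \<Rightarrow> 'b::real_normed_vector"
  shows "smooth_upto (Suc k) V f \<longleftrightarrow> (\<forall>u\<in>V. f differentiable (at u)) \<and> (\<forall>i. smooth_upto k V (partial i f))"
proof (intro iffI conjI allI ballI)
  assume s: "smooth_upto (Suc k) V f"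
  show "f differentiable (at u)" if "u \<in> V" for u
    using s that unfolding smooth_upto_def by (metis iter_partial.simps(1) le0 list.size(3))
  show "smooth_upto k V (partial i f)" for i
    unfolding smooth_upto_def
  proof (intro allI impI ballI)
    fix "is" :: "'n list" and u assume *: "length is \<le> k" "u \<in> V"
    then have "length (is @ [i]) \<le> Suc k" by simp
    then have "iter_partial (is @ [i]) f differentiable (at u)"
      using s *(2) unfolding smooth_upto_def by blast
    then show "iter_partial is (partial i f) differentiable (at u)"
      by (simp add: iter_partial_append)
  qed
next
  assume s: "(\<forall>u\<in>V. f differentiable (at u)) \<and> (\<forall>i. smooth_upto k V (partial i f))"
  show "smooth_upto (Suc k) V f"
    unfolding smooth_upto_def
  proof (intro allI impI ballI)
    fix "is" :: "'n list" and u assume *: "length is \<le> Suc k" "u \<in> V"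
    show "iter_partial is f differentiable (at u)"
    \<comment> \<open>The head of the list is the derivative taken last, so the one applied to
      \<open>f\<close> itself is the last entry.\<close>
    proof (cases "is" rule: rev_cases)
      case Nil
      then show ?thesis using s * by simp
    next
      case (snoc js j)
      then have "iter_partial js (partial j f) differentiable (at u)"
        using s * unfolding smooth_upto_def by simp
      then show ?thesis by (simp add: snoc iter_partial_append)
    qed
  qed
qed

lemma smooth_upto_cong_open:
  fixes f :: "real^'n::finite \<Rightarrow> 'b::real_normed_vector"
  assumes V: "open V" and eq: "\<And>v. v \<in> V \<Longrightarrow> f v = g v" and f: "smooth_upto k V f"
  shows "smooth_upto k V g"
  unfolding smooth_upto_def
proof (intro allI impI ballI)
  fix "is" :: "'n list" and u assume *: "length is \<le> k" "u \<in> V"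
  then have "iter_partial is f differentiable (at u)" using f unfolding smooth_upto_def by blast
  moreover have "iter_partial is f v = iter_partial is g v" if "v \<in> V" for v
    by (rule iter_partial_cong_open[OF V _ that]) (rule eq)
  ultimately show "iter_partial is g differentiable (at u)"
    using differentiable_cong_open[OF V *(2), of "iter_partial is f" "iter_partial is g"] by blast
qed

lemma smooth_upto_SucD: "smooth_upto (Suc k) V f \<Longrightarrow> smooth_upto k V f"
  by (simp add: smooth_upto_def)

lemma smooth_upto_differentiable: "smooth_upto k V f \<Longrightarrow> u \<in> V \<Longrightarrow> f differentiable (at u)"
  unfolding smooth_upto_def by (metis iter_partial.simps(1) le0 list.size(3))

lemma smooth_upto_const:
  fixes V :: "(real^'n::finite) set"
  shows "smooth_upto k V (\<lambda>_. c)"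
proof (induction k arbitrary: c)
  case (Suc k)
  have "partial i (\<lambda>_::real^'n. c) = (\<lambda>_. 0)" for i
    using partial_eq[OF has_derivative_const] by blast
  then show ?case using Suc[of 0] unfolding smooth_upto_Suc by simp
qed (simp add: smooth_upto_0)

lemma partial_add:
  assumes "f differentiable (at u)" "g differentiable (at u)"
  shows "partial i (\<lambda>u. f u + g u) u = partial i f u + partial i g u"
proof -
  obtain F G where FG: "(f has_derivative F) (at u)" "(g has_derivative G) (at u)"
    using assms by (auto simp: differentiable_def)
  show ?thesis using partial_eq[OF has_derivative_add[OF FG]] partial_eq[OF FG(1)] partial_eq[OF FG(2)] by simp
qed

lemma smooth_upto_add:
  assumes V: "open V"
  shows "smooth_upto k V f \<Longrightarrow> smooth_upto k V g \<Longrightarrow> smooth_upto k V (\<lambda>u. f u + g u)"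
proof (induction k arbitrary: f g)
  case (Suc k)
  have "smooth_upto k V (partial i (\<lambda>u. f u + g u))" for i
  proof (rule smooth_upto_cong_open[OF V])
    show "smooth_upto k V (\<lambda>u. partial i f u + partial i g u)"
      using Suc.prems by (intro Suc.IH) (auto simp: smooth_upto_Suc)
    show "partial i f v + partial i g v = partial i (\<lambda>u. f u + g u) v" if "v \<in> V" for v
      by (rule partial_add[OF smooth_upto_differentiable[OF Suc.prems(1) that]
            smooth_upto_differentiable[OF Suc.prems(2) that], symmetric])
  qed
  then show ?case using Suc.prems by (auto simp: smooth_upto_Suc)
qed (auto simp: smooth_upto_0)

lemma smooth_upto_sum:
  assumes "open V" "\<And>i. i \<in> I \<Longrightarrow> smooth_upto k V (f i)"
  shows "smooth_upto k V (\<lambda>u. \<Sum>i\<in>I. f i u)"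
  using assms(2)
  by (induction I rule: infinite_finite_induct) (auto intro: smooth_upto_const smooth_upto_add[OF assms(1)])

lemma partial_bounded_linear:
  assumes "bounded_linear L" "f differentiable (at u)"
  shows "partial i (\<lambda>u. L (f u)) u = L (partial i f u)"
proof -
  obtain F where F: "(f has_derivative F) (at u)" using assms by (auto simp: differentiable_def)
  show ?thesis
    using partial_eq[OF bounded_linear.has_derivative[OF assms(1) F]] partial_eq[OF F] by simp
qed

lemma bounded_linear_differentiable:
  assumes "bounded_linear L" "f differentiable F"
  shows "(\<lambda>u. L (f u)) differentiable F"
  using assms bounded_linear.has_derivative unfolding differentiable_def by blast

lemma smooth_upto_bounded_linear:
  assumes V: "open V" and L: "bounded_linear L"
  shows "smooth_upto k V f \<Longrightarrow> smooth_upto k V (\<lambda>u. L (f u))"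
proof (induction k arbitrary: f)
  case 0
  then show ?case unfolding smooth_upto_0 by (intro ballI bounded_linear_differentiable[OF L]) auto
next
  case (Suc k)
  have "smooth_upto k V (partial i (\<lambda>u. L (f u)))" for i
  proof (rule smooth_upto_cong_open[OF V])
    show "smooth_upto k V (\<lambda>u. L (partial i f u))"
      using Suc.prems by (intro Suc.IH) (auto simp: smooth_upto_Suc)
    show "L (partial i f v) = partial i (\<lambda>u. L (f u)) v" if "v \<in> V" for v
      by (rule partial_bounded_linear[OF L smooth_upto_differentiable[OF Suc.prems that], symmetric])
  qed
  moreover have "\<forall>u\<in>V. (\<lambda>u. L (f u)) differentiable (at u)"
    by (intro ballI bounded_linear_differentiable[OF L] smooth_upto_differentiable[OF Suc.prems])
  ultimately show ?case by (simp add: smooth_upto_Suc)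
qed

lemma bilinear_differentiable:
  assumes "bounded_bilinear B" "f differentiable (at u)" "g differentiable (at u)"
  shows "(\<lambda>u. B (f u) (g u)) differentiable (at u)"
  using assms(2,3) bounded_bilinear.FDERIV[OF assms(1)] unfolding differentiable_def by blast

lemma partial_bilinear:
  assumes "bounded_bilinear B" "f differentiable (at u)" "g differentiable (at u)"
  shows "partial i (\<lambda>u. B (f u) (g u)) u = B (f u) (partial i g u) + B (partial i f u) (g u)"
proof -
  obtain F G where FG: "(f has_derivative F) (at u)" "(g has_derivative G) (at u)"
    using assms(2,3) by (auto simp: differentiable_def)
  show ?thesis using partial_eq[OF bounded_bilinear.FDERIV[OF assms(1) FG]] partial_eq[OF FG(1)] partial_eq[OF FG(2)] by simp
qed

text \<open>By the Leibniz rule a derivative of \<open>B f g\<close> is a sum of two terms of the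
  same kind, hence the induction over all pairs \<open>f\<close>, \<open>g\<close> at once. Inner
  products, scalar multiples and products of functions are all instances.\<close>

lemma smooth_upto_bilinear:
  assumes B: "bounded_bilinear B" and V: "open V"
  shows "smooth_upto k V f \<Longrightarrow> smooth_upto k V g \<Longrightarrow> smooth_upto k V (\<lambda>u. B (f u) (g u))"
proof (induction k arbitrary: f g)
  case 0
  then show ?case unfolding smooth_upto_0 by (intro ballI bilinear_differentiable[OF B]) auto
next
  case (Suc k)
  have "smooth_upto k V (partial i (\<lambda>u. B (f u) (g u)))" for i
  proof (rule smooth_upto_cong_open[OF V])
    show "smooth_upto k V (\<lambda>u. B (f u) (partial i g u) + B (partial i f u) (g u))"
      using Suc.prems smooth_upto_SucD[OF Suc.prems(1)] smooth_upto_SucD[OF Suc.prems(2)]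
      by (intro smooth_upto_add[OF V] Suc.IH) (auto simp: smooth_upto_Suc)
    show "B (f v) (partial i g v) + B (partial i f v) (g v) = partial i (\<lambda>u. B (f u) (g u)) v" if "v \<in> V" for v
      by (rule partial_bilinear[OF B smooth_upto_differentiable[OF Suc.prems(1) that]
            smooth_upto_differentiable[OF Suc.prems(2) that], symmetric])
  qed
  moreover have "\<forall>u\<in>V. (\<lambda>u. B (f u) (g u)) differentiable (at u)"
    using Suc.prems by (intro ballI bilinear_differentiable[OF B]) (auto simp: smooth_upto_Suc)
  ultimately show ?case by (simp add: smooth_upto_Suc)
qed

text \<open>The derivative of a power of \<open>G\<close> contains the next lower power, so the
  exponent has to vary in the induction. The exponents needed are 1/2, for the Lame coefficients as
  square roots of the metric, and -1, for their reciprocals.\<close>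

lemma smooth_upto_powr:
  fixes G :: "real^'n::finite \<Rightarrow> real"
  assumes V: "open V" and pos: "\<And>u. u \<in> V \<Longrightarrow> G u > 0"
  shows "smooth_upto k V G \<Longrightarrow> smooth_upto k V (\<lambda>u. G u powr a)"
proof (induction k arbitrary: a)
  have der: "((\<lambda>u. G u powr a) has_derivative (\<lambda>h. a * G u powr (a - 1) * F h)) (at u)"
    if "(G has_derivative F) (at u)" "u \<in> V" for F u a
  proof -
    have "((\<lambda>x. x powr a) has_real_derivative a * G u powr (a - 1)) (at (G u))"
      using pos[OF that(2)] by (rule has_real_derivative_powr)
    then have "((\<lambda>x. x powr a) has_derivative (*) (a * G u powr (a - 1))) (at (G u))"
      by (rule has_field_derivative_imp_has_derivative)
    from has_derivative_compose[OF that(1) this] show ?thesis .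
  qed
  {
    case 0
    then show ?case using der unfolding smooth_upto_0 differentiable_def by blast
  next
    case (Suc k)
    have "smooth_upto k V (partial i (\<lambda>u. G u powr a))" for i
    proof (rule smooth_upto_cong_open[OF V])
      show "smooth_upto k V (\<lambda>u. a *\<^sub>R (G u powr (a - 1) * partial i G u))"
        using Suc.prems smooth_upto_SucD[OF Suc.prems]
        by (intro smooth_upto_bounded_linear[OF V bounded_linear_scaleR_right]
              smooth_upto_bilinear[OF bounded_bilinear_mult V] Suc.IH) (auto simp: smooth_upto_Suc)
      fix v assume v: "v \<in> V"
      obtain F where F: "(G has_derivative F) (at v)"
        using Suc.prems v by (auto simp: smooth_upto_Suc differentiable_def)
      show "a *\<^sub>R (G v powr (a - 1) * partial i G v) = partial i (\<lambda>u. G u powr a) v"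
        using partial_eq[OF der[OF F v]] partial_eq[OF F] by simp
    qed
    moreover have "\<forall>u\<in>V. (\<lambda>u. G u powr a) differentiable (at u)"
      using Suc.prems der unfolding smooth_upto_Suc differentiable_def by blast
    ultimately show ?case by (simp add: smooth_upto_Suc)
  }
qed

lemma smooth_on_partial: "smooth_on V f \<Longrightarrow> smooth_on V (partial i f)"
  unfolding smooth_on_iff by (intro allI conjunct2[OF iffD1[OF smooth_upto_Suc], rule_format]) simp

lemma smooth_on_differentiable: "smooth_on V f \<Longrightarrow> u \<in> V \<Longrightarrow> f differentiable (at u)"
  unfolding smooth_on_iff by (rule smooth_upto_differentiable) auto

lemma smooth_on_cong_open:
  assumes "open V" "\<And>v. v \<in> V \<Longrightarrow> f v = g v" "smooth_on V f"
  shows "smooth_on V g"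
  unfolding smooth_on_iff using assms(3)
  by (intro allI smooth_upto_cong_open[OF assms(1,2)]) (auto simp: smooth_on_iff)

lemma smooth_on_subset: "smooth_on V f \<Longrightarrow> W \<subseteq> V \<Longrightarrow> smooth_on W f"
  unfolding smooth_on_def by blast

lemma smooth_on_sum:
  "open V \<Longrightarrow> (\<And>i. i \<in> I \<Longrightarrow> smooth_on V (f i)) \<Longrightarrow> smooth_on V (\<lambda>u. \<Sum>i\<in>I. f i u)"
  unfolding smooth_on_iff by (intro allI smooth_upto_sum) auto

lemma smooth_on_bounded_linear:
  "open V \<Longrightarrow> bounded_linear L \<Longrightarrow> smooth_on V f \<Longrightarrow> smooth_on V (\<lambda>u. L (f u))"
  unfolding smooth_on_iff by (intro allI, rule smooth_upto_bounded_linear[where L = L]) auto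

lemma smooth_on_powr:
  fixes G :: "real^'n::finite \<Rightarrow> real"
  shows "open V \<Longrightarrow> (\<And>u. u \<in> V \<Longrightarrow> G u > 0) \<Longrightarrow> smooth_on V G \<Longrightarrow> smooth_on V (\<lambda>u. G u powr a)"
  unfolding smooth_on_iff by (intro allI smooth_upto_powr) auto

lemma smooth_on_bilinear:
  "bounded_bilinear B \<Longrightarrow> open V \<Longrightarrow> smooth_on V f \<Longrightarrow> smooth_on V g \<Longrightarrow> smooth_on V (\<lambda>u. B (f u) (g u))"
  unfolding smooth_on_iff by (intro allI, rule smooth_upto_bilinear[where B = B]) auto

lemmas smooth_on_inner = smooth_on_bilinear[OF bounded_bilinear_inner]
lemmas smooth_on_scaleR = smooth_on_bilinear[OF bounded_bilinear_scaleR]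
lemmas smooth_on_mult = smooth_on_bilinear[OF bounded_bilinear_mult]
lemmas partial_inner = partial_bilinear[OF bounded_bilinear_inner]
lemmas partial_scaleR = partial_bilinear[OF bounded_bilinear_scaleR]

section \<open>Symmetry of mixed partial derivatives\<close>

text \<open>Mean value theorem applied twice, to the second difference over a square of side
  \<open>h\<close>: in direction \<open>i\<close> for the increment in direction \<open>j\<close>,
  and then in direction \<open>j\<close>. The second difference is symmetric in \<open>i\<close> and
  \<open>j\<close>, which forces the two mixed derivatives to agree in the limit.\<close>

lemma mixed_partial_mean_value:
  fixes f :: "real^'n::finite \<Rightarrow> real"
  assumes f: "smooth_on V f" and h: "h > 0"
    and V: "\<And>s t. 0 \<le> s \<Longrightarrow> s \<le> h \<Longrightarrow> 0 \<le> t \<Longrightarrow> t \<le> h \<Longrightarrow> u + s *\<^sub>R axis i 1 + t *\<^sub>R axis j 1 \<in> V"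
  obtains s t where "0 < s" "s < h" "0 < t" "t < h"
    "f (u + h *\<^sub>R axis i 1 + h *\<^sub>R axis j 1) - f (u + h *\<^sub>R axis i 1) - f (u + h *\<^sub>R axis j 1) + f u =
      h * h * partial j (partial i f) (u + s *\<^sub>R axis i 1 + t *\<^sub>R axis j 1)"
proof -
  let ?i = "axis i 1 :: real^'n" and ?j = "axis j 1 :: real^'n"
  have d1: "((\<lambda>s. f (u + s *\<^sub>R ?i + t *\<^sub>R ?j)) has_real_derivative partial i f (u + s *\<^sub>R ?i + t *\<^sub>R ?j)) (at s)"
    if "0 \<le> s" "s \<le> h" "0 \<le> t" "t \<le> h" for s t
    using has_vector_derivative_partial[of f "u + t *\<^sub>R ?j" s i] smooth_on_differentiable[OF f V[OF that]]
    by (simp add: has_real_derivative_iff_has_vector_derivative algebra_simps)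
  have d2: "((\<lambda>t. partial i f (u + s *\<^sub>R ?i + t *\<^sub>R ?j)) has_real_derivative
      partial j (partial i f) (u + s *\<^sub>R ?i + t *\<^sub>R ?j)) (at t)"
    if "0 \<le> s" "s \<le> h" "0 \<le> t" "t \<le> h" for s t
    using has_vector_derivative_partial[of "partial i f" "u + s *\<^sub>R ?i" t j]
      smooth_on_differentiable[OF smooth_on_partial[OF f] V[OF that]]
    by (simp add: has_real_derivative_iff_has_vector_derivative algebra_simps)
  define g where "g s = f (u + s *\<^sub>R ?i + h *\<^sub>R ?j) - f (u + s *\<^sub>R ?i + 0 *\<^sub>R ?j)" for s
  have "\<exists>s>0. s < h \<and> g h - g 0 = (h - 0) * (partial i f (u + s *\<^sub>R ?i + h *\<^sub>R ?j) - partial i f (u + s *\<^sub>R ?i + 0 *\<^sub>R ?j))"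
    unfolding g_def by (rule MVT2[OF h]) (use h in \<open>intro DERIV_diff d1; simp\<close>)
  then obtain s where s: "0 < s" "s < h"
    "g h - g 0 = h * (partial i f (u + s *\<^sub>R ?i + h *\<^sub>R ?j) - partial i f (u + s *\<^sub>R ?i + 0 *\<^sub>R ?j))" by auto
  have "\<exists>t>0. t < h \<and> partial i f (u + s *\<^sub>R ?i + h *\<^sub>R ?j) - partial i f (u + s *\<^sub>R ?i + 0 *\<^sub>R ?j) =
      (h - 0) * partial j (partial i f) (u + s *\<^sub>R ?i + t *\<^sub>R ?j)"
    by (rule MVT2[OF h]) (use s in \<open>intro d2; simp\<close>)
  then obtain t where t: "0 < t" "t < h"
    "partial i f (u + s *\<^sub>R ?i + h *\<^sub>R ?j) - partial i f (u + s *\<^sub>R ?i + 0 *\<^sub>R ?j) =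
      h * partial j (partial i f) (u + s *\<^sub>R ?i + t *\<^sub>R ?j)" by auto
  show thesis
    using that[OF s(1,2) t(1,2)] s(3) t(3) by (simp add: g_def)
qed

lemma partial_commute_real:
  fixes f :: "real^'n::finite \<Rightarrow> real"
  assumes V: "open V" and f: "smooth_on V f" and u: "u \<in> V"
  shows "partial i (partial j f) u = partial j (partial i f) u"
proof (rule ccontr)
  assume ne: "\<not> ?thesis"
  let ?A = "partial i (partial j f)" and ?B = "partial j (partial i f)"
  let ?i = "axis i 1 :: real^'n" and ?j = "axis j 1 :: real^'n"
  \<comment> \<open>Half the distance of the two supposedly different values: by continuity, nearby
    values of the two mixed derivatives then stay apart.\<close>
  define e where "e = \<bar>?A u - ?B u\<bar> / 2"
  have e: "e > 0" using ne by (simp add: e_def)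
  have "isCont ?A u" "isCont ?B u"
    using smooth_on_differentiable[OF smooth_on_partial[OF smooth_on_partial[OF f]] u]
    by (auto intro: differentiable_imp_continuous_within)
  then obtain d1 d2 where d: "d1 > 0" "\<And>v. dist v u < d1 \<Longrightarrow> dist (?A v) (?A u) < e"
      "d2 > 0" "\<And>v. dist v u < d2 \<Longrightarrow> dist (?B v) (?B u) < e"
    using e unfolding continuous_at_eps_delta by metis
  obtain d3 where d3: "d3 > 0" "ball u d3 \<subseteq> V" using V u open_contains_ball by blast
  \<comment> \<open>A point of the square of side \<open>h\<close> at \<open>u\<close> has distance
    at most \<open>2 * h\<close> from \<open>u\<close>, strictly less than each of the three
    radii.\<close>
  define h where "h = Min {d1, d2, d3} / 3"
  have h: "h > 0" "3 * h \<le> d1" "3 * h \<le> d2" "3 * h \<le> d3" using d d3 by (auto simp: h_def)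
  have near: "dist (u + s *\<^sub>R ?i + t *\<^sub>R ?j) u < 3 * h" "dist (u + s *\<^sub>R ?j + t *\<^sub>R ?i) u < 3 * h"
    if "0 \<le> s" "s \<le> h" "0 \<le> t" "t \<le> h" for s t
  proof -
    have "norm (s *\<^sub>R ?i + t *\<^sub>R ?j) \<le> norm (s *\<^sub>R ?i) + norm (t *\<^sub>R ?j)"
      "norm (s *\<^sub>R ?j + t *\<^sub>R ?i) \<le> norm (s *\<^sub>R ?j) + norm (t *\<^sub>R ?i)"
      by (rule norm_triangle_ineq)+
    then show "dist (u + s *\<^sub>R ?i + t *\<^sub>R ?j) u < 3 * h" "dist (u + s *\<^sub>R ?j + t *\<^sub>R ?i) u < 3 * h"
      using that h(1) by (simp_all add: dist_norm norm_axis_1 add.assoc)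
  qed
  have inV: "u + s *\<^sub>R ?i + t *\<^sub>R ?j \<in> V" "u + s *\<^sub>R ?j + t *\<^sub>R ?i \<in> V"
    if "0 \<le> s" "s \<le> h" "0 \<le> t" "t \<le> h" for s t
    using near[OF that] h(4) d3(2) by (auto simp: dist_commute subset_iff)
  obtain s t where st: "0 < s" "s < h" "0 < t" "t < h"
    "f (u + h *\<^sub>R ?i + h *\<^sub>R ?j) - f (u + h *\<^sub>R ?i) - f (u + h *\<^sub>R ?j) + f u =
      h * h * ?B (u + s *\<^sub>R ?i + t *\<^sub>R ?j)"
    by (rule mixed_partial_mean_value[OF f h(1) inV(1)])
  obtain s' t' where st': "0 < s'" "s' < h" "0 < t'" "t' < h"
    "f (u + h *\<^sub>R ?j + h *\<^sub>R ?i) - f (u + h *\<^sub>R ?j) - f (u + h *\<^sub>R ?i) + f u =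
      h * h * ?A (u + s' *\<^sub>R ?j + t' *\<^sub>R ?i)"
    by (rule mixed_partial_mean_value[OF f h(1) inV(2)])
  have "u + h *\<^sub>R ?j + h *\<^sub>R ?i = u + h *\<^sub>R ?i + h *\<^sub>R ?j" by (simp add: algebra_simps)
  from st'(5)[unfolded this]
  have "h * h * ?A (u + s' *\<^sub>R ?j + t' *\<^sub>R ?i) = h * h * ?B (u + s *\<^sub>R ?i + t *\<^sub>R ?j)"
    using st(5) by linarith
  then have eq: "?A (u + s' *\<^sub>R ?j + t' *\<^sub>R ?i) = ?B (u + s *\<^sub>R ?i + t *\<^sub>R ?j)" using h(1) by simp
  have "dist (u + s' *\<^sub>R ?j + t' *\<^sub>R ?i) u < d1" using near(2)[of s' t'] st' h by simp
  then have "dist (?A (u + s' *\<^sub>R ?j + t' *\<^sub>R ?i)) (?A u) < e" by (rule d(2))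
  moreover have "dist (u + s *\<^sub>R ?i + t *\<^sub>R ?j) u < d2" using near(1)[of s t] st h by simp
  then have "dist (?B (u + s *\<^sub>R ?i + t *\<^sub>R ?j)) (?B u) < e" by (rule d(4))
  ultimately show False unfolding eq dist_real_def e_def by argo
qed

lemma partial_commute:
  fixes f :: "real^'n::finite \<Rightarrow> 'b::euclidean_space"
  assumes V: "open V" and f: "smooth_on V f" and u: "u \<in> V"
  shows "partial i (partial j f) u = partial j (partial i f) u"
proof (rule euclidean_eqI)
  fix b :: 'b assume "b \<in> Basis"
  note L = bounded_linear_inner_left[of b]
  have 1: "partial i (\<lambda>v. g v \<bullet> b) v = partial i g v \<bullet> b" if "smooth_on V g" "v \<in> V" for g i v
    using that by (intro partial_bounded_linear[OF L] smooth_on_differentiable)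
  have 2: "partial i (partial j f) u \<bullet> b = partial i (partial j (\<lambda>v. f v \<bullet> b)) u" for i j
  proof -
    have "partial i (partial j f) u \<bullet> b = partial i (\<lambda>v. partial j f v \<bullet> b) u"
      using 1[OF smooth_on_partial[OF f] u] by simp
    also have "\<dots> = partial i (partial j (\<lambda>v. f v \<bullet> b)) u"
      by (rule partial_cong_open[OF V u]) (simp add: 1[OF f])
    finally show ?thesis .
  qed
  show "partial i (partial j f) u \<bullet> b = partial j (partial i f) u \<bullet> b"
    unfolding 2 by (rule partial_commute_real[OF V smooth_on_bounded_linear[OF V L f] u])
qed

section \<open>Orthogonal coordinates on the sphere\<close>

text \<open>Parseval's identity: by \<open>card\<close> the vectors \<open>x\<close> and
  \<open>e i\<close> are as many as the dimension, so being orthonormal they form a basis. The unit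
  normal \<open>x\<close> of the sphere is part of the frame, and its term is the source of the
  curvature 1 in the second Lame equation.\<close>

lemma inner_orthonormal_frame:
  fixes e :: "'n::finite \<Rightarrow> real^'m::finite" and x v w :: "real^'m"
  assumes card: "CARD('m) = CARD('n) + 1"
    and x: "x \<bullet> x = 1" and e: "\<And>i. e i \<bullet> e i = 1"
    and ex: "\<And>i. e i \<bullet> x = 0" and ee: "\<And>i j. i \<noteq> j \<Longrightarrow> e i \<bullet> e j = 0"
  shows "v \<bullet> w = (v \<bullet> x) * (w \<bullet> x) + (\<Sum>k\<in>UNIV. (v \<bullet> e k) * (w \<bullet> e k))"
proof -
  let ?B = "insert x (range e)"
  have inj: "inj e"
  proof (rule injI)
    fix i j assume "e i = e j"
    then show "i = j" using ee[of i j] e[of i] by (cases "i = j") auto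
  qed
  have nin: "x \<notin> range e" using ex x by (metis imageE zero_neq_one)
  have orth: "pairwise orthogonal ?B"
    unfolding pairwise_def orthogonal_def
    using ex ee by (auto simp: inner_commute) (metis inner_commute)+
  have "0 \<notin> ?B" using x e by (metis imageE inner_zero_left insertE zero_neq_one)
  then have ind: "independent ?B" using orth pairwise_orthogonal_independent by blast
  have fin: "finite ?B" by simp
  have "card ?B = CARD('m)" using nin inj by (simp add: card card_image)
  then have "UNIV \<subseteq> span ?B"
    using ind by (intro card_ge_dim_independent) (auto simp: dim_UNIV)
  then have v: "v \<in> span ?B" by blast
  have "norm b = 1" if "b \<in> ?B" for b
    using that x e by (auto simp: norm_eq_1)
  from orthonormal_basis_expand[OF orth this v fin]
  have "v = (\<Sum>b\<in>?B. (v \<bullet> b) *\<^sub>R b)" by simp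
  then have "v \<bullet> w = (\<Sum>b\<in>?B. (v \<bullet> b) *\<^sub>R b) \<bullet> w" by simp
  also have "\<dots> = (\<Sum>b\<in>?B. (v \<bullet> b) * (w \<bullet> b))"
    unfolding inner_sum_left inner_scaleR_left by (intro sum.cong refl) (simp add: inner_commute)
  also have "\<dots> = (v \<bullet> x) * (w \<bullet> x) + (\<Sum>k\<in>UNIV. (v \<bullet> e k) * (w \<bullet> e k))"
    using nin inj by (simp add: sum.reindex)
  finally show ?thesis .
qed

text \<open>
  In the moving frame of \<open>x\<close> and \<open>e\<^sub>i = \<partial>\<^sub>i x / H i\<close> the rotation coefficients are the connection
  coefficients: \<open>\<partial>\<^sub>i e\<^sub>j = \<beta>\<^sub>j\<^sub>i e\<^sub>i\<close> for \<open>i \<noteq> j\<close>.  Both Lame equations then express that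
  \<open>\<partial>\<^sub>k\<close> and \<open>\<partial>\<^sub>i\<close> commute on the frame.
\<close>

lemma lame_equations_sphere:
  fixes x :: "real^'n::finite \<Rightarrow> real^'m::finite"
  assumes card: "CARD('m) = CARD('n) + 1" and V: "open V" and x: "smooth_on V x"
    and sphere: "\<And>u. u \<in> V \<Longrightarrow> x u \<bullet> x u = 1"
    and orth: "\<And>u i j. u \<in> V \<Longrightarrow> i \<noteq> j \<Longrightarrow> partial i x u \<bullet> partial j x u = 0"
    and pos: "\<And>u i. u \<in> V \<Longrightarrow> partial i x u \<bullet> partial i x u > 0"
    and H: "\<And>u i. u \<in> V \<Longrightarrow> H i u = sqrt (partial i x u \<bullet> partial i x u)"
  shows "lame_equations 1 V H"
proof -
  define X where "X i = partial i x" for i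
  note orth = orth[folded X_def] and pos = pos[folded X_def] and H = H[folded X_def]
  have sX: "smooth_on V (X i)" for i unfolding X_def by (rule smooth_on_partial[OF x])
  have sG: "smooth_on V (\<lambda>u. X i u \<bullet> X i u)" for i by (rule smooth_on_inner[OF V sX sX])
  have Hpos: "H i u > 0" if "u \<in> V" for i u using pos[OF that] H[OF that] by simp
  have H2: "H i u * H i u = X i u \<bullet> X i u" if "u \<in> V" for i u
    using pos[OF that, of i] H[OF that, of i] by simp
  have sH: "smooth_on V (H i)" for i
  proof (rule smooth_on_cong_open[OF V _ smooth_on_powr[OF V _ sG]])
    show "(X i v \<bullet> X i v) powr (1 / 2) = H i v" if "v \<in> V" for v
      using H[OF that, of i] pos[OF that, of i] by (simp add: powr_half_sqrt)
  qed (rule pos)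
  \<comment> \<open>The reciprocal is written as a power so that its smoothness follows from that of
    powers.\<close>
  define K where "K i u = H i u powr (- 1)" for i u
  have K: "K i u * H i u = 1" "H i u * K i u = 1" if "u \<in> V" for i u
    using Hpos[OF that, of i] by (simp_all add: K_def powr_minus)
  have Ki: "K i u = 1 / H i u" if "u \<in> V" for i u
    using Hpos[OF that, of i] by (simp add: K_def powr_minus divide_inverse)
  have sK: "smooth_on V (K i)" for i
    unfolding K_def[abs_def] by (rule smooth_on_powr[OF V Hpos sH])
  define e where "e i u = K i u *\<^sub>R X i u" for i u
  have se: "smooth_on V (e i)" for i
    unfolding e_def[abs_def] by (rule smooth_on_scaleR[OF V sK sX])
  note d = smooth_on_differentiable
  define D where "D i f u = partial i f u" for i and f :: "real^'n \<Rightarrow> real^'m" and u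
  have Dinner: "partial i (\<lambda>v. f v \<bullet> g v) u = f u \<bullet> D i g u + D i f u \<bullet> g u"
    if "smooth_on V f" "smooth_on V g" "u \<in> V" for i f u and g :: "real^'n \<Rightarrow> real^'m"
    unfolding D_def by (rule partial_inner[OF d[OF that(1,3)] d[OF that(2,3)]])
  have zero: "f u \<bullet> D i g u + D i f u \<bullet> g u = 0"
    if "smooth_on V f" "smooth_on V g" "u \<in> V" and c: "\<And>v. v \<in> V \<Longrightarrow> f v \<bullet> g v = c"
    for i f u c and g :: "real^'n \<Rightarrow> real^'m"
  proof -
    have "partial i (\<lambda>v. f v \<bullet> g v) u = partial i (\<lambda>_. c) u"
      by (rule partial_cong_open[OF V that(3) c])
    also have "\<dots> = 0" using partial_eq[OF has_derivative_const] by blast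
    finally show ?thesis using Dinner[OF that(1-3)] by simp
  qed
  have Xx: "X i u \<bullet> x u = 0" if u: "u \<in> V" for i u
    using zero[OF x x u sphere, of i] by (simp add: D_def X_def inner_commute)
  have sym: "D i (X j) u = D j (X i) u" if "u \<in> V" for i j u
    unfolding D_def X_def by (rule partial_commute[OF V x that])
  \<comment> \<open>The expression is symmetric in the first two indices, because derivatives
    commute, and antisymmetric in the last two, because of orthogonality; running through the three
    cyclic positions shows that it vanishes.\<close>
  have Xijk: "D i (X j) u \<bullet> X k u = 0" if u: "u \<in> V" and "i \<noteq> j" "j \<noteq> k" "i \<noteq> k" for i j k u
  proof -
    have z: "X a u \<bullet> D c (X b) u + D c (X a) u \<bullet> X b u = 0" if "a \<noteq> b" for a b c
      by (rule zero[OF sX sX u orth[OF _ that]])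
    show ?thesis
      using z[of i j k] z[of j k i] z[of i k j] that(2-4) sym[OF u, of i j] sym[OF u, of j k] sym[OF u, of i k]
      by (simp add: inner_commute)
  qed
  have Xiji: "D i (X j) u \<bullet> X i u = H i u * partial j (H i) u" if u: "u \<in> V" and "i \<noteq> j" for i j u
  proof -
    have "X i u \<bullet> D j (X i) u + D j (X i) u \<bullet> X i u = partial j (\<lambda>v. X i v \<bullet> X i v) u"
      by (rule Dinner[OF sX sX u, symmetric])
    also have "\<dots> = partial j (\<lambda>v. H i v \<bullet> H i v) u"
      by (rule partial_cong_open[OF V u]) (simp add: H2)
    also have "\<dots> = H i u \<bullet> partial j (H i) u + partial j (H i) u \<bullet> H i u"
      by (rule partial_inner[OF d[OF sH u] d[OF sH u]])
    finally show ?thesis using sym[OF u, of i j] by (simp add: inner_commute)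
  qed
  have ex: "e i u \<bullet> x u = 0" if "u \<in> V" for i u by (simp add: e_def Xx[OF that])
  have ee: "e i u \<bullet> e j u = (if i = j then 1 else 0)" if "u \<in> V" for i j u
    using K(1)[OF that, of i] orth[OF that, of i j] H2[OF that, of i, symmetric]
    by (auto simp: e_def algebra_simps)
  have eX: "e i u \<bullet> X j u = (if i = j then H i u else 0)" if "u \<in> V" for i j u
    using K(1)[OF that, of i] orth[OF that, of i j] H2[OF that, of i, symmetric]
    by (auto simp: e_def mult.assoc[symmetric])
  define b where "b = rotation_coeff H"
  have b: "b i j u = partial i (H j) u * K i u" if "u \<in> V" for i j u
    by (simp add: b_def rotation_coeff_def Ki[OF that])
  note frame = inner_orthonormal_frame[OF card]
  have Dee: "D i (e j) u \<bullet> e k u = (if k = i then b j i u else 0)" if u: "u \<in> V" and ij: "i \<noteq> j" for i j k u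
  proof (cases "k = j")
    case True
    have "e j u \<bullet> D i (e j) u + D i (e j) u \<bullet> e j u = 0"
      by (rule zero[OF se se u, of _ _ 1]) (simp add: ee)
    then show ?thesis using True ij by (simp add: inner_commute)
  next
    case False
    have "D i (e j) u = K j u *\<^sub>R D i (X j) u + partial i (K j) u *\<^sub>R X j u"
      unfolding D_def e_def[abs_def] by (rule partial_scaleR[OF d[OF sK u] d[OF sX u]])
    then have 1: "D i (e j) u \<bullet> e k u = K j u * K k u * (D i (X j) u \<bullet> X k u)"
      using orth[OF u, of j k] False by (simp add: inner_add_left e_def)
    show ?thesis
    proof (cases "k = i")
      case True
      then have "D i (e j) u \<bullet> e k u = K j u * K i u * (H i u * partial j (H i) u)"
        using 1 Xiji[OF u ij] by simp
      also have "\<dots> = (K i u * H i u) * (partial j (H i) u * K j u)" by simp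
      finally show ?thesis using True K[OF u, of i] b[OF u, of j i] by simp
    next
      case False
      then show ?thesis using 1 Xijk[OF u ij, of k] \<open>k \<noteq> j\<close> by auto
    qed
  qed
  have Dex: "D i (e j) u \<bullet> x u = - (if i = j then H j u else 0)" if u: "u \<in> V" for i j u
  proof -
    have "e j u \<bullet> D i x u + D i (e j) u \<bullet> x u = 0"
      by (rule zero[OF se x u ex])
    then show ?thesis using eX[OF u, of j i] by (cases "i = j") (simp_all add: D_def X_def)
  qed
  have De: "D i (e j) u = b j i u *\<^sub>R e i u" if u: "u \<in> V" and ij: "i \<noteq> j" for i j u
  proof (rule vector_eq_rdot[THEN iffD1], rule allI)
    fix w
    have "D i (e j) u \<bullet> w = (D i (e j) u \<bullet> x u) * (w \<bullet> x u) + (\<Sum>k\<in>UNIV. (D i (e j) u \<bullet> e k u) * (w \<bullet> e k u))"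
      by (rule frame[OF sphere[OF u]]) (simp_all add: ee[OF u] ex[OF u])
    also have "\<dots> = (\<Sum>k\<in>UNIV. if k = i then b j i u * (w \<bullet> e i u) else 0)"
      using ij by (simp add: Dex[OF u] Dee[OF u ij] if_distrib[of "\<lambda>t. t * _"] cong: if_cong sum.cong)
    also have "\<dots> = (b j i u *\<^sub>R e i u) \<bullet> w" by (simp add: inner_commute)
    finally show "D i (e j) u \<bullet> w = (b j i u *\<^sub>R e i u) \<bullet> w" .
  qed
  have sb: "smooth_on V (b i j)" for i j
    by (rule smooth_on_cong_open[OF V b[symmetric] smooth_on_mult[OF V smooth_on_partial[OF sH] sK]])
  have bD: "b i j v = D j (e i) v \<bullet> e j v" if "v \<in> V" "i \<noteq> j" for i j v
    using Dee[OF that(1), of j i j] that(2) by simp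
  have sD: "smooth_on V (D i f)" if "smooth_on V f" for i f
    unfolding D_def[abs_def] using smooth_on_partial[OF that] by simp
  have DD: "D i (D j f) u = D j (D i f) u" if "smooth_on V f" "u \<in> V" for i j f u
    using partial_commute[OF V that, of i j] unfolding D_def[abs_def] by simp
  \<comment> \<open>The derivatives are commuted in order to differentiate \<open>e i\<close> by
    \<open>k\<close> before \<open>j\<close>: for \<open>k \<noteq> i\<close> the inner derivative
    is then an explicit multiple of \<open>e k\<close>.\<close>
  have db: "partial k (b i j) u = D j (e i) u \<bullet> D k (e j) u + D j (D k (e i)) u \<bullet> e j u"
    if u: "u \<in> V" and ij: "i \<noteq> j" for i j k u
  proof -
    have "partial k (b i j) u = partial k (\<lambda>v. D j (e i) v \<bullet> e j v) u"
      by (rule partial_cong_open[OF V u]) (rule bD[OF _ ij])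
    also have "\<dots> = D j (e i) u \<bullet> D k (e j) u + D k (D j (e i)) u \<bullet> e j u"
      by (rule Dinner[OF sD[OF se] se u])
    finally show ?thesis using DD[OF se u] by simp
  qed
  have first: "partial k (b i j) u = b i k u * b k j u"
    if u: "u \<in> V" and ij: "i \<noteq> j" "j \<noteq> k" "i \<noteq> k" for i j k u
  proof -
    have "D j (D k (e i)) u = partial j (\<lambda>v. b i k v *\<^sub>R e k v) u"
      unfolding D_def[of j] by (rule partial_cong_open[OF V u]) (use De[of _ k i] ij in auto)
    also have "\<dots> = b i k u *\<^sub>R D j (e k) u + partial j (b i k) u *\<^sub>R e k u"
      unfolding D_def by (rule partial_scaleR[OF d[OF sb u] d[OF se u]])
    also have "\<dots> = b i k u *\<^sub>R (b k j u *\<^sub>R e j u) + partial j (b i k) u *\<^sub>R e k u"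
      using De[OF u, of j k] ij by simp
    finally have "D j (D k (e i)) u \<bullet> e j u = b i k u * b k j u"
      using ij ee[OF u] by (simp add: inner_add_left)
    moreover have "D j (e i) u \<bullet> D k (e j) u = 0"
      using De[OF u, of j i] De[OF u, of k j] ij ee[OF u] by simp
    ultimately show ?thesis using db[OF u ij(1), of k] by simp
  qed
  have second: "partial i (b i j) u + partial j (b j i) u + (\<Sum>m\<in>UNIV - {i, j}. b m i u * b m j u) = - H i u * H j u"
    if u: "u \<in> V" and ij: "i \<noteq> j" for i j u
  proof -
    have neg: "D a (e a) v \<bullet> e c v = - b c a v" if "v \<in> V" "a \<noteq> c" for a c v
    proof -
      have "e a v \<bullet> D a (e c) v + D a (e a) v \<bullet> e c v = 0"
        by (rule zero[OF se se that(1), of _ _ 0]) (use that(2) ee in simp)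
      then show ?thesis using Dee[OF that(1), of a c a] that(2) by (simp add: inner_commute)
    qed
    have self: "D a (e a) u \<bullet> e a u = 0" for a
    proof -
      have "e a u \<bullet> D a (e a) u + D a (e a) u \<bullet> e a u = 0"
        by (rule zero[OF se se u, of _ _ 1]) (simp add: ee)
      then show ?thesis by (simp add: inner_commute)
    qed
    have 1: "partial i (b i j) u = D j (D i (e i)) u \<bullet> e j u"
      using db[OF u ij, of i] De[OF u, of j i] De[OF u ij] ij ee[OF u] by simp
    \<comment> \<open>\<open>D i (e i)\<close> is not a multiple of a single frame vector, so
      \<open>b j i\<close> is rewritten as minus its component along \<open>e j\<close>. Then the
      second derivatives in the sum of both terms cancel, and only an inner product of first
      derivatives remains.\<close>
    have "partial j (b j i) u = partial j (\<lambda>v. (- D i (e i) v) \<bullet> e j v) u"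
      by (rule partial_cong_open[OF V u]) (use neg ij in simp)
    also have "\<dots> = (- D i (e i) u) \<bullet> D j (e j) u + D j (\<lambda>v. - D i (e i) v) u \<bullet> e j u"
      by (rule Dinner[OF smooth_on_bounded_linear[OF V bounded_linear_minus[OF bounded_linear_ident] sD[OF se]] se u])
    also have "D j (\<lambda>v. - D i (e i) v) u = - D j (D i (e i)) u"
      unfolding D_def[of j]
      by (rule partial_bounded_linear[OF bounded_linear_minus[OF bounded_linear_ident] d[OF sD[OF se] u]])
    finally have 2: "partial i (b i j) u + partial j (b j i) u = - (D i (e i) u \<bullet> D j (e j) u)"
      using 1 by simp
    \<comment> \<open>Expanded in the frame, the \<open>x\<close> components contribute
      \<open>H i u * H j u\<close>, the components along \<open>e i\<close> and \<open>e j\<close>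
      vanish, and the others give the sum of products of rotation coefficients.\<close>
    have "D i (e i) u \<bullet> D j (e j) u = (D i (e i) u \<bullet> x u) * (D j (e j) u \<bullet> x u) +
        (\<Sum>k\<in>UNIV. (D i (e i) u \<bullet> e k u) * (D j (e j) u \<bullet> e k u))"
      by (rule frame[OF sphere[OF u]]) (simp_all add: ee[OF u] ex[OF u])
    also have "(\<Sum>k\<in>UNIV. (D i (e i) u \<bullet> e k u) * (D j (e j) u \<bullet> e k u)) =
        (\<Sum>k\<in>UNIV - {i, j}. (D i (e i) u \<bullet> e k u) * (D j (e j) u \<bullet> e k u))"
      by (rule sum.mono_neutral_right) (auto simp: self)
    also have "\<dots> = (\<Sum>k\<in>UNIV - {i, j}. b k i u * b k j u)"
      by (rule sum.cong) (auto simp: neg[OF u])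
    finally show ?thesis using 2 Dex[OF u] by simp
  qed
  show ?thesis
    unfolding lame_equations_def Let_def b_def[symmetric]
    using sH Hpos first second by (auto simp: less_imp_neq[symmetric])
qed

section \<open>Integration over the complex plane\<close>

text \<open>The change of variables formula is stated for maps of \<open>real^'n\<close>, so the
  complex plane is identified with \<open>real^Enum.finite_2\<close>, whose index type has two
  elements.\<close>

definition plane_of :: "complex \<Rightarrow> real^Enum.finite_2" where
  "plane_of w = (\<chi> k. if k = Enum.finite_2.a\<^sub>1 then Re w else Im w)"

definition of_plane :: "real^Enum.finite_2 \<Rightarrow> complex" where
  "of_plane v = Complex (v $ Enum.finite_2.a\<^sub>1) (v $ Enum.finite_2.a\<^sub>2)"

lemma of_plane_of [simp]: "of_plane (plane_of w) = w"
  by (simp add: of_plane_def plane_of_def)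

lemma plane_of_plane [simp]: "plane_of (of_plane v) = v"
  by (auto simp: vec_eq_iff of_plane_def plane_of_def)

lemma bounded_linear_plane_of: "bounded_linear plane_of"
proof (subst linear_conv_bounded_linear [symmetric], rule linearI)
qed (auto simp: plane_of_def vec_eq_iff)

lemma bounded_linear_of_plane: "bounded_linear of_plane"
proof (subst linear_conv_bounded_linear [symmetric], rule linearI)
qed (auto simp: of_plane_def complex_eq_iff)

text \<open>Lebesgue measure is determined by its values on boxes, and the preimage of a box is the
  box with the same side lengths.\<close>

lemma distr_of_plane: "distr lborel borel of_plane = (lborel :: complex measure)"
proof (rule lborel_eqI [symmetric])
  have [measurable]: "of_plane \<in> borel \<rightarrow>\<^sub>M borel"
    by (intro borel_measurable_continuous_onI linear_continuous_on bounded_linear_of_plane)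
  fix l u :: complex assume le: "\<And>b. b \<in> Basis \<Longrightarrow> l \<bullet> b \<le> u \<bullet> b"
  have [simp]: "Re l \<le> Re u" "Im l \<le> Im u"
    using le[of 1] le[of \<i>] by (auto simp: Basis_complex_def)
  have all2: "(\<forall>k. Q k) \<longleftrightarrow> Q Enum.finite_2.a\<^sub>1 \<and> Q Enum.finite_2.a\<^sub>2" for Q :: "Enum.finite_2 \<Rightarrow> bool"
    by (metis finite_2.exhaust)
  have "of_plane -` box l u = box (plane_of l) (plane_of u)"
    by (auto simp: box_complex_eq in_box_complex_iff mem_box_cart plane_of_def of_plane_def all2)
  then have "emeasure (distr lborel borel of_plane) (box l u) = emeasure lborel (box (plane_of l) (plane_of u))"
    by (simp add: emeasure_distr)
  also have "\<dots> = ennreal (\<Prod>b\<in>Basis. (plane_of u - plane_of l) \<bullet> b)"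
  proof (rule emeasure_lborel_box)
    show "\<And>b. b \<in> Basis \<Longrightarrow> plane_of l \<bullet> b \<le> plane_of u \<bullet> b"
      by (auto simp: Basis_vec_def inner_axis plane_of_def)
  qed
  also have "(\<Prod>b\<in>Basis. (plane_of u - plane_of l) \<bullet> b) = (\<Prod>b\<in>Basis. (u - l) \<bullet> b)"
  proof -
    have B: "(Basis :: (real^Enum.finite_2) set) = {axis Enum.finite_2.a\<^sub>1 1, axis Enum.finite_2.a\<^sub>2 1}"
      by (auto simp: Basis_vec_def UNIV_finite_2)
    have "axis Enum.finite_2.a\<^sub>1 1 \<noteq> (axis Enum.finite_2.a\<^sub>2 1 :: real^Enum.finite_2)"
      by (simp add: axis_eq_axis)
    then show ?thesis
      unfolding B by (simp add: inner_axis plane_of_def Basis_complex_def)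
  qed
  finally show "emeasure (distr lborel borel of_plane) (box l u) = ennreal (\<Prod>b\<in>Basis. (u - l) \<bullet> b)" .
qed simp

lemma det_finite_2:
  "det (A :: real^Enum.finite_2^Enum.finite_2) =
     A $ Enum.finite_2.a\<^sub>1 $ Enum.finite_2.a\<^sub>1 * A $ Enum.finite_2.a\<^sub>2 $ Enum.finite_2.a\<^sub>2 -
     A $ Enum.finite_2.a\<^sub>1 $ Enum.finite_2.a\<^sub>2 * A $ Enum.finite_2.a\<^sub>2 $ Enum.finite_2.a\<^sub>1"
proof -
  have f12: "finite {Enum.finite_2.a\<^sub>2}" "Enum.finite_2.a\<^sub>1 \<notin> {Enum.finite_2.a\<^sub>2}" by auto
  have U: "(UNIV :: Enum.finite_2 set) = {Enum.finite_2.a\<^sub>1, Enum.finite_2.a\<^sub>2}"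
    by (simp add: UNIV_finite_2)
  show ?thesis
    unfolding det_def U
    unfolding sum_over_permutations_insert[OF f12]
    unfolding permutes_sing
    by (simp add: sign_swap_id sign_id swap_id_eq)
qed

lemma set_integrable_compact:
  fixes f :: "complex \<Rightarrow> complex"
  assumes "compact K" "continuous_on K f"
  shows "set_integrable lborel K f"
  using borel_integrable_compact[OF assms] by (simp add: set_integrable_def)

text \<open>Bridge between the Lebesgue integral over complex sets, in which the surface integrals
  are written, and the gauge integral over \<open>real^Enum.finite_2\<close> that occurs in the
  change of variables formula.\<close>

lemma set_integral_of_plane:
  fixes f :: "complex \<Rightarrow> complex"
  assumes K: "compact K" "continuous_on K f"
  shows "plane_of (LINT w:K|lborel. f w) = integral (plane_of ` K) (plane_of \<circ> f \<circ> of_plane)"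
    and "(plane_of \<circ> f \<circ> of_plane) absolutely_integrable_on plane_of ` K"
proof -
  have [measurable]: "of_plane \<in> borel \<rightarrow>\<^sub>M borel"
    by (intro borel_measurable_continuous_onI linear_continuous_on bounded_linear_of_plane)
  have int: "integrable lborel (\<lambda>w. indicator K w *\<^sub>R f w)"
    using set_integrable_compact[OF K] by (simp add: set_integrable_def)
  then have "integrable (distr lborel borel of_plane) (\<lambda>w. indicator K w *\<^sub>R f w)"
    by (simp add: distr_of_plane)
  then have int': "integrable lborel (\<lambda>v. indicator K (of_plane v) *\<^sub>R f (of_plane v))"
    by (subst (asm) integrable_distr_eq) (use int in auto)
  have eqK: "of_plane v \<in> K \<longleftrightarrow> v \<in> plane_of ` K" for v
    by (metis image_iff of_plane_of plane_of_plane)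
  have ind: "indicator K (of_plane v) = (indicator (plane_of ` K) v :: real)" for v
    by (simp add: indicator_def eqK)
  have int2: "integrable lborel (\<lambda>v. indicator (plane_of ` K) v *\<^sub>R plane_of (f (of_plane v)))"
    using integrable_bounded_linear[OF bounded_linear_plane_of int']
    by (simp add: ind bounded_linear.linear bounded_linear_plane_of linear_scale)
  have si: "set_integrable lborel (plane_of ` K) (plane_of \<circ> f \<circ> of_plane)"
    using int2 by (simp add: set_integrable_def)
  have "(LINT w:K|lborel. f w) = integral\<^sup>L (distr lborel borel of_plane) (\<lambda>w. indicator K w *\<^sub>R f w)"
    by (simp add: distr_of_plane set_lebesgue_integral_def)
  also have "\<dots> = (LINT v|lborel. indicator K (of_plane v) *\<^sub>R f (of_plane v))"
    by (rule integral_distr) (use int in auto)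
  finally have "plane_of (LINT w:K|lborel. f w) =
      (LINT v|lborel. plane_of (indicator K (of_plane v) *\<^sub>R f (of_plane v)))"
    by (simp add: integral_bounded_linear[OF bounded_linear_plane_of int'])
  also have "\<dots> = (LINT v:plane_of ` K|lborel. (plane_of \<circ> f \<circ> of_plane) v)"
    by (simp add: set_lebesgue_integral_def ind bounded_linear.linear bounded_linear_plane_of linear_scale)
  also have "\<dots> = integral (plane_of ` K) (plane_of \<circ> f \<circ> of_plane)"
    by (rule set_borel_integral_eq_integral[OF si])
  finally show "plane_of (LINT w:K|lborel. f w) = integral (plane_of ` K) (plane_of \<circ> f \<circ> of_plane)" .
  show "(plane_of \<circ> f \<circ> of_plane) absolutely_integrable_on plane_of ` K"
  proof -
    have "(\<lambda>v. indicator (plane_of ` K) v *\<^sub>R plane_of (f (of_plane v))) \<in> borel_measurable lborel"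
      using int2 by auto
    then show ?thesis
      unfolding set_integrable_def o_def
      using int2 integrable_completion by blast
  qed
qed

text \<open>The differential of \<open>T\<close> is multiplication by the complex number
  \<open>deriv T w\<close>, whose determinant as a real map is the square of its modulus.\<close>

lemma holomorphic_change_of_variables:
  fixes T f :: "complex \<Rightarrow> complex"
  assumes X: "open X" "T holomorphic_on X" and K: "compact K" "K \<subseteq> X" and inj: "inj_on T K"
    and f: "continuous_on (T ` K) f"
  shows "(LINT w:K|lborel. of_real ((cmod (deriv T w))\<^sup>2) * f (T w)) = (LINT v:T ` K|lborel. f v)"
proof -
  define g where "g = plane_of \<circ> T \<circ> of_plane"
  define g' where "g' x = plane_of \<circ> (\<lambda>h. deriv T (of_plane x) * h) \<circ> of_plane" for x
  define S where "S = plane_of ` K"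
  have TK: "compact (T ` K)" "continuous_on K T"
    using K X holomorphic_on_imp_continuous_on continuous_on_subset compact_continuous_image by blast+
  have "compact S" unfolding S_def
    by (intro compact_continuous_image linear_continuous_on bounded_linear_plane_of K)
  have der: "(g has_derivative g' x) (at x within S)" if "x \<in> S" for x
  proof -
    have "of_plane x \<in> X" using that K by (auto simp: S_def)
    then have "(T has_derivative (*) (deriv T (of_plane x))) (at (of_plane x))"
      using X holomorphic_derivI has_field_derivative_imp_has_derivative by blast
    then have "(T has_derivative (\<lambda>h. deriv T (of_plane x) * h)) (at (of_plane x) within range of_plane)"
      by (simp add: has_derivative_at_withinI)
    then have "((T \<circ> of_plane) has_derivative (\<lambda>h. deriv T (of_plane x) * h) \<circ> of_plane) (at x within UNIV)"
      by (intro diff_chain_within bounded_linear.has_derivative[OF bounded_linear_of_plane, of "\<lambda>x. x" "\<lambda>x. x", simplified]) auto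
    then have "(plane_of \<circ> (T \<circ> of_plane) has_derivative plane_of \<circ> ((\<lambda>h. deriv T (of_plane x) * h) \<circ> of_plane)) (at x within UNIV)"
      unfolding o_def by (rule bounded_linear.has_derivative[OF bounded_linear_plane_of])
    then show ?thesis
      unfolding g_def g'_def o_def using has_derivative_at_withinI by blast
  qed
  have gS: "g ` S = plane_of ` (T ` K)"
    by (force simp: g_def S_def image_image)
  have injS: "inj_on g S"
    using inj unfolding inj_on_def S_def g_def
    by (metis (no_types, lifting) comp_apply imageE of_plane_of)
  have det: "\<bar>det (matrix (g' x))\<bar> = (cmod (deriv T (of_plane x)))\<^sup>2" for x
    by (simp add: det_finite_2 matrix_def g'_def plane_of_def of_plane_def axis_def cmod_power2)
       (simp add: power2_eq_square)
  define F where "F = plane_of \<circ> f \<circ> of_plane"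
  have 1: "plane_of (LINT w:T ` K|lborel. f w) = integral (g ` S) F" "F absolutely_integrable_on g ` S"
    unfolding F_def gS using set_integral_of_plane[OF TK(1) f] by auto
  have "continuous_on K (\<lambda>w. of_real ((cmod (deriv T w))\<^sup>2) * f (T w))"
    using K X TK holomorphic_deriv[OF X(2,1)]
    by (intro continuous_intros continuous_on_compose2[OF f])
       (auto dest!: holomorphic_on_imp_continuous_on intro: continuous_on_subset)
  note 2 = set_integral_of_plane(1)[OF K(1) this]
  have "integral S (\<lambda>x. \<bar>det (matrix (g' x))\<bar> *\<^sub>R F (g x)) = integral (g ` S) F"
    using has_absolute_integral_change_of_variables_compact[OF \<open>compact S\<close> der injS, of F "integral (g ` S) F"]
      1(2) by simp
  also have "integral S (\<lambda>x. \<bar>det (matrix (g' x))\<bar> *\<^sub>R F (g x)) =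
     plane_of (LINT w:K|lborel. of_real ((cmod (deriv T w))\<^sup>2) * f (T w))"
    unfolding 2 S_def[symmetric] det F_def g_def
    by (simp add: o_def) (metis (no_types, lifting) bounded_linear.linear bounded_linear_plane_of linear_scale scaleR_conv_of_real of_real_power)
  finally show ?thesis using 1(1) by (metis of_plane_of)
qed

section \<open>The Cauchy-Riemann operator on continuously differentiable functions\<close>

text \<open>The Wirtinger derivative with respect to the conjugate variable: it vanishes where the
  differential is complex linear.\<close>

definition dbar :: "(complex \<Rightarrow> complex) \<Rightarrow> complex \<Rightarrow> complex" where
  "dbar f w = (frechet_derivative f (at w) 1 + \<i> * frechet_derivative f (at w) \<i>) / 2"

text \<open>Continuity is asked for the two values of the differential at 1 and \<i>, which
  determine it by real linearity.\<close>

definition C1_on :: "complex set \<Rightarrow> (complex \<Rightarrow> complex) \<Rightarrow> bool" where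
  "C1_on D f \<longleftrightarrow> (\<forall>w\<in>D. f differentiable (at w)) \<and>
     continuous_on D (\<lambda>w. frechet_derivative f (at w) 1) \<and>
     continuous_on D (\<lambda>w. frechet_derivative f (at w) \<i>)"

lemma complex_linear_expand:
  assumes "linear (F :: complex \<Rightarrow> complex)"
  shows "F h = of_real (Re h) * F 1 + of_real (Im h) * F \<i>"
proof -
  have "F h = F (Re h *\<^sub>R 1 + Im h *\<^sub>R \<i>)"
    by (rule arg_cong[where f=F]) (simp add: complex_eq_iff)
  also have "\<dots> = Re h *\<^sub>R F 1 + Im h *\<^sub>R F \<i>"
    using assms by (simp only: linear_add linear_scale)
  finally show ?thesis by (simp add: scaleR_conv_of_real)
qed

lemma dbar_eq:
  assumes "(f has_derivative F) (at w)"
  shows "dbar f w = (F 1 + \<i> * F \<i>) / 2"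
  using frechet_derivative_at[OF assms] by (simp add: dbar_def)

lemma C1_on_derivative:
  assumes "C1_on D f" "w \<in> D"
  shows "(f has_derivative frechet_derivative f (at w)) (at w)"
  using assms by (simp add: C1_on_def frechet_derivative_works)

lemma C1_onI:
  assumes "\<And>w. w \<in> D \<Longrightarrow> (f has_derivative F w) (at w)"
    and "continuous_on D (\<lambda>w. F w 1)" "continuous_on D (\<lambda>w. F w \<i>)"
  shows "C1_on D f"
proof -
  have "frechet_derivative f (at w) = F w" if "w \<in> D" for w
    using frechet_derivative_at[OF assms(1)[OF that]] by simp
  then show ?thesis
    using assms unfolding C1_on_def
    by (auto simp: differentiable_def cong: continuous_on_cong)
qed

lemma C1_on_subset: "C1_on D f \<Longrightarrow> E \<subseteq> D \<Longrightarrow> C1_on E f"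
  unfolding C1_on_def using continuous_on_subset by blast

lemma C1_on_Un: "C1_on D f \<Longrightarrow> C1_on E f \<Longrightarrow> open D \<Longrightarrow> open E \<Longrightarrow> C1_on (D \<union> E) f"
  unfolding C1_on_def by (auto intro: continuous_on_open_Un)

lemma C1_on_continuous: "C1_on D f \<Longrightarrow> continuous_on D f"
  unfolding C1_on_def
  by (meson continuous_at_imp_continuous_on differentiable_imp_continuous_within)

lemma continuous_on_dbar: "C1_on D f \<Longrightarrow> continuous_on D (dbar f)"
  unfolding C1_on_def dbar_def[abs_def] by (intro continuous_intros) auto

lemma frechet_derivative_cong_open:
  assumes "open D" "w \<in> D" "\<And>v. v \<in> D \<Longrightarrow> f v = g v"
  shows "frechet_derivative f (at w) = frechet_derivative g (at w)"
proof -
  have "(f has_derivative F) (at w) \<longleftrightarrow> (g has_derivative F) (at w)" for F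
    using assms by (metis has_derivative_transform_within_open)
  then show ?thesis by (simp add: frechet_derivative_def)
qed

lemma dbar_cong_open:
  assumes "open D" "w \<in> D" "\<And>v. v \<in> D \<Longrightarrow> f v = g v"
  shows "dbar f w = dbar g w"
  using frechet_derivative_cong_open[OF assms] by (simp add: dbar_def)

lemma C1_on_cong_open:
  assumes D: "open D" and eq: "\<And>v. v \<in> D \<Longrightarrow> f v = g v" and f: "C1_on D f"
  shows "C1_on D g"
proof (rule C1_onI)
  show "(g has_derivative frechet_derivative f (at w)) (at w)" if "w \<in> D" for w
    by (rule has_derivative_transform_within_open[OF C1_on_derivative[OF f that] D that eq])
qed (use f in \<open>auto simp: C1_on_def\<close>)

lemma C1_on_const: "C1_on D (\<lambda>_. c)" and dbar_const: "dbar (\<lambda>_. c) w = 0"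
  by (rule C1_onI[where F = "\<lambda>_ _. 0"]) (auto simp: dbar_eq[of _ "\<lambda>_. 0"])

lemma C1_on_holomorphic:
  assumes "open D" "f holomorphic_on D"
  shows "C1_on D f" and "w \<in> D \<Longrightarrow> dbar f w = 0"
proof -
  have d: "(f has_derivative (*) (deriv f w)) (at w)" if "w \<in> D" for w
    using assms that holomorphic_derivI has_field_derivative_imp_has_derivative by blast
  have "continuous_on D (deriv f)"
    using assms holomorphic_deriv holomorphic_on_imp_continuous_on by blast
  then show "C1_on D f"
    using d by (intro C1_onI[where F = "\<lambda>w h. deriv f w * h"]) (auto intro: continuous_intros)
  show "w \<in> D \<Longrightarrow> dbar f w = 0"
    using dbar_eq[OF d] by (simp add: field_simps)
qed

lemma C1_on_add:
  assumes "C1_on D f" "C1_on D g"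
  shows "C1_on D (\<lambda>w. f w + g w)" and "w \<in> D \<Longrightarrow> dbar (\<lambda>w. f w + g w) w = dbar f w + dbar g w"
proof -
  have d: "((\<lambda>w. f w + g w) has_derivative (\<lambda>h. frechet_derivative f (at w) h + frechet_derivative g (at w) h)) (at w)"
    if "w \<in> D" for w
    using assms that by (intro has_derivative_add C1_on_derivative)
  show "C1_on D (\<lambda>w. f w + g w)"
    by (rule C1_onI[OF d]) (use assms in \<open>auto simp: C1_on_def intro!: continuous_intros\<close>)
  show "dbar (\<lambda>w. f w + g w) w = dbar f w + dbar g w" if "w \<in> D"
    unfolding dbar_eq[OF d[OF that]] by (simp add: dbar_def field_simps)
qed

lemma C1_on_mult:
  assumes "C1_on D f" "C1_on D g"
  shows "C1_on D (\<lambda>w. f w * g w)"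
    and "w \<in> D \<Longrightarrow> dbar (\<lambda>w. f w * g w) w = dbar f w * g w + f w * dbar g w"
proof -
  have d: "((\<lambda>w. f w * g w) has_derivative (\<lambda>h. f w * frechet_derivative g (at w) h + frechet_derivative f (at w) h * g w)) (at w)"
    if "w \<in> D" for w
    using assms that by (intro has_derivative_mult C1_on_derivative)
  show "C1_on D (\<lambda>w. f w * g w)"
    using assms C1_on_continuous[OF assms(1)] C1_on_continuous[OF assms(2)]
    by (intro C1_onI[OF d] continuous_intros) (auto simp: C1_on_def)
  show "dbar (\<lambda>w. f w * g w) w = dbar f w * g w + f w * dbar g w" if "w \<in> D"
    unfolding dbar_eq[OF d[OF that]] by (simp add: dbar_def field_simps)
qed

lemma C1_on_sum:
  assumes "finite I" "\<And>i. i \<in> I \<Longrightarrow> C1_on D (f i)"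
  shows "C1_on D (\<lambda>w. \<Sum>i\<in>I. f i w) \<and> (\<forall>w\<in>D. dbar (\<lambda>w. \<Sum>i\<in>I. f i w) w = (\<Sum>i\<in>I. dbar (f i) w))"
  using assms
proof (induction I rule: finite_induct)
  case empty
  then show ?case by (simp add: C1_on_const dbar_const)
next
  case (insert i I)
  then show ?case
    using C1_on_add[of D "f i" "\<lambda>w. \<Sum>i\<in>I. f i w"] by simp
qed

lemma C1_on_inverse:
  assumes f: "C1_on D f" and nz: "\<And>w. w \<in> D \<Longrightarrow> f w \<noteq> 0"
  shows "C1_on D (\<lambda>w. inverse (f w))"
proof (rule C1_onI)
  show "((\<lambda>w. inverse (f w)) has_derivative
      (\<lambda>h. - (inverse (f w) * frechet_derivative f (at w) h * inverse (f w)))) (at w)" if "w \<in> D" for w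
    using Deriv.has_derivative_inverse[OF nz C1_on_derivative[OF f]] that by blast
qed (use f C1_on_continuous[OF f] nz in \<open>auto simp: C1_on_def intro!: continuous_intros\<close>)

text \<open>Only the conjugate of the derivative of \<open>T\<close> appears, since the differential
  of \<open>T\<close> is complex linear. Together with the factor \<open>deriv T w\<close> in the
  transformation law of a 1-form it yields the Jacobian of \<open>T\<close>.\<close>

lemma C1_on_compose:
  assumes D: "open D" "T holomorphic_on D" "T ` D \<subseteq> E" and f: "C1_on E f"
  shows "C1_on D (f \<circ> T)" and "w \<in> D \<Longrightarrow> dbar (f \<circ> T) w = dbar f (T w) * cnj (deriv T w)"
proof -
  let ?F = "\<lambda>w. frechet_derivative f (at w)"
  have d: "((f \<circ> T) has_derivative (\<lambda>h. ?F (T w) (deriv T w * h))) (at w)" if "w \<in> D" for w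
  proof -
    have "(T has_derivative (*) (deriv T w)) (at w)"
      using D that holomorphic_derivI has_field_derivative_imp_has_derivative by blast
    moreover have "(f has_derivative ?F (T w)) (at (T w))"
      using f D(3) that by (intro C1_on_derivative) auto
    ultimately show ?thesis
      using diff_chain_at by (fastforce simp: o_def)
  qed
  have ex: "?F (T w) h = of_real (Re h) * ?F (T w) 1 + of_real (Im h) * ?F (T w) \<i>" if "w \<in> D" for w h
    using C1_on_derivative[OF f, of "T w"] D(3) that
    by (intro complex_linear_expand) (auto dest: has_derivative_linear)
  have cT: "continuous_on D T" "continuous_on D (deriv T)"
    using D holomorphic_deriv holomorphic_on_imp_continuous_on by blast+
  have c: "continuous_on D (\<lambda>w. ?F (T w) 1)" "continuous_on D (\<lambda>w. ?F (T w) \<i>)"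
    using f D(3) cT unfolding C1_on_def
    by (auto intro!: continuous_on_compose2[of E _ D T])
  show "C1_on D (f \<circ> T)"
  proof (rule C1_onI[OF d])
    have "continuous_on D (\<lambda>w. of_real (Re (deriv T w * v)) * ?F (T w) 1 + of_real (Im (deriv T w * v)) * ?F (T w) \<i>)" for v
      by (intro continuous_intros c cT)
    then have "continuous_on D (\<lambda>w. ?F (T w) (deriv T w * v))" for v
      by (rule continuous_on_eq) (rule ex[symmetric])
    then show "continuous_on D (\<lambda>w. ?F (T w) (deriv T w * 1))" "continuous_on D (\<lambda>w. ?F (T w) (deriv T w * \<i>))"
      by blast+
  qed auto
  show "dbar (f \<circ> T) w = dbar f (T w) * cnj (deriv T w)" if "w \<in> D"
  proof -
    define p q where "p = ?F (T w) 1" and "q = ?F (T w) \<i>"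
    have "dbar (f \<circ> T) w = ((of_real (Re (deriv T w)) * p + of_real (Im (deriv T w)) * q) +
        \<i> * (of_real (- Im (deriv T w)) * p + of_real (Re (deriv T w)) * q)) / 2"
      unfolding dbar_eq[OF d[OF that]] p_def q_def
      using ex[OF that, of "deriv T w * 1"] ex[OF that, of "deriv T w * \<i>"] by simp
    also have "\<dots> = (p + \<i> * q) / 2 * cnj (deriv T w)"
      by (auto simp: complex_eq_iff algebra_simps)
    finally show ?thesis by (simp add: p_def q_def dbar_def)
  qed
qed

section \<open>Stokes' theorem for compactly supported functions in the plane\<close>

lemma integral_lborel_translation:
  fixes f :: "complex \<Rightarrow> complex"
  assumes "integrable lborel f"
  shows "(LINT w|lborel. f (c + w)) = (LINT w|lborel. f w)" "integrable lborel (\<lambda>w. f (c + w))"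
proof -
  have [measurable]: "f \<in> borel_measurable borel" using assms by auto
  have "(LINT w|lborel. f w) = integral\<^sup>L (distr lborel borel ((+) c)) f"
    by (simp add: lborel_distr_plus)
  also have "\<dots> = (LINT w|lborel. f (c + w))"
    by (rule integral_distr) auto
  finally show "(LINT w|lborel. f (c + w)) = (LINT w|lborel. f w)" ..
  have "integrable (distr lborel borel ((+) c)) f" using assms by (simp add: lborel_distr_plus)
  then show "integrable lborel (\<lambda>w. f (c + w))"
    by (subst (asm) integrable_distr_eq) auto
qed

lemma integrable_compact_support:
  fixes f :: "complex \<Rightarrow> complex"
  assumes "compact K" "continuous_on K f" "\<And>w. w \<notin> K \<Longrightarrow> f w = 0"
  shows "integrable lborel f" and "(LINT w|lborel. f w) = (LINT w:K|lborel. f w)"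
proof -
  have "f = (\<lambda>w. indicator K w *\<^sub>R f w)"
    using assms(3) by (auto simp: indicator_def fun_eq_iff)
  then show "integrable lborel f" "(LINT w|lborel. f w) = (LINT w:K|lborel. f w)"
    using set_integrable_compact[OF assms(1,2)]
    by (auto simp: set_integrable_def set_lebesgue_integral_def)
qed

lemma set_integral_restrict:
  fixes f :: "complex \<Rightarrow> complex"
  assumes "K' \<subseteq> K" "\<And>w. w \<in> K - K' \<Longrightarrow> f w = 0"
  shows "(LINT w:K|lborel. f w) = (LINT w:K'|lborel. f w)"
  unfolding set_lebesgue_integral_def
  by (rule Bochner_Integration.integral_cong) (use assms in \<open>auto simp: indicator_def\<close>)

lemma set_integral_sum:
  fixes f :: "'i \<Rightarrow> complex \<Rightarrow> complex"
  assumes "\<And>i. i \<in> I \<Longrightarrow> set_integrable lborel K (f i)"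
  shows "(LINT w:K|lborel. \<Sum>i\<in>I. f i w) = (\<Sum>i\<in>I. LINT w:K|lborel. f i w)"
  using assms unfolding set_lebesgue_integral_def set_integrable_def scaleR_sum_right
  by (rule Bochner_Integration.integral_sum)

text \<open>By translation invariance the integral of \<open>f (w + v / n) - f w\<close> vanishes for every \<open>n\<close>.\<close>

lemma integral_directional_derivative_eq_0:
  fixes f :: "complex \<Rightarrow> complex"
  assumes f: "C1_on UNIV f" and K: "compact K" "\<And>w. w \<notin> K \<Longrightarrow> f w = 0"
    and v: "v = 1 \<or> v = \<i>"
  shows "(LINT w|lborel. frechet_derivative f (at w) v) = 0"
proof -
  let ?F = "\<lambda>w. frechet_derivative f (at w)"
  have lin: "linear (?F w)" for w
    using C1_on_derivative[OF f] has_derivative_linear by blast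
  obtain M where M: "K \<subseteq> cball 0 M" "0 < M"
    using compact_imp_bounded[OF K(1)] bounded_subset_ballD ball_subset_cball by (metis order_trans)
  have out: "f w = 0" if "norm w > M" for w
    using K(2) M that by (metis in_mono mem_cball_0 not_le)
  \<comment> \<open>The difference quotients vanish for \<open>norm w > M + 1\<close>. For other
    \<open>w\<close> both \<open>w\<close> and its translate by a vector of length at most 1 lie in
    \<open>C\<close>, where the differential is bounded by \<open>B\<close>; so they are dominated
    by \<open>B\<close> on a ball.\<close>
  define C where "C = cball (0::complex) (M + 2)"
  have C: "compact C" "convex C" by (auto simp: C_def)
  have cf: "continuous_on UNIV f" by (rule C1_on_continuous[OF f])
  have "bounded (G' ` C)" if "continuous_on UNIV G'" for G' :: "complex \<Rightarrow> complex"
    using that C by (meson compact_continuous_image compact_imp_bounded continuous_on_subset subset_UNIV)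
  then have "bounded ((\<lambda>w. ?F w 1) ` C)" "bounded ((\<lambda>w. ?F w \<i>) ` C)"
    using f by (auto simp: C1_on_def)
  then obtain B1 B2 where B: "\<And>w. w \<in> C \<Longrightarrow> norm (?F w 1) \<le> B1" "\<And>w. w \<in> C \<Longrightarrow> norm (?F w \<i>) \<le> B2"
    unfolding bounded_iff by auto
  define B where "B = B1 + B2"
  have on: "onorm (?F w) \<le> B" if "w \<in> C" for w
  proof (rule onorm_le)
    fix h
    have "norm (?F w h) \<le> \<bar>Re h\<bar> * norm (?F w 1) + \<bar>Im h\<bar> * norm (?F w \<i>)"
    proof -
      have "norm (?F w h) = norm (of_real (Re h) * ?F w 1 + of_real (Im h) * ?F w \<i>)"
        by (rule arg_cong[OF complex_linear_expand[OF lin]])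
      also have "\<dots> \<le> norm (of_real (Re h) * ?F w 1) + norm (of_real (Im h) * ?F w \<i>)"
        by (rule norm_triangle_ineq)
      finally show ?thesis by (simp add: norm_mult)
    qed
    also have "\<dots> \<le> norm h * B1 + norm h * B2"
      using B[OF that] by (intro add_mono mult_mono abs_Re_le_cmod abs_Im_le_cmod) auto
    finally show "norm (?F w h) \<le> B * norm h" by (simp add: B_def algebra_simps)
  qed
  have Lip: "norm (f x - f y) \<le> B * norm (x - y)" if "x \<in> C" "y \<in> C" for x y
  proof (rule differentiable_bound[OF C(2) _ _ that])
    show "(f has_derivative ?F w) (at w within C)" if "w \<in> C" for w
      using C1_on_derivative[OF f] has_derivative_at_withinI by blast
  qed (use on in auto)
  have intf: "integrable lborel f"
    using integrable_compact_support[OF K(1) continuous_on_subset[OF cf]] K(2) by auto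
  \<comment> \<open>The difference quotient with step \<open>v / Suc n\<close>. Its integral is 0 by
    translation invariance, and it converges to the derivative in direction
    \<open>v\<close>.\<close>
  define s where "s n w = (of_nat (Suc n)) * (f (v / of_nat (Suc n) + w) - f w)" for n w
  have zero: "(LINT w|lborel. s n w) = 0" for n
    unfolding s_def using integral_lborel_translation[OF intf, of "v / of_nat (Suc n)"] intf by simp
  have nv: "norm v = 1" using v by auto
  have lim: "(\<lambda>n. LINT w|lborel. s n w) \<longlonglongrightarrow> (LINT w|lborel. ?F w v)"
  proof (rule integral_dominated_convergence[where w = "\<lambda>w. indicator (cball 0 (M + 1)) w * B"])
    have [measurable]: "f \<in> borel_measurable borel" using cf by (rule borel_measurable_continuous_onI)
    have "continuous_on UNIV (\<lambda>w. ?F w v)" using f v by (auto simp: C1_on_def)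
    then show "(\<lambda>w. ?F w v) \<in> borel_measurable lborel"
      by (simp add: borel_measurable_continuous_onI)
    show "s n \<in> borel_measurable lborel" for n
      unfolding s_def[abs_def] by measurable
    show "integrable lborel (\<lambda>w::complex. indicat_real (cball 0 (M + 1)) w * B)"
      using emeasure_bounded_finite[OF bounded_cball, of "0::complex" "M + 1"]
      by (intro integrable_mult_left integrable_real_indicator) auto
    show "AE w in lborel. (\<lambda>n. s n w) \<longlonglongrightarrow> ?F w v"
    proof (rule AE_I2)
      fix w
      have *: "((\<lambda>t. norm (f (w + t *\<^sub>R v) - f w - t *\<^sub>R ?F w v) / \<bar>t\<bar>) \<longlongrightarrow> 0) (at 0)"
      proof -
        have "((\<lambda>t::real. f (w + t *\<^sub>R v)) has_vector_derivative ?F w v) (at 0)"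
        proof -
          have "((\<lambda>t::real. w + t *\<^sub>R v) has_derivative (\<lambda>t. t *\<^sub>R v)) (at 0)"
            by (auto intro!: derivative_eq_intros)
          moreover have "(f has_derivative ?F w) (at (w + 0 *\<^sub>R v))"
            using C1_on_derivative[OF f] by simp
          ultimately have "((\<lambda>t. f (w + t *\<^sub>R v)) has_derivative (\<lambda>t. ?F w (t *\<^sub>R v))) (at 0)"
            using has_derivative_compose[of "\<lambda>t::real. w + t *\<^sub>R v" "\<lambda>t. t *\<^sub>R v" 0 UNIV f "?F w"] by (simp add: o_def)
          then show ?thesis
            by (simp add: has_vector_derivative_def linear_scale[OF lin])
        qed
        then show ?thesis
          by (simp add: has_vector_derivative_def has_derivative_at)
      qed
      have seq: "filterlim (\<lambda>n. 1 / real (Suc n)) (at 0) sequentially"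
        using LIMSEQ_inverse_real_of_nat by (auto simp: filterlim_at inverse_eq_divide)
      have "(\<lambda>n. norm (f (w + (1 / real (Suc n)) *\<^sub>R v) - f w - (1 / real (Suc n)) *\<^sub>R ?F w v) / \<bar>1 / real (Suc n)\<bar>) \<longlonglongrightarrow> 0"
        by (rule filterlim_compose[OF * seq])
      moreover have "norm (f (w + (1 / real (Suc n)) *\<^sub>R v) - f w - (1 / real (Suc n)) *\<^sub>R ?F w v) / \<bar>1 / real (Suc n)\<bar>
          = norm (s n w - ?F w v)" for n
      proof -
        have "s n w - ?F w v = real (Suc n) *\<^sub>R (f (w + (1 / real (Suc n)) *\<^sub>R v) - f w - (1 / real (Suc n)) *\<^sub>R ?F w v)"
        proof -
          define c :: complex where "c = of_nat (Suc n)"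
          have c: "c \<noteq> 0" "real (Suc n) *\<^sub>R X = c * X" "(1 / real (Suc n)) *\<^sub>R X = X / c" for X :: complex
            by (auto simp: c_def scaleR_conv_of_real simp del: of_nat_Suc)
          show ?thesis
            unfolding s_def c(2,3) c_def[symmetric] using c(1) by (simp add: right_diff_distrib add.commute)
        qed
        then show ?thesis by (simp del: of_nat_Suc)
      qed
      ultimately have "(\<lambda>n. norm (s n w - ?F w v)) \<longlonglongrightarrow> 0" by simp
      then show "(\<lambda>n. s n w) \<longlonglongrightarrow> ?F w v"
        using LIM_zero_cancel tendsto_norm_zero_iff by blast
    qed
    show "AE w in lborel. norm (s n w) \<le> indicat_real (cball 0 (M + 1)) w * B" for n
    proof (rule AE_I2)
      fix w
      have n1: "norm (v / of_nat (Suc n)) \<le> 1" using nv by (simp add: norm_divide del: of_nat_Suc)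
      have n2: "norm (v / of_nat (Suc n) + w) \<ge> norm w - 1" "norm (v / of_nat (Suc n) + w) \<le> norm w + 1"
        using n1 norm_triangle_ineq[of "v / of_nat (Suc n)" w] norm_diff_ineq[of w "v / of_nat (Suc n)"]
        by (auto simp: add.commute)
      show "norm (s n w) \<le> indicat_real (cball 0 (M + 1)) w * B"
      proof (cases "norm w \<le> M + 1")
        case True
        have "v / of_nat (Suc n) + w \<in> C" "w \<in> C"
          using True n2 unfolding C_def mem_cball_0 by linarith+
        then have "norm (f (v / of_nat (Suc n) + w) - f w) \<le> B * norm (v / of_nat (Suc n) + w - w)"
          by (rule Lip)
        also have "\<dots> = B / Suc n" using nv by (simp add: norm_divide del: of_nat_Suc)
        finally have "Suc n * norm (f (v / of_nat (Suc n) + w) - f w) \<le> B"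
          by (simp add: field_simps del: of_nat_Suc)
        then show ?thesis using True by (simp add: s_def norm_mult del: of_nat_Suc)
      next
        case False
        then have "f w = 0" "f (v / of_nat (Suc n) + w) = 0"
          using n2(1) by (auto intro!: out)
        then show ?thesis using False by (simp add: s_def)
      qed
    qed
  qed
  show ?thesis using LIMSEQ_unique[OF lim] by (simp add: zero)
qed

text \<open>\<open>dbar f\<close> is a combination of the derivatives of \<open>f\<close> in the
  directions 1 and \<i>, each of which has integral 0.\<close>

lemma integral_dbar_eq_0:
  assumes f: "C1_on UNIV f" and K: "compact K" "\<And>w. w \<notin> K \<Longrightarrow> f w = 0"
  shows "(LINT w:K|lborel. dbar f w) = 0"
proof -
  have z: "frechet_derivative f (at w) v = 0" if "w \<notin> K" for w v
  proof -
    have "frechet_derivative f (at w) = frechet_derivative (\<lambda>_. 0) (at w)"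
      using K that by (intro frechet_derivative_cong_open[of "-K"]) (auto simp: compact_imp_closed)
    then show ?thesis by simp
  qed
  have c: "continuous_on K (\<lambda>w. frechet_derivative f (at w) 1)" "continuous_on K (\<lambda>w. frechet_derivative f (at w) \<i>)"
    using f continuous_on_subset unfolding C1_on_def by blast+
  note i = integrable_compact_support(1)[OF K(1) c(1) z] integrable_compact_support(1)[OF K(1) c(2) z]
  have "(LINT w:K|lborel. dbar f w) = (LINT w|lborel. dbar f w)"
    using continuous_on_dbar[OF f] z
    by (intro integrable_compact_support(2)[symmetric] K(1))
       (auto intro: continuous_on_subset simp: dbar_def)
  also have "\<dots> = ((LINT w|lborel. frechet_derivative f (at w) 1) + \<i> * (LINT w|lborel. frechet_derivative f (at w) \<i>)) / 2"
    unfolding dbar_def using i by simp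
  also have "\<dots> = 0"
    using integral_directional_derivative_eq_0[OF f K] by simp
  finally show ?thesis .
qed

section \<open>Bump functions and the contribution of a simple pole\<close>

text \<open>An explicit function that is 1 for \<open>t \<le> 1\<close> and 0 for
  \<open>t \<ge> 2\<close>. One continuous derivative is all that Stokes' theorem asks for; each
  positive part is squared to smooth its kink.\<close>

definition cutoff :: "real \<Rightarrow> real" where
  "cutoff t = (max 0 (1 - (max 0 (t - 1))\<^sup>2))\<^sup>2"

definition cutoff' :: "real \<Rightarrow> real" where
  "cutoff' t = - 4 * max 0 (1 - (max 0 (t - 1))\<^sup>2) * max 0 (t - 1)"

lemma DERIV_max_0_square: "((\<lambda>t::real. (max 0 t)\<^sup>2) has_real_derivative 2 * max 0 t) (at t)"
proof -
  consider "t > 0" | "t < 0" | "t = 0" by linarith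
  then show ?thesis
  proof cases
    case 1
    have "((\<lambda>t::real. t\<^sup>2) has_real_derivative 2 * t) (at t)"
      by (auto intro!: derivative_eq_intros)
    then have "((\<lambda>t::real. (max 0 t)\<^sup>2) has_real_derivative 2 * t) (at t)"
      by (rule has_field_derivative_transform_within_open[where S = "{0<..}"]) (use 1 in auto)
    then show ?thesis using 1 by simp
  next
    case 2
    have "((\<lambda>t::real. 0) has_real_derivative 0) (at t)" by simp
    then have "((\<lambda>t::real. (max 0 t)\<^sup>2) has_real_derivative 0) (at t)"
      by (rule has_field_derivative_transform_within_open[where S = "{..<0}"]) (use 2 in auto)
    then show ?thesis using 2 by simp
  next
    case 3
    have "((\<lambda>h::real. (max 0 h)\<^sup>2 / h) \<longlongrightarrow> 0) (at 0)"
    proof (rule Lim_null_comparison)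
      show "\<forall>\<^sub>F h::real in at 0. norm ((max 0 h)\<^sup>2 / h) \<le> \<bar>h\<bar>"
        by (intro always_eventually) (auto simp: max_def power2_eq_square)
      show "((\<lambda>h::real. \<bar>h\<bar>) \<longlongrightarrow> 0) (at 0)"
        by (rule tendsto_rabs_zero) simp
    qed
    then show ?thesis using 3 by (simp add: DERIV_def)
  qed
qed

lemma DERIV_cutoff: "(cutoff has_real_derivative cutoff' t) (at t)"
proof -
  have 1: "((\<lambda>t. 1 - (max 0 (t - 1))\<^sup>2) has_real_derivative - (2 * max 0 (t - 1))) (at t)"
  proof -
    have "((\<lambda>t. (max 0 (t - 1))\<^sup>2) has_real_derivative 2 * max 0 (t - 1) * 1) (at t)"
      by (rule DERIV_chain2[OF DERIV_max_0_square]) (auto intro!: derivative_eq_intros)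
    from DERIV_diff[OF DERIV_const this] show ?thesis by simp
  qed
  show ?thesis
    using DERIV_chain2[OF DERIV_max_0_square 1]
    unfolding cutoff_def[abs_def] cutoff'_def by (simp add: field_simps)
qed

lemma continuous_cutoff': "continuous_on S cutoff'"
  unfolding cutoff'_def[abs_def] by (intro continuous_intros)

text \<open>The squared modulus, unlike the modulus, is differentiable at 0 as well.\<close>

definition bump :: "complex \<Rightarrow> complex" where
  "bump w = of_real (cutoff ((cmod w)\<^sup>2))"

lemma cutoff_eq_1: "t \<le> 1 \<Longrightarrow> cutoff t = 1"
  by (simp add: cutoff_def max_absorb1)

lemma cutoff_eq_0:
  assumes "t \<ge> 2"
  shows "cutoff t = 0" "cutoff' t = 0"
proof -
  have "1 \<le> (t - 1)\<^sup>2" using assms by (intro one_le_power) auto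
  then show "cutoff t = 0" "cutoff' t = 0"
    using assms by (simp_all add: cutoff_def cutoff'_def max_absorb2 max_absorb1)
qed

lemma bump_eq_1: "cmod w \<le> 1 \<Longrightarrow> bump w = 1"
  by (simp add: bump_def cutoff_eq_1 power_le_one)

lemma two_le_square: "cmod w \<ge> 2 \<Longrightarrow> 2 \<le> (cmod w)\<^sup>2"
  using power_mono[of 2 "cmod w" 2] by simp

lemma bump_eq_0: "cmod w \<ge> 2 \<Longrightarrow> bump w = 0"
  by (simp add: bump_def cutoff_eq_0 two_le_square)

lemma bump_nonneg: "bump w \<in> \<real>" "0 \<le> Re (bump w)"
  by (simp_all add: bump_def cutoff_def)

lemma has_derivative_bump:
  "(bump has_derivative (\<lambda>h. of_real (cutoff' ((cmod w)\<^sup>2) * (2 * (Re w * Re h + Im w * Im h))))) (at w)"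
proof -
  have 1: "((\<lambda>w. (cmod w)\<^sup>2) has_derivative (\<lambda>h. 2 * (Re w * Re h + Im w * Im h))) (at w)"
    unfolding cmod_power2
    by (auto intro!: derivative_eq_intros simp: algebra_simps)
  have "(cutoff has_derivative (*) (cutoff' ((cmod w)\<^sup>2))) (at ((cmod w)\<^sup>2))"
    using DERIV_cutoff has_field_derivative_imp_has_derivative by blast
  from has_derivative_compose[OF 1 this]
  show ?thesis unfolding bump_def[abs_def] by (rule has_derivative_of_real)
qed

lemma C1_on_bump: "C1_on D bump"
  by (rule C1_onI[OF has_derivative_bump])
     (auto intro!: continuous_intros continuous_on_compose2[OF continuous_cutoff'])

text \<open>\<open>dbar\<close> of the squared modulus is the identity. Divided by the coordinate,
  \<open>dbar bump\<close> is thus a continuous radial function: the factor \<open>w\<close> cancels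
  a simple pole at the centre.\<close>

lemma dbar_bump: "dbar bump w = of_real (cutoff' ((cmod w)\<^sup>2)) * w"
  by (simp add: dbar_eq[OF has_derivative_bump] complex_eq_iff)

text \<open>The integral of \<open>dbar bump v / v\<close>, with the singularity cancelled. Polar
  coordinates give the value -pi; the residue theorem divides by this constant, so its nonvanishing
  is what matters.\<close>

definition bump_const :: complex where
  "bump_const = (LINT v:cball 0 2|lborel. of_real (cutoff' ((cmod v)\<^sup>2)))"

text \<open>The integrand is continuous and nowhere positive, so a vanishing integral would force it
  to vanish identically. The disc is replaced by a square because that principle is applied on a
  box.\<close>

lemma bump_const_nonzero: "bump_const \<noteq> 0"
proof
  assume 0: "bump_const = 0"
  let ?k = "\<lambda>v::complex. of_real (cutoff' ((cmod v)\<^sup>2)) :: complex"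
  define C where "C = cbox (Complex (-2) (-2)) (Complex 2 2)"
  have C: "compact C" by (simp add: C_def)
  have sub: "cball 0 2 \<subseteq> C"
  proof
    fix v :: complex assume "v \<in> cball 0 2"
    then show "v \<in> C"
      using abs_Re_le_cmod[of v] abs_Im_le_cmod[of v] by (auto simp: C_def in_cbox_complex_iff)
  qed
  have cont: "continuous_on S ?k" for S
    by (intro continuous_intros continuous_on_compose2[OF continuous_cutoff']) auto
  have z: "?k v = 0" if "v \<notin> cball 0 2" for v
    using that by (simp add: cutoff_eq_0 two_le_square)
  have "bump_const = (LINT v|lborel. ?k v)"
    unfolding bump_const_def using z cont
    by (intro integrable_compact_support(2)[symmetric]) auto
  also have "\<dots> = (LINT v:C|lborel. ?k v)"
    using z cont C sub by (intro integrable_compact_support(2)) blast+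
  also have "\<dots> = integral C ?k"
    by (intro set_borel_integral_eq_integral set_integrable_compact C cont)
  finally have "integral C ?k = 0" using 0 by simp
  moreover have "?k integrable_on C"
    by (intro set_borel_integral_eq_integral set_integrable_compact C cont)
  ultimately have "(?k has_integral 0) C" by (simp add: has_integral_iff)
  from has_integral_linear[OF this bounded_linear_Re]
  have "((\<lambda>v. cutoff' ((cmod v)\<^sup>2)) has_integral 0) C" by (simp add: o_def)
  from has_integral_neg[OF this]
  have h: "((\<lambda>v. - cutoff' ((cmod v)\<^sup>2)) has_integral 0) C" by simp
  \<comment> \<open>A point whose squared modulus 3/2 lies strictly between 1 and 2; there
    \<open>cutoff'\<close> is -3/2.\<close>
  have "- cutoff' ((cmod (of_real (sqrt (3/2))))\<^sup>2) = 0"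
  proof (rule has_integral_0_cbox_imp_0[OF _ _ h[unfolded C_def]])
    show "continuous_on (cbox (Complex (- 2) (- 2)) (Complex 2 2)) (\<lambda>v. - cutoff' ((cmod v)\<^sup>2))"
      by (intro continuous_intros continuous_on_compose2[OF continuous_cutoff']) auto
    show "0 \<le> - cutoff' ((cmod v)\<^sup>2)" for v
      by (simp add: cutoff'_def)
    show "box (Complex (- 2) (- 2)) (Complex 2 2) \<noteq> {}"
      by (auto simp: box_ne_empty Basis_complex_def)
    have "sqrt (3/2) \<le> 2" by (rule real_le_lsqrt) (auto simp: power2_eq_square)
    moreover have "0 \<le> sqrt (3/2)" by simp
    ultimately show "of_real (sqrt (3/2)) \<in> cbox (Complex (- 2) (- 2)) (Complex 2 2)"
      by (auto simp: in_cbox_complex_iff simp del: real_sqrt_le_iff real_sqrt_ge_0_iff)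
  qed
  then show False by (simp add: cutoff'_def power2_eq_square max_def)
qed

definition bump_at :: "complex \<Rightarrow> real \<Rightarrow> complex \<Rightarrow> complex" where
  "bump_at p \<rho> w = bump ((w - p) / of_real \<rho>)"

lemma bump_at_eq_1: "\<rho> > 0 \<Longrightarrow> w \<in> cball p \<rho> \<Longrightarrow> bump_at p \<rho> w = 1"
  unfolding bump_at_def by (rule bump_eq_1) (auto simp: norm_divide dist_norm norm_minus_commute)

lemma bump_at_eq_0: "\<rho> > 0 \<Longrightarrow> w \<notin> ball p (2 * \<rho>) \<Longrightarrow> bump_at p \<rho> w = 0"
  unfolding bump_at_def by (rule bump_eq_0) (auto simp: norm_divide dist_norm norm_minus_commute field_simps)

lemma bump_at_nonneg: "bump_at p \<rho> w \<in> \<real>" "0 \<le> Re (bump_at p \<rho> w)"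
  by (simp_all add: bump_at_def bump_nonneg)

lemma C1_on_bump_at: "\<rho> > 0 \<Longrightarrow> C1_on UNIV (bump_at p \<rho>)"
  and dbar_bump_at: "\<rho> > 0 \<Longrightarrow>
    dbar (bump_at p \<rho>) w = of_real (cutoff' ((cmod ((w - p) / \<rho>))\<^sup>2) / \<rho>\<^sup>2) * (w - p)"
proof -
  assume \<rho>: "\<rho> > 0"
  let ?T = "\<lambda>w. (w - p) / of_real \<rho>"
  have T: "?T holomorphic_on UNIV" using \<rho> by (intro holomorphic_intros) auto
  have dT: "deriv ?T w = 1 / of_real \<rho>" for w
    using \<rho> by (intro DERIV_imp_deriv) (auto intro!: derivative_eq_intros)
  have eq: "bump_at p \<rho> = bump \<circ> ?T" by (auto simp: bump_at_def)
  show "C1_on UNIV (bump_at p \<rho>)"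
    unfolding eq by (rule C1_on_compose[OF _ T _ C1_on_bump]) auto
  show "dbar (bump_at p \<rho>) w = of_real (cutoff' ((cmod ((w - p) / \<rho>))\<^sup>2) / \<rho>\<^sup>2) * (w - p)"
    unfolding eq using C1_on_compose(2)[OF _ T _ C1_on_bump, of UNIV w] \<rho>
    by (simp add: dT dbar_bump power2_eq_square)
qed

text \<open>The regular part contributes 0 by Stokes' theorem, as the bump times \<open>h\<close>
  has compact support. The polar part becomes the integral defining \<open>bump_const\<close> after
  rescaling by \<open>?T\<close>, whose Jacobian is the inverse square of \<rho>; so neither centre
  nor radius enters the result.\<close>

lemma integral_dbar_bump_at_simple_pole:
  assumes \<rho>: "\<rho> > 0" and D: "open D" "cball p (2 * \<rho>) \<subseteq> D" and h: "h holomorphic_on D"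
    and f: "\<And>w. w \<in> D - {p} \<Longrightarrow> f w = R / (w - p) + h w"
  shows "(LINT w:cball p (2 * \<rho>)|lborel. dbar (bump_at p \<rho>) w * f w) = R * bump_const"
proof -
  let ?K = "cball p (2 * \<rho>)" and ?b = "bump_at p \<rho>"
  let ?T = "\<lambda>w. (w - p) / of_real \<rho>"
  let ?k = "\<lambda>v::complex. of_real (cutoff' ((cmod v)\<^sup>2)) :: complex"
  have ck: "continuous_on S ?k" for S
    by (intro continuous_intros continuous_on_compose2[OF continuous_cutoff']) auto
  have ckT: "continuous_on S (\<lambda>w. ?k (?T w))" for S
    by (intro continuous_on_compose2[OF ck] continuous_intros) (use \<rho> in auto)
  have dT: "deriv ?T w = 1 / of_real \<rho>" for w
    using \<rho> by (intro DERIV_imp_deriv) (auto intro!: derivative_eq_intros)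
  have TK: "?T ` ?K = cball 0 2"
  proof
    show "?T ` ?K \<subseteq> cball 0 2"
      using \<rho> by (auto simp: dist_norm norm_divide norm_minus_commute field_simps)
    show "cball 0 2 \<subseteq> ?T ` ?K"
    proof
      fix v :: complex assume "v \<in> cball 0 2"
      then have "p + \<rho> * v \<in> ?K" "?T (p + \<rho> * v) = v"
        using \<rho> by (auto simp: dist_norm norm_mult)
      then show "v \<in> ?T ` ?K" by (metis imageI)
    qed
  qed
  have pole: "(LINT w:?K|lborel. of_real ((cmod (deriv ?T w))\<^sup>2) * ?k (?T w)) = bump_const"
    unfolding bump_const_def TK[symmetric]
    by (rule holomorphic_change_of_variables[OF open_UNIV _ compact_cball _ _ ck])
       (use \<rho> in \<open>auto intro!: holomorphic_intros simp: inj_on_def intro: ck\<close>)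
  let ?P = "\<lambda>w. of_real ((cmod (deriv ?T w))\<^sup>2) * ?k (?T w)"
  have cP: "continuous_on S ?P" for S
    unfolding dT by (intro continuous_intros ckT)
  \<comment> \<open>Extension by zero: \<open>F\<close> is continuously differentiable on
    \<open>D\<close> and on the complement of the disc, and these two open sets cover the
    plane.\<close>
  define F where "F w = (if w \<in> D then ?b w * h w else 0)" for w
  have z: "?b w = 0" if "w \<notin> ?K" for w using bump_at_eq_0[of \<rho> w p] that \<rho> by simp
  have FD: "C1_on D (\<lambda>w. ?b w * h w)"
    by (intro C1_on_mult C1_on_holomorphic[OF D(1) h] C1_on_subset[OF C1_on_bump_at[OF \<rho>]]) auto
  have "C1_on (D \<union> - ?K) F"
  proof (rule C1_on_Un)
    show "C1_on D F" using C1_on_cong_open[OF D(1) _ FD] by (simp add: F_def)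
    show "C1_on (- ?K) F"
      by (rule C1_on_cong_open[OF _ _ C1_on_const[of _ 0]]) (use z in \<open>auto simp: F_def\<close>)
  qed (use D in auto)
  moreover have "D \<union> - ?K = UNIV" using D(2) by auto
  ultimately have F: "C1_on UNIV F" by simp
  have "(LINT w:?K|lborel. dbar F w) = 0"
    by (rule integral_dbar_eq_0[OF F]) (use z in \<open>auto simp: F_def\<close>)
  moreover have dF: "dbar F w = dbar ?b w * h w" if "w \<in> D" for w
  proof -
    have "dbar F w = dbar (\<lambda>w. ?b w * h w) w"
      by (rule dbar_cong_open[OF D(1) that]) (simp add: F_def)
    also have "\<dots> = dbar ?b w * h w"
      using C1_on_mult(2)[OF C1_on_subset[OF C1_on_bump_at[OF \<rho>] subset_UNIV] C1_on_holomorphic(1)[OF D(1) h] that]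
        C1_on_holomorphic(2)[OF D(1) h that] by simp
    finally show ?thesis .
  qed
  moreover have "(LINT w:?K|lborel. dbar F w) = (LINT w:?K|lborel. dbar ?b w * h w)"
    using D(2) dF by (intro set_lebesgue_integral_cong) auto
  ultimately have hol: "(LINT w:?K|lborel. dbar ?b w * h w) = 0" by simp
  have "(LINT w:?K|lborel. dbar ?b w * f w) = (LINT w:?K|lborel. R * ?P w + dbar ?b w * h w)"
  proof (rule set_lebesgue_integral_cong)
    show "\<forall>w. w \<in> ?K \<longrightarrow> dbar ?b w * f w = R * ?P w + dbar ?b w * h w"
    proof (intro allI impI)
      fix w assume w: "w \<in> ?K"
      show "dbar ?b w * f w = R * ?P w + dbar ?b w * h w"
      proof (cases "w = p")
        case True
        \<comment> \<open>At the centre both \<open>dbar\<close> of the bump and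
          \<open>cutoff' 0\<close> vanish, whatever value \<open>f\<close> takes at its
          pole.\<close>
        then show ?thesis using \<rho> by (simp add: dbar_bump_at cutoff'_def)
      next
        case False
        then have "f w = R / (w - p) + h w" using f w D by auto
        then have "dbar ?b w * f w = dbar ?b w / (w - p) * R + dbar ?b w * h w"
          by (simp add: algebra_simps)
        also have "dbar ?b w / (w - p) = ?P w"
          using \<rho> False by (simp add: dbar_bump_at dT norm_divide power_divide)
        finally show ?thesis by (simp add: algebra_simps)
      qed
    qed
  qed auto
  also have "\<dots> = (LINT w:?K|lborel. R * ?P w) + (LINT w:?K|lborel. dbar ?b w * h w)"
  proof (rule set_integral_add)
    show "set_integrable lborel ?K (\<lambda>w. R * ?P w)"
      by (intro set_integrable_compact continuous_intros cP) auto
    have "continuous_on D h" using h holomorphic_on_imp_continuous_on by blast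
    then show "set_integrable lborel ?K (\<lambda>w. dbar ?b w * h w)"
      using continuous_on_dbar[OF C1_on_bump_at[OF \<rho>, of p]] D(2)
      by (intro set_integrable_compact continuous_intros) (auto intro: continuous_on_subset)
  qed
  also have "\<dots> = R * bump_const" using hol pole by simp
  finally show ?thesis .
qed

text \<open>\<open>(w - a) * f w\<close>, with value \<open>R\<close> at \<open>a\<close>, is
  holomorphic by Riemann's theorem on removable singularities, and \<open>h\<close> is its
  difference quotient at \<open>a\<close>. The case \<open>R = 0\<close> says that the singularity
  of \<open>f\<close> is removable.\<close>

lemma holomorphic_simple_pole_split:
  assumes D: "open D" "a \<in> D" and f: "f holomorphic_on D - {a}"
    and lim: "((\<lambda>w. (w - a) * f w) \<longlongrightarrow> R) (at a)"
  obtains h where "h holomorphic_on D" "\<And>w. w \<in> D - {a} \<Longrightarrow> f w = R / (w - a) + h w"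
proof -
  define F where "F w = (if w = a then R else (w - a) * f w)" for w
  have "F holomorphic_on D"
  proof (rule no_isolated_singularity'[where K = "{a}"])
    show "(F \<longlongrightarrow> F z) (at z within D)" if "z \<in> {a}" for z
    proof -
      have "(F \<longlongrightarrow> R) (at a)"
        using lim by (rule Lim_transform_eventually) (auto simp: F_def eventually_at_filter)
      then show ?thesis using that by (simp add: F_def tendsto_within_subset[OF _ subset_UNIV])
    qed
    have "(\<lambda>w. (w - a) * f w) holomorphic_on D - {a}"
      using f by (intro holomorphic_intros)
    then show "F holomorphic_on D - {a}"
      by (rule holomorphic_transform) (auto simp: F_def)
  qed (use D in auto)
  then have "(\<lambda>z. if z = a then deriv F a else (F z - F a) / (z - a)) holomorphic_on D"
    using D by (intro pole_lemma) (auto simp: interior_open)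
  moreover have "f w = R / (w - a) + (if w = a then deriv F a else (F w - F a) / (w - a))" if "w \<in> D - {a}" for w
    using that by (simp add: F_def diff_divide_distrib)
  ultimately show thesis using that by blast
qed

section \<open>The residue theorem on a compact Riemann surface\<close>

locale riemann_surface_atlas =
  fixes \<A> :: "'a::t2_space chart set"
  assumes surface: "riemann_surface \<A>"
begin

lemma is_chart: "c \<in> \<A> \<Longrightarrow> is_chart c"
  using surface by (simp add: riemann_surface_def)

lemma chart_exists: "\<exists>c\<in>\<A>. p \<in> fst c"
proof -
  have "(\<Union>c\<in>\<A>. fst c) = UNIV" using surface unfolding riemann_surface_def by blast
  then show ?thesis by blast
qed

lemma open_chart: "c \<in> \<A> \<Longrightarrow> open (fst c)"
  using is_chart by (auto simp: is_chart_def)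

lemma chart_homeomorphism:
  "c \<in> \<A> \<Longrightarrow> homeomorphism (fst c) (snd c ` fst c) (snd c) (chart_inv c)"
  using is_chart by (auto simp: is_chart_def)

lemma chart_inv_chart [simp]: "c \<in> \<A> \<Longrightarrow> q \<in> fst c \<Longrightarrow> chart_inv c (snd c q) = q"
  by (rule homeomorphism_apply1[OF chart_homeomorphism])

lemma continuous_on_chart: "c \<in> \<A> \<Longrightarrow> D \<subseteq> fst c \<Longrightarrow> continuous_on D (snd c)"
  by (rule continuous_on_subset[OF homeomorphism_cont1[OF chart_homeomorphism]])

lemma continuous_on_chart_inv: "c \<in> \<A> \<Longrightarrow> D \<subseteq> snd c ` fst c \<Longrightarrow> continuous_on D (chart_inv c)"
  by (rule continuous_on_subset[OF homeomorphism_cont2[OF chart_homeomorphism]])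

lemma inj_on_chart: "c \<in> \<A> \<Longrightarrow> inj_on (snd c) (fst c)"
  by (rule inj_on_inverseI[where g = "chart_inv c"]) simp

lemma chart_eq_iff: "c \<in> \<A> \<Longrightarrow> p \<in> fst c \<Longrightarrow> q \<in> fst c \<Longrightarrow> snd c p = snd c q \<longleftrightarrow> p = q"
  by (rule inj_on_eq_iff[OF inj_on_chart])

lemma open_chart_image:
  assumes "c \<in> \<A>" "open D" "D \<subseteq> fst c"
  shows "open (snd c ` D)"
proof -
  have "openin (top_of_set (snd c ` fst c)) (snd c ` D)"
    using homeomorphism_imp_open_map[OF chart_homeomorphism[OF assms(1)]] assms(2,3)
    by (simp add: open_openin_trans open_chart assms(1) openin_open_eq open_subset)
  moreover have "open (snd c ` fst c)"
    using is_chart[OF assms(1)] by (simp add: is_chart_def)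
  ultimately show ?thesis using openin_open_trans by blast
qed

lemma open_chart_inv_image:
  assumes "c \<in> \<A>" "open D" "D \<subseteq> snd c ` fst c"
  shows "open (chart_inv c ` D)"
proof -
  have "chart_inv c ` D = fst c \<inter> snd c -` D"
  proof (intro equalityI subsetI)
    fix q assume "q \<in> chart_inv c ` D"
    then obtain w where w: "w \<in> D" "q = chart_inv c w" by auto
    then obtain q' where "q' \<in> fst c" "w = snd c q'" using assms(3) by blast
    then show "q \<in> fst c \<inter> snd c -` D" using w assms by simp
  next
    fix q assume "q \<in> fst c \<inter> snd c -` D"
    then have "chart_inv c (snd c q) \<in> chart_inv c ` D" "q \<in> fst c" by auto
    then show "q \<in> chart_inv c ` D" using assms by simp
  qed
  then show ?thesis
    using continuous_open_preimage[OF continuous_on_chart[OF assms(1) subset_refl] open_chart[OF assms(1)] assms(2)]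
    by simp
qed

lemma compact_chart_image: "c \<in> \<A> \<Longrightarrow> compact K \<Longrightarrow> K \<subseteq> fst c \<Longrightarrow> compact (snd c ` K)"
  using continuous_on_chart by (blast intro: compact_continuous_image)

lemma transition_chart [simp]: "c \<in> \<A> \<Longrightarrow> q \<in> fst c \<Longrightarrow> transition c d (snd c q) = snd d q"
  by (simp add: transition_def)

lemma transition_holomorphic:
  assumes "c \<in> \<A>" "d \<in> \<A>"
  shows "transition c d holomorphic_on snd c ` (fst c \<inter> fst d)"
proof -
  have "compatible c d" using surface assms unfolding riemann_surface_def by blast
  then show ?thesis by (simp add: compatible_def)
qed

lemma open_overlap: "c \<in> \<A> \<Longrightarrow> d \<in> \<A> \<Longrightarrow> open (snd c ` (fst c \<inter> fst d))"
  by (intro open_chart_image open_Int open_chart) auto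

section \<open>Differentiable functions and bump functions on the surface\<close>

definition C1_fun :: "('a \<Rightarrow> complex) \<Rightarrow> bool" where
  "C1_fun F \<longleftrightarrow> (\<forall>c\<in>\<A>. C1_on (snd c ` fst c) (F \<circ> chart_inv c))"

lemma C1_fun_const: "C1_fun (\<lambda>_. k)"
  unfolding C1_fun_def o_def using C1_on_const by blast

lemma C1_fun_add: "C1_fun F \<Longrightarrow> C1_fun G \<Longrightarrow> C1_fun (\<lambda>q. F q + G q)"
  unfolding C1_fun_def o_def using C1_on_add(1) by blast

lemma C1_fun_mult: "C1_fun F \<Longrightarrow> C1_fun G \<Longrightarrow> C1_fun (\<lambda>q. F q * G q)"
  unfolding C1_fun_def o_def using C1_on_mult(1) by blast

lemma C1_fun_sum: "finite I \<Longrightarrow> (\<And>i. i \<in> I \<Longrightarrow> C1_fun (F i)) \<Longrightarrow> C1_fun (\<lambda>q. \<Sum>i\<in>I. F i q)"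
  by (induction I rule: finite_induct) (auto intro: C1_fun_const C1_fun_add)

lemma C1_fun_inverse: "C1_fun F \<Longrightarrow> (\<And>q. F q \<noteq> 0) \<Longrightarrow> C1_fun (\<lambda>q. inverse (F q))"
  unfolding C1_fun_def o_def by (simp add: C1_on_inverse)

text \<open>The transformation law of a form of type (0,1); wedged with a 1-form of type (1,0) it
  gives a density in the plane.\<close>

lemma dbar_transition:
  assumes "C1_fun F" "c \<in> \<A>" "d \<in> \<A>" "q \<in> fst c" "q \<in> fst d"
  shows "dbar (F \<circ> chart_inv c) (snd c q) =
    dbar (F \<circ> chart_inv d) (snd d q) * cnj (deriv (transition c d) (snd c q))"
proof -
  let ?D = "snd c ` (fst c \<inter> fst d)"
  have "dbar (F \<circ> chart_inv c) (snd c q) = dbar ((F \<circ> chart_inv d) \<circ> transition c d) (snd c q)"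
    by (rule dbar_cong_open[OF open_overlap[OF assms(2,3)]]) (use assms in auto)
  also have "\<dots> = dbar (F \<circ> chart_inv d) (transition c d (snd c q)) * cnj (deriv (transition c d) (snd c q))"
  proof (rule C1_on_compose(2)[OF open_overlap transition_holomorphic])
    show "C1_on (snd d ` fst d) (F \<circ> chart_inv d)" using assms by (simp add: C1_fun_def)
  qed (use assms in auto)
  finally show ?thesis using assms by simp
qed

lemma dbar_locally_constant:
  assumes "c \<in> \<A>" "open N" "q \<in> fst c" "q \<in> N" "\<And>x. x \<in> N \<Longrightarrow> F x = k"
  shows "dbar (F \<circ> chart_inv c) (snd c q) = 0"
proof -
  have "dbar (F \<circ> chart_inv c) (snd c q) = dbar (\<lambda>_. k) (snd c q)"
    by (rule dbar_cong_open[of "snd c ` (fst c \<inter> N)"])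
       (use assms in \<open>auto intro!: open_chart_image open_Int open_chart\<close>)
  then show ?thesis by (simp add: dbar_const)
qed

definition chart_bump :: "'a chart \<Rightarrow> 'a \<Rightarrow> real \<Rightarrow> 'a \<Rightarrow> complex" where
  "chart_bump c p \<rho> q = (if q \<in> fst c then bump_at (snd c p) \<rho> (snd c q) else 0)"

text \<open>The two radii differ on purpose: the set of coordinate radius \<open>2 * \<rho>\<close>
  carries the support of \<open>chart_bump c p \<rho>\<close>, while on the set
  \<open>chart_ball c p \<rho>\<close>, of coordinate radius \<rho>, the bump is 1.\<close>

definition chart_cball :: "'a chart \<Rightarrow> 'a \<Rightarrow> real \<Rightarrow> 'a set" where
  "chart_cball c p \<rho> = chart_inv c ` cball (snd c p) (2 * \<rho>)"

definition chart_ball :: "'a chart \<Rightarrow> 'a \<Rightarrow> real \<Rightarrow> 'a set" where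
  "chart_ball c p \<rho> = chart_inv c ` ball (snd c p) \<rho>"

lemma chart_cball:
  assumes "c \<in> \<A>" "cball (snd c p) (2 * \<rho>) \<subseteq> snd c ` D" "D \<subseteq> fst c"
  shows "compact (chart_cball c p \<rho>)" "chart_cball c p \<rho> \<subseteq> D"
    "snd c ` chart_cball c p \<rho> = cball (snd c p) (2 * \<rho>)"
proof -
  show "compact (chart_cball c p \<rho>)"
    unfolding chart_cball_def using assms
    by (intro compact_continuous_image continuous_on_chart_inv) auto
  show "chart_cball c p \<rho> \<subseteq> D"
  proof
    fix q assume "q \<in> chart_cball c p \<rho>"
    then obtain w where "w \<in> cball (snd c p) (2 * \<rho>)" and w: "q = chart_inv c w"
      unfolding chart_cball_def by blast
    then have "w \<in> snd c ` D" using assms(2) by blast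
    then obtain q' where "q' \<in> D" "w = snd c q'" by auto
    then show "q \<in> D" using w assms by auto
  qed
  show "snd c ` chart_cball c p \<rho> = cball (snd c p) (2 * \<rho>)"
  proof -
    have "snd c (chart_inv c w) = w" if "w \<in> cball (snd c p) (2 * \<rho>)" for w
    proof -
      have "w \<in> snd c ` D" using that assms by blast
      then obtain q where "q \<in> D" "w = snd c q" by blast
      then show ?thesis using assms by auto
    qed
    then show ?thesis by (simp add: chart_cball_def image_image)
  qed
qed

lemma chart_bump_eq_0:
  assumes "c \<in> \<A>" "\<rho> > 0" "q \<notin> chart_cball c p \<rho>"
  shows "chart_bump c p \<rho> q = 0"
proof (cases "q \<in> fst c")
  case True
  have "snd c q \<notin> ball (snd c p) (2 * \<rho>)"
  proof
    assume "snd c q \<in> ball (snd c p) (2 * \<rho>)"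
    then have "chart_inv c (snd c q) \<in> chart_cball c p \<rho>"
      unfolding chart_cball_def by (intro imageI) auto
    then show False using assms True by simp
  qed
  then show ?thesis using bump_at_eq_0[OF assms(2)] by (simp add: chart_bump_def)
qed (simp add: chart_bump_def)

lemma chart_ball:
  assumes "c \<in> \<A>" "p \<in> fst c" "\<rho> > 0" "cball (snd c p) (2 * \<rho>) \<subseteq> snd c ` fst c"
  shows "open (chart_ball c p \<rho>)" "p \<in> chart_ball c p \<rho>"
    "\<And>q. q \<in> chart_ball c p \<rho> \<Longrightarrow> chart_bump c p \<rho> q = 1"
proof -
  have sub: "ball (snd c p) \<rho> \<subseteq> snd c ` fst c"
    using assms(3,4) ball_subset_cball[of "snd c p" \<rho>] subset_cball[of \<rho> "2 * \<rho>" "snd c p"] by force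
  show "open (chart_ball c p \<rho>)"
    unfolding chart_ball_def by (rule open_chart_inv_image[OF assms(1) open_ball sub])
  have "chart_inv c (snd c p) \<in> chart_ball c p \<rho>"
    unfolding chart_ball_def using assms(3) by (intro imageI) auto
  then show "p \<in> chart_ball c p \<rho>" using assms by simp
  fix q assume "q \<in> chart_ball c p \<rho>"
  then obtain w where w: "w \<in> ball (snd c p) \<rho>" "q = chart_inv c w"
    by (auto simp: chart_ball_def)
  then obtain q' where q': "q' \<in> fst c" "w = snd c q'" using sub by blast
  then have "q = q'" using w assms by simp
  then show "chart_bump c p \<rho> q = 1"
    using q' w assms(3) by (simp add: chart_bump_def bump_at_eq_1)
qed

lemma chart_bump_nonneg: "chart_bump c p \<rho> q \<in> \<real>" "0 \<le> Re (chart_bump c p \<rho> q)"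
  by (simp_all add: chart_bump_def bump_at_nonneg)

text \<open>The support is compact, hence closed in the Hausdorff space. In any other chart the
  function is therefore differentiable on the overlap with \<open>c\<close> and zero on the
  complement of the support, and these two open sets cover that chart.\<close>

lemma C1_fun_chart_bump:
  assumes c: "c \<in> \<A>" and \<rho>: "\<rho> > 0" and sub: "cball (snd c p) (2 * \<rho>) \<subseteq> snd c ` fst c"
  shows "C1_fun (chart_bump c p \<rho>)"
  unfolding C1_fun_def
proof
  fix d assume d: "d \<in> \<A>"
  let ?K = "chart_cball c p \<rho>" and ?F = "chart_bump c p \<rho> \<circ> chart_inv d"
  have K: "compact ?K" "?K \<subseteq> fst c" using chart_cball[OF c sub subset_refl] by auto
  have oK: "open (fst d - ?K)" using K open_chart[OF d] compact_imp_closed by blast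
  have "C1_on (snd d ` (fst d \<inter> fst c)) ?F"
  proof (rule C1_on_cong_open[OF open_overlap[OF d c]])
    show "C1_on (snd d ` (fst d \<inter> fst c)) (bump_at (snd c p) \<rho> \<circ> transition d c)"
      using C1_on_compose(1)[OF open_overlap[OF d c] transition_holomorphic[OF d c] _ C1_on_bump_at[OF \<rho>]]
      by blast
    show "(bump_at (snd c p) \<rho> \<circ> transition d c) v = ?F v" if "v \<in> snd d ` (fst d \<inter> fst c)" for v
      using that d by (auto simp: chart_bump_def)
  qed
  moreover have "C1_on (snd d ` (fst d - ?K)) ?F"
    by (rule C1_on_cong_open[OF open_chart_image[OF d oK] _ C1_on_const[of _ 0]])
       (use d chart_bump_eq_0[OF c \<rho>] in auto)
  ultimately have "C1_on (snd d ` (fst d \<inter> fst c) \<union> snd d ` (fst d - ?K)) ?F"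
    by (rule C1_on_Un[OF _ _ open_overlap[OF d c] open_chart_image[OF d oK]]) auto
  moreover have "snd d ` (fst d \<inter> fst c) \<union> snd d ` (fst d - ?K) = snd d ` fst d"
    using K(2) by auto
  ultimately show "C1_on (snd d ` fst d) ?F" by simp
qed

text \<open>
  Inserting \<open>1 = (\<Sum>j. \<eta> j)\<close> into the \<open>i\<close>-th integral and moving the \<open>(i, j)\<close> term to the chart \<open>j\<close>
  turns the sum over \<open>i\<close> into an integral of \<open>dbar (\<Sum>i. \<eta> i) = 0\<close>.
\<close>

lemma sum_integral_dbar_partition_eq_0:
  assumes I: "finite I" and cc: "\<And>i. i \<in> I \<Longrightarrow> cc i \<in> \<A>"
    and K: "\<And>i. i \<in> I \<Longrightarrow> compact (K i)" "\<And>i. i \<in> I \<Longrightarrow> K i \<subseteq> fst (cc i)"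
    and \<eta>: "\<And>i. i \<in> I \<Longrightarrow> C1_fun (\<eta> i)" "\<And>i q. i \<in> I \<Longrightarrow> q \<notin> K i \<Longrightarrow> \<eta> i q = 0"
    and one: "\<And>q. (\<Sum>i\<in>I. \<eta> i q) = 1"
    and N: "open N" "S \<subseteq> N" "closed S"
    and flat: "\<And>i c q. i \<in> I \<Longrightarrow> c \<in> \<A> \<Longrightarrow> q \<in> fst c \<Longrightarrow> q \<in> N \<Longrightarrow> dbar (\<eta> i \<circ> chart_inv c) (snd c q) = 0"
    and cont: "\<And>c. c \<in> \<A> \<Longrightarrow> continuous_on (snd c ` (fst c - S)) (\<omega> c)"
    and trans: "\<And>c d q. c \<in> \<A> \<Longrightarrow> d \<in> \<A> \<Longrightarrow> q \<in> fst c \<Longrightarrow> q \<in> fst d \<Longrightarrow> q \<notin> S \<Longrightarrow>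
        \<omega> c (snd c q) = \<omega> d (snd d q) * deriv (transition c d) (snd c q)"
  shows "(\<Sum>i\<in>I. LINT w:snd (cc i) ` K i|lborel. dbar (\<eta> i \<circ> chart_inv (cc i)) w * \<omega> (cc i) w) = 0"
proof -
  define \<theta> where "\<theta> c i w = dbar (\<eta> i \<circ> chart_inv c) w * \<omega> c w" for c i w
  have flat\<theta>: "\<theta> c i (snd c q) = 0" if "i \<in> I" "c \<in> \<A>" "q \<in> fst c" "q \<in> N" for c i q
    using flat[OF that] by (simp add: \<theta>_def)
  have z: "\<theta> c i (snd c q) = 0" if "i \<in> I" "c \<in> \<A>" "q \<in> fst c" "q \<notin> K i" for c i q
  proof -
    have "open (- K i)" using K(1)[OF that(1)] compact_imp_closed by blast
    then have "dbar (\<eta> i \<circ> chart_inv c) (snd c q) = 0"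
      using dbar_locally_constant[of c "- K i" q "\<eta> i" 0] \<eta>(2)[OF that(1)] that by simp
    then show ?thesis by (simp add: \<theta>_def)
  qed
  \<comment> \<open>The coefficient of \<omega> may be singular on \<open>S\<close>, but
    \<open>dbar (\<eta> i)\<close> vanishes on the neighbourhood \<open>N\<close> of
    \<open>S\<close>, so the product is continuous on the whole chart.\<close>
  have c\<theta>: "continuous_on (snd c ` fst c) (\<theta> c i)" if i: "i \<in> I" and c: "c \<in> \<A>" for c i
  proof -
    have o: "open (snd c ` (fst c - S))" "open (snd c ` (fst c \<inter> N))"
      using c N by (intro open_chart_image open_Diff open_Int open_chart; auto)+
    have "continuous_on (snd c ` fst c) (dbar (\<eta> i \<circ> chart_inv c))"
      using \<eta>(1)[OF i] c by (intro continuous_on_dbar) (auto simp: C1_fun_def)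
    then have "continuous_on (snd c ` (fst c - S)) (\<theta> c i)"
      unfolding \<theta>_def[abs_def] using cont[OF c]
      by (intro continuous_intros) (auto intro: continuous_on_subset)
    moreover have "continuous_on (snd c ` (fst c \<inter> N)) (\<theta> c i)"
    proof (rule continuous_on_eq[of _ "\<lambda>_. 0"])
      fix w assume "w \<in> snd c ` (fst c \<inter> N)"
      then obtain q where "q \<in> fst c" "q \<in> N" "w = snd c q" by blast
      then show "0 = \<theta> c i w" using flat\<theta>[OF i c] by simp
    qed simp
    ultimately have "continuous_on (snd c ` (fst c - S) \<union> snd c ` (fst c \<inter> N)) (\<theta> c i)"
      using o by (intro continuous_on_open_Un)
    moreover have "snd c ` (fst c - S) \<union> snd c ` (fst c \<inter> N) = snd c ` fst c" using N by auto
    ultimately show ?thesis by simp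
  qed
  have c\<eta>: "continuous_on (snd c ` fst c) (\<lambda>w. \<eta> j (chart_inv c w))" if "j \<in> I" "c \<in> \<A>" for c j
    using C1_on_continuous[of "snd c ` fst c" "\<eta> j \<circ> chart_inv c"] \<eta>(1)[OF that(1)] that(2)
    by (auto simp: C1_fun_def o_def)
  have c\<eta>\<theta>: "continuous_on D (\<lambda>w. \<eta> j (chart_inv c w) * \<theta> c i w)"
    if "i \<in> I" "j \<in> I" "c \<in> \<A>" "D \<subseteq> snd c ` fst c" for c i j D
    using c\<eta>[OF that(2,3)] c\<theta>[OF that(1,3)] that(4)
    by (intro continuous_intros) (auto intro: continuous_on_subset)
  define X where "X i j = (LINT w:snd (cc i) ` (K i \<inter> K j)|lborel. \<eta> j (chart_inv (cc i) w) * \<theta> (cc i) i w)" for i j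
  define Y where "Y i j = (LINT w:snd (cc j) ` (K i \<inter> K j)|lborel. \<eta> j (chart_inv (cc j) w) * \<theta> (cc j) i w)" for i j
  have XY: "X i j = Y i j" if i: "i \<in> I" and j: "j \<in> I" for i j
  proof -
    let ?c = "cc i" and ?d = "cc j"
    let ?T = "transition ?c ?d" and ?K = "snd ?c ` (K i \<inter> K j)"
    let ?f = "\<lambda>v. \<eta> j (chart_inv ?d v) * \<theta> ?d i v"
    note c = cc[OF i] and d = cc[OF j]
    have sub: "K i \<inter> K j \<subseteq> fst ?c" "K i \<inter> K j \<subseteq> fst ?d" using K(2) i j by auto
    have TK: "?T ` ?K = snd ?d ` (K i \<inter> K j)"
    proof -
      have "transition ?c ?d (snd ?c q) = snd ?d q" if "q \<in> K i \<inter> K j" for q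
        using that sub c by (intro transition_chart) auto
      then show ?thesis unfolding image_image by (intro image_cong) auto
    qed
    have "X i j = (LINT w:?K|lborel. of_real ((cmod (deriv ?T w))\<^sup>2) * ?f (?T w))"
      unfolding X_def
    proof (rule set_lebesgue_integral_cong)
      have "compact (K i \<inter> K j)" using K(1) i j by (simp add: compact_Int_closed compact_imp_closed)
      then have "compact ?K" using compact_chart_image c sub by blast
      then show "?K \<in> sets lborel" by (simp add: borel_compact)
      show "\<forall>w. w \<in> ?K \<longrightarrow> \<eta> j (chart_inv ?c w) * \<theta> ?c i w = of_real ((cmod (deriv ?T w))\<^sup>2) * ?f (?T w)"
      proof (intro allI impI)
        fix w assume "w \<in> ?K"
        then obtain q where q: "q \<in> K i" "q \<in> K j" "w = snd ?c q" by auto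
        have qcd: "q \<in> fst ?c" "q \<in> fst ?d" using q sub by auto
        have "\<theta> ?c i w = of_real ((cmod (deriv ?T w))\<^sup>2) * \<theta> ?d i (snd ?d q)"
        proof (cases "q \<in> S")
          case True
          then have "q \<in> N" using N(2) by blast
          then show ?thesis using flat\<theta>[OF i c qcd(1)] flat\<theta>[OF i d qcd(2)] q(3) by simp
        next
          \<comment> \<open>The conjugate of \<open>deriv ?T\<close> from
            \<open>dbar (\<eta> i)\<close> and \<open>deriv ?T\<close> from \<omega> multiply to the
            square of the modulus.\<close>
          case False
          then show ?thesis
            unfolding \<theta>_def complex_norm_square q(3)
              dbar_transition[OF \<eta>(1)[OF i] c d qcd] trans[OF c d qcd False]
            by simp
        qed
        then show "\<eta> j (chart_inv ?c w) * \<theta> ?c i w = of_real ((cmod (deriv ?T w))\<^sup>2) * ?f (?T w)"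
          using q qcd c d by simp
      qed
    qed
    also have "\<dots> = (LINT v:?T ` ?K|lborel. ?f v)"
    proof (rule holomorphic_change_of_variables[OF open_overlap transition_holomorphic])
      show "compact ?K"
        using K(1) i j sub(1) c by (intro compact_chart_image) (auto simp: compact_Int_closed compact_imp_closed)
      show "?K \<subseteq> snd ?c ` (fst ?c \<inter> fst ?d)" using sub by auto
      show "inj_on ?T ?K"
      proof (rule inj_onI)
        fix v w assume "v \<in> ?K" "w \<in> ?K" and eq: "?T v = ?T w"
        then obtain p q where pq: "p \<in> K i \<inter> K j" "q \<in> K i \<inter> K j" "v = snd ?c p" "w = snd ?c q" by auto
        then have "p \<in> fst ?c" "q \<in> fst ?c" "p \<in> fst ?d" "q \<in> fst ?d" using sub by auto
        then show "v = w" using eq pq c d by (simp add: chart_eq_iff)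
      qed
      show "continuous_on (?T ` ?K) ?f"
        unfolding TK using c\<eta>\<theta>[OF i j d] sub(2) by blast
    qed (use c d in auto)
    finally show ?thesis by (simp add: Y_def TK)
  qed
  have X: "(LINT w:snd (cc i) ` K i|lborel. \<theta> (cc i) i w) = (\<Sum>j\<in>I. X i j)" if i: "i \<in> I" for i
  proof -
    let ?c = "cc i"
    have Kc: "K i \<subseteq> fst ?c" "?c \<in> \<A>" "compact (snd ?c ` K i)"
      using K i cc compact_chart_image by auto
    have "(LINT w:snd ?c ` K i|lborel. \<theta> ?c i w) =
        (LINT w:snd ?c ` K i|lborel. \<Sum>j\<in>I. \<eta> j (chart_inv ?c w) * \<theta> ?c i w)"
      by (simp add: sum_distrib_right[symmetric] one)
    also have "\<dots> = (\<Sum>j\<in>I. LINT w:snd ?c ` K i|lborel. \<eta> j (chart_inv ?c w) * \<theta> ?c i w)"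
      by (rule set_integral_sum) (intro set_integrable_compact c\<eta>\<theta> Kc i image_mono)
    also have "\<dots> = (\<Sum>j\<in>I. X i j)"
      unfolding X_def
    proof (rule sum.cong[OF refl], rule set_integral_restrict)
      fix j w assume "j \<in> I" "w \<in> snd ?c ` K i - snd ?c ` (K i \<inter> K j)"
      moreover from this obtain q where "q \<in> K i" "w = snd ?c q" "q \<notin> K j" by auto
      ultimately show "\<eta> j (chart_inv ?c w) * \<theta> ?c i w = 0"
        using \<eta>(2) Kc by auto
    qed auto
    finally show ?thesis .
  qed
  have Y: "(\<Sum>i\<in>I. Y i j) = 0" if j: "j \<in> I" for j
  proof -
    let ?d = "cc j"
    have Kd: "K j \<subseteq> fst ?d" "?d \<in> \<A>" "compact (snd ?d ` K j)"
      using K j cc compact_chart_image by auto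
    have "(\<Sum>i\<in>I. Y i j) = (\<Sum>i\<in>I. LINT w:snd ?d ` K j|lborel. \<eta> j (chart_inv ?d w) * \<theta> ?d i w)"
      unfolding Y_def
    proof (rule sum.cong[OF refl], rule set_integral_restrict[symmetric])
      fix i w assume "i \<in> I" "w \<in> snd ?d ` K j - snd ?d ` (K i \<inter> K j)"
      moreover from this obtain q where "q \<in> K j" "w = snd ?d q" "q \<notin> K i" by auto
      ultimately show "\<eta> j (chart_inv ?d w) * \<theta> ?d i w = 0"
        using z[of i ?d q] Kd by auto
    qed auto
    also have "\<dots> = (LINT w:snd ?d ` K j|lborel. \<Sum>i\<in>I. \<eta> j (chart_inv ?d w) * \<theta> ?d i w)"
      by (rule set_integral_sum[symmetric]) (intro set_integrable_compact c\<eta>\<theta> Kd j image_mono)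
    also have "\<dots> = (LINT w:snd ?d ` K j|lborel. 0)"
    proof (rule set_lebesgue_integral_cong)
      show "snd ?d ` K j \<in> sets lborel" using Kd by (simp add: borel_compact)
      show "\<forall>w. w \<in> snd ?d ` K j \<longrightarrow> (\<Sum>i\<in>I. \<eta> j (chart_inv ?d w) * \<theta> ?d i w) = 0"
      proof (intro allI impI)
        fix w assume "w \<in> snd ?d ` K j"
        then have w: "w \<in> snd ?d ` fst ?d" using Kd by auto
        have "(\<Sum>i\<in>I. dbar (\<eta> i \<circ> chart_inv ?d) w) = dbar (\<lambda>w. \<Sum>i\<in>I. (\<eta> i \<circ> chart_inv ?d) w) w"
        proof -
          have *: "\<And>i. i \<in> I \<Longrightarrow> C1_on (snd ?d ` fst ?d) (\<eta> i \<circ> chart_inv ?d)"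
            using \<eta>(1) Kd(2) unfolding C1_fun_def by blast
          show ?thesis by (rule bspec[OF conjunct2[OF C1_on_sum[OF I *]] w, symmetric])
        qed
        also have "\<dots> = 0" by (simp add: one dbar_const)
        finally show "(\<Sum>i\<in>I. \<eta> j (chart_inv ?d w) * \<theta> ?d i w) = 0"
          unfolding \<theta>_def by (simp add: sum_distrib_left[symmetric] sum_distrib_right[symmetric])
      qed
    qed
    finally show ?thesis by simp
  qed
  have "(\<Sum>i\<in>I. LINT w:snd (cc i) ` K i|lborel. \<theta> (cc i) i w) = (\<Sum>i\<in>I. \<Sum>j\<in>I. X i j)"
    using X by simp
  also have "\<dots> = (\<Sum>i\<in>I. \<Sum>j\<in>I. Y i j)" using XY by simp
  also have "\<dots> = (\<Sum>j\<in>I. \<Sum>i\<in>I. Y i j)" by (rule sum.swap)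
  also have "\<dots> = 0" using Y by simp
  finally show ?thesis by (simp add: \<theta>_def)
qed

lemma exists_chart_radius:
  assumes "c \<in> \<A>" "p \<in> D" "open D" "D \<subseteq> fst c"
  obtains \<rho> where "\<rho> > 0" "cball (snd c p) (2 * \<rho>) \<subseteq> snd c ` D"
proof -
  have "open (snd c ` D)" using open_chart_image assms by blast
  then obtain e where "e > 0" "cball (snd c p) e \<subseteq> snd c ` D"
    using assms(2) open_contains_cball by blast
  then show thesis using that[of "e / 2"] by simp
qed

lemma filterlim_chart_inv:
  assumes "c \<in> \<A>" "p \<in> fst c"
  shows "filterlim (chart_inv c) (at p) (at (snd c p))"
proof -
  have o: "open (snd c ` fst c)" using is_chart[OF assms(1)] by (simp add: is_chart_def)
  have "isCont (chart_inv c) (snd c p)"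
    using continuous_on_chart_inv[OF assms(1) subset_refl] o assms(2)
    by (simp add: continuous_on_eq_continuous_at)
  then have "(chart_inv c \<longlongrightarrow> p) (at (snd c p))"
    using assms by (simp add: isCont_def)
  moreover have "\<forall>\<^sub>F w in at (snd c p). chart_inv c w \<noteq> p"
  proof -
    have "\<forall>\<^sub>F w in at (snd c p). w \<in> snd c ` fst c \<and> w \<noteq> snd c p"
      using eventually_at_in_open[OF o, of "snd c p"] assms by (auto elim: eventually_mono)
    then show ?thesis
      by (rule eventually_mono) (use assms in auto)
  qed
  ultimately show ?thesis by (simp add: filterlim_at)
qed

text \<open>As \<open>F\<close> vanishes near \<open>S\<close>, the product \<open>F * f\<close>,
  extended by zero, is continuously differentiable with compact support in the plane, and its
  \<open>dbar\<close> is \<open>dbar F * f\<close>. This disposes of the members of the partition of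
  unity that stay away from the poles.\<close>

lemma integral_dbar_holomorphic_eq_0:
  assumes c: "c \<in> \<A>" and K: "compact K" "K \<subseteq> fst c"
    and F: "C1_fun F" "\<And>q. q \<notin> K \<Longrightarrow> F q = 0" "\<And>q. q \<in> N \<Longrightarrow> F q = 0"
    and N: "open N" "S \<subseteq> N" "closed S" and f: "f holomorphic_on snd c ` (fst c - S)"
  shows "(LINT w:snd c ` K|lborel. dbar (F \<circ> chart_inv c) w * f w) = 0"
proof -
  let ?F = "F \<circ> chart_inv c" and ?V = "snd c ` fst c"
  define G where "G w = (if w \<in> ?V then ?F w * f w else 0)" for w
  have o: "open (snd c ` (fst c - S))" "open (snd c ` (fst c \<inter> N))"
    using c N by (intro open_chart_image open_Diff open_Int open_chart; auto)+
  have cK: "compact (snd c ` K)" using compact_chart_image c K by blast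
  have FV: "C1_on ?V ?F" using F(1) c by (simp add: C1_fun_def)
  have V1: "snd c ` (fst c - S) \<subseteq> ?V" by auto
  have G1: "G w = ?F w * f w" if "w \<in> snd c ` (fst c - S)" for w using that by (auto simp: G_def)
  have G2: "G w = 0" if w: "w \<in> snd c ` (fst c \<inter> N)" for w
  proof -
    obtain q where "q \<in> fst c" "q \<in> N" "w = snd c q" using w by blast
    then show ?thesis using F(3) c by (simp add: G_def)
  qed
  have G3: "G w = 0" if w: "w \<notin> snd c ` K" for w
  proof (cases "w \<in> ?V")
    case True
    then obtain q where "q \<in> fst c" "w = snd c q" by blast
    then show ?thesis using F(2)[of q] w c by (auto simp: G_def)
  qed (simp add: G_def)
  have "C1_on (snd c ` (fst c - S)) G"
    by (rule C1_on_cong_open[OF o(1) _ C1_on_mult(1)[OF C1_on_subset[OF FV V1] C1_on_holomorphic(1)[OF o(1) f]]])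
       (use G1 in auto)
  moreover have "C1_on (snd c ` (fst c \<inter> N)) G"
    by (rule C1_on_cong_open[OF o(2) _ C1_on_const[of _ 0]]) (use G2 in auto)
  moreover have "C1_on (- (snd c ` K)) G"
    by (rule C1_on_cong_open[OF _ _ C1_on_const[of _ 0]]) (use G3 cK compact_imp_closed in auto)
  ultimately have "C1_on (snd c ` (fst c - S) \<union> snd c ` (fst c \<inter> N) \<union> - (snd c ` K)) G"
    using o cK compact_imp_closed by (intro C1_on_Un) auto
  moreover have "snd c ` (fst c - S) \<union> snd c ` (fst c \<inter> N) \<union> - (snd c ` K) = UNIV"
    using K(2) N(2) by auto
  ultimately have "C1_on UNIV G" by simp
  then have "(LINT w:snd c ` K|lborel. dbar G w) = 0"
    by (rule integral_dbar_eq_0[OF _ cK]) (use G3 in auto)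
  moreover have "(LINT w:snd c ` K|lborel. dbar G w) = (LINT w:snd c ` K|lborel. dbar ?F w * f w)"
  proof (rule set_lebesgue_integral_cong)
    show "snd c ` K \<in> sets lborel" using cK by (simp add: borel_compact)
    show "\<forall>w. w \<in> snd c ` K \<longrightarrow> dbar G w = dbar ?F w * f w"
    proof (intro allI impI)
      fix w assume "w \<in> snd c ` K"
      then obtain q where q: "q \<in> fst c" "w = snd c q" using K(2) by blast
      show "dbar G w = dbar ?F w * f w"
      proof (cases "q \<in> N")
        case True
        have "dbar G w = dbar (\<lambda>_. 0) w"
          by (rule dbar_cong_open[OF o(2)]) (use q True G2 in auto)
        then show ?thesis
          using dbar_locally_constant[OF c N(1) q(1) True F(3)] q(2) by (simp add: dbar_const)
      next
        case False
        then have w: "w \<in> snd c ` (fst c - S)" using q N(2) by blast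
        have "dbar G w = dbar (\<lambda>w. ?F w * f w) w"
          by (rule dbar_cong_open[OF o(1) w G1])
        also have "\<dots> = dbar ?F w * f w + ?F w * dbar f w"
          by (rule C1_on_mult(2)[OF C1_on_subset[OF FV V1] C1_on_holomorphic(1)[OF o(1) f] w])
        finally show ?thesis using C1_on_holomorphic(2)[OF o(1) f w] by simp
      qed
    qed
  qed
  ultimately show ?thesis by simp
qed

text \<open>Residues enter as limits of the coordinate times the coefficient, each in some chart of
  one's choice. The value \<open>R p = 0\<close> is allowed, so \<open>S\<close> may also contain
  points whose singularity is removable; in the applications these are zeros and poles of the
  factors that cancel each other.\<close>

theorem sum_residues_eq_0:
  assumes cpt: "compact (UNIV :: 'a set)" and S: "finite S"
    and hol: "\<And>c. c \<in> \<A> \<Longrightarrow> \<omega> c holomorphic_on snd c ` (fst c - S)"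
    and trans: "\<And>c d q. c \<in> \<A> \<Longrightarrow> d \<in> \<A> \<Longrightarrow> q \<in> fst c \<Longrightarrow> q \<in> fst d \<Longrightarrow> q \<notin> S \<Longrightarrow>
        \<omega> c (snd c q) = \<omega> d (snd d q) * deriv (transition c d) (snd c q)"
    and res: "\<And>p. p \<in> S \<Longrightarrow> \<exists>c\<in>\<A>. p \<in> fst c \<and>
        ((\<lambda>q. (snd c q - snd c p) * \<omega> c (snd c q)) \<longlongrightarrow> R p) (at p)"
  shows "(\<Sum>p\<in>S. R p) = 0"
proof -
  \<comment> \<open>The closed disc of coordinate radius \<open>2 * \<rho>\<close> contains no point
    of \<open>S\<close> other than possibly \<open>p\<close>, so on the support of the bump a pole
    can only occur at its centre.\<close>
  define good where "good p c \<rho> \<longleftrightarrow> c \<in> \<A> \<and> p \<in> fst c \<and> \<rho> > 0 \<and>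
      cball (snd c p) (2 * \<rho>) \<subseteq> snd c ` (fst c - (S - {p})) \<and>
      (p \<in> S \<longrightarrow> ((\<lambda>q. (snd c q - snd c p) * \<omega> c (snd c q)) \<longlongrightarrow> R p) (at p))" for p c \<rho>
  have "\<forall>p. \<exists>c \<rho>. good p c \<rho>"
  proof
    fix p
    obtain c where c: "c \<in> \<A>" "p \<in> fst c"
        "p \<in> S \<longrightarrow> ((\<lambda>q. (snd c q - snd c p) * \<omega> c (snd c q)) \<longlongrightarrow> R p) (at p)"
    proof (cases "p \<in> S")
      case True
      from res[OF this] obtain c where "c \<in> \<A>" "p \<in> fst c"
        "((\<lambda>q. (snd c q - snd c p) * \<omega> c (snd c q)) \<longlongrightarrow> R p) (at p)" by (elim bexE conjE)
      then show ?thesis by (rule that[OF _ _ impI])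
    next
      case False
      from chart_exists[of p] obtain c where "c \<in> \<A>" "p \<in> fst c" by (elim bexE)
      then show ?thesis by (rule that) (simp add: False)
    qed
    have "open (fst c - (S - {p}))"
      using S open_chart[OF c(1)] by (intro open_Diff finite_imp_closed) auto
    then obtain \<rho> where "\<rho> > 0" "cball (snd c p) (2 * \<rho>) \<subseteq> snd c ` (fst c - (S - {p}))"
      by (rule exists_chart_radius[OF c(1), rotated]) (use c(2) in auto)
    with c have "good p c \<rho>" unfolding good_def by (intro conjI)
    then show "\<exists>c \<rho>. good p c \<rho>" by (intro exI)
  qed
  then obtain ch \<rho> where good: "\<And>p. good p (ch p) (\<rho> p)" by metis
  have ch: "\<And>p. ch p \<in> \<A>" "\<And>p. p \<in> fst (ch p)" and \<rho>: "\<And>p. \<rho> p > 0"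
    and sub: "\<And>p. cball (snd (ch p) p) (2 * \<rho> p) \<subseteq> snd (ch p) ` (fst (ch p) - (S - {p}))"
    and lim: "\<And>p. p \<in> S \<Longrightarrow> ((\<lambda>q. (snd (ch p) q - snd (ch p) p) * \<omega> (ch p) (snd (ch p) q)) \<longlongrightarrow> R p) (at p)"
    using good unfolding good_def by simp_all
  have sub': "cball (snd (ch p) p) (2 * \<rho> p) \<subseteq> snd (ch p) ` fst (ch p)" for p
    using sub[of p] by blast
  define b where "b p = chart_bump (ch p) p (\<rho> p)" for p
  define KK where "KK p = chart_cball (ch p) p (\<rho> p)" for p
  define G where "G p = chart_ball (ch p) p (\<rho> p)" for p
  have KK: "compact (KK p)" "KK p \<subseteq> fst (ch p) - (S - {p})" "KK p \<subseteq> fst (ch p)"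
      "snd (ch p) ` KK p = cball (snd (ch p) p) (2 * \<rho> p)" for p
    using chart_cball[OF ch(1) sub Diff_subset, of p] unfolding KK_def by auto
  have G: "open (G p)" "p \<in> G p" "q \<in> G p \<Longrightarrow> b p q = 1" for p q
    unfolding G_def b_def using chart_ball[OF ch(1) ch(2) \<rho> sub'] by - assumption+
  have b0: "b p q = 0" if "q \<notin> KK p" for p q
    using chart_bump_eq_0[OF ch(1) \<rho>] that unfolding b_def KK_def by blast
  have C1b: "C1_fun (b p)" for p
    unfolding b_def by (rule C1_fun_chart_bump[OF ch(1) \<rho> sub'])
  obtain T where T: "finite T" "UNIV \<subseteq> (\<Union>p\<in>T. G p)"
  proof (rule compactE_image[OF cpt, of UNIV G])
    show "UNIV \<subseteq> (\<Union>p\<in>UNIV. G p)" using G(2) by blast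
  qed (use G(1) in auto)
  define s where "s q = (\<Sum>t\<in>T. b t q)" for q
  have s0: "s q \<noteq> 0" for q
  proof -
    obtain t where t: "t \<in> T" "q \<in> G t" using T(2) by blast
    have nn: "0 \<le> Re (b t q)" for t using chart_bump_nonneg by (simp add: b_def)
    have "1 \<le> Re (b t q)" using G(3)[OF t(2)] by simp
    also have "\<dots> \<le> (\<Sum>t\<in>T. Re (b t q))"
      by (rule member_le_sum[OF t(1) nn T(1)])
    finally have "1 \<le> Re (s q)" by (simp add: s_def)
    then show ?thesis by auto
  qed
  define e where "e q = (\<Sum>p\<in>S. b p q)" for q
  \<comment> \<open>The unmodified bumps \<open>b p\<close> around the poles, together with a
    normalised partition of unity multiplied by one minus their sum \<open>e\<close>; the latter
    members vanish where \<open>e\<close> is 1. A disjoint sum of index types is used because a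
    point may serve both as a pole and as a centre of the cover.\<close>
  define \<eta> where "\<eta> i q = (case i of Inl p \<Rightarrow> b p q | Inr t \<Rightarrow> (1 + (- 1) * e q) * (b t q * inverse (s q)))"
    for i :: "'a + 'a" and q
  \<comment> \<open>Near each pole \<open>p\<close>, the part of the region with
    \<open>b p = 1\<close> that avoids the supports of the bumps at all other poles. There every
    \<open>b\<close> indexed by a pole is constantly 0 or 1, and \<open>e\<close> is 1.\<close>
  define N where "N = (\<Union>p\<in>S. G p - (\<Union>p'\<in>S - {p}. KK p'))"
  have oN: "open (G p - (\<Union>p'\<in>S - {p}. KK p'))" for p
    using G(1) S KK(1) by (intro open_Diff closed_UN) (auto intro: compact_imp_closed)
  have N: "open N" "S \<subseteq> N"
  proof -
    show "open N" unfolding N_def using oN by blast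
    have "p \<notin> KK p'" if "p \<in> S" "p' \<in> S - {p}" for p p' using KK(2)[of p'] that by blast
    then show "S \<subseteq> N" unfolding N_def using G(2) by blast
  qed
  have bN: "b p' q = (if p' = p then 1 else 0)"
    if "p \<in> S" "p' \<in> S" "q \<in> G p - (\<Union>p'\<in>S - {p}. KK p')" for p p' q
    using that G(3)[of q p] b0[of q p'] by auto
  have eN: "e q = 1" if "q \<in> N" for q
  proof -
    obtain p where p: "p \<in> S" "q \<in> G p - (\<Union>p'\<in>S - {p}. KK p')" using \<open>q \<in> N\<close> unfolding N_def by blast
    have "e q = (\<Sum>p'\<in>S. if p' = p then 1 else 0)"
      unfolding e_def by (rule sum.cong[OF refl bN[OF p(1) _ p(2)]])
    then show ?thesis using p(1) S by simp
  qed
  define I where "I = Inl ` S \<union> Inr ` T"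
  define cc where "cc i = ch (case i of Inl p \<Rightarrow> p | Inr t \<Rightarrow> t)" for i :: "'a + 'a"
  define K where "K i = KK (case i of Inl p \<Rightarrow> p | Inr t \<Rightarrow> t)" for i :: "'a + 'a"
  have C1: "C1_fun (\<eta> (Inl p))" "C1_fun (\<eta> (Inr p))" for p
  proof -
    have "C1_fun e" "C1_fun s" unfolding e_def s_def using S T(1) C1b by (intro C1_fun_sum; simp)+
    then show "C1_fun (\<eta> (Inr p))"
      unfolding \<eta>_def sum.case
      by (intro C1_fun_mult C1_fun_add C1_fun_const C1_fun_inverse C1b s0)
    show "C1_fun (\<eta> (Inl p))"
      unfolding \<eta>_def sum.case using C1b[of p] by simp
  qed
  have \<eta>0: "\<eta> i q = 0" if "q \<notin> K i" for i q
    using that b0 by (auto simp: \<eta>_def K_def split: sum.splits)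
  have sumI: "(\<Sum>i\<in>I. f i) = (\<Sum>p\<in>S. f (Inl p)) + (\<Sum>t\<in>T. f (Inr t))" for f :: "'a + 'a \<Rightarrow> complex"
    unfolding I_def using S T(1)
    by (subst sum.union_disjoint) (auto simp: sum.reindex)
  have "(\<Sum>i\<in>I. LINT w:snd (cc i) ` K i|lborel. dbar (\<eta> i \<circ> chart_inv (cc i)) w * \<omega> (cc i) w) = 0"
  proof (rule sum_integral_dbar_partition_eq_0[where N = N and S = S])
    show "finite I" using S T(1) by (simp add: I_def)
    show "cc i \<in> \<A>" "compact (K i)" "K i \<subseteq> fst (cc i)" for i
      using ch KK by (auto simp: cc_def K_def split: sum.splits)
    show "C1_fun (\<eta> i)" for i using C1 by (cases i) auto
    show "\<eta> i q = 0" if "q \<notin> K i" for i q using \<eta>0 that .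
    show "(\<Sum>i\<in>I. \<eta> i q) = 1" for q
    proof -
      have "(\<Sum>i\<in>I. \<eta> i q) = e q + (1 + (- 1) * e q) * ((\<Sum>t\<in>T. b t q) * inverse (s q))"
        unfolding sumI by (simp add: \<eta>_def e_def sum_distrib_left sum_distrib_right)
      also have "(\<Sum>t\<in>T. b t q) * inverse (s q) = 1"
        using s0[of q] by (simp add: s_def)
      finally show ?thesis by simp
    qed
    show "open N" "S \<subseteq> N" "closed S" using N S by (auto intro: finite_imp_closed)
    show "continuous_on (snd c ` (fst c - S)) (\<omega> c)" if "c \<in> \<A>" for c
      using hol[OF that] holomorphic_on_imp_continuous_on by blast
    show "dbar (\<eta> i \<circ> chart_inv c) (snd c q) = 0"
      if "i \<in> I" "c \<in> \<A>" "q \<in> fst c" "q \<in> N" for i c q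
    proof -
      obtain p where p: "p \<in> S" "q \<in> G p - (\<Union>p'\<in>S - {p}. KK p')" using \<open>q \<in> N\<close> unfolding N_def by blast
      show ?thesis
      proof (cases i)
        case (Inl p')
        then have "p' \<in> S" using \<open>i \<in> I\<close> by (auto simp: I_def)
        show ?thesis
          by (rule dbar_locally_constant[OF that(2) oN that(3) p(2), of _ "if p' = p then 1 else 0"])
             (use bN[OF p(1) \<open>p' \<in> S\<close>] Inl in \<open>simp add: \<eta>_def\<close>)
      next
        case (Inr t)
        then show ?thesis
          by (intro dbar_locally_constant[OF that(2) N(1) that(3,4), of _ 0]) (simp add: \<eta>_def eN)
      qed
    qed
  qed (rule trans)
  moreover have "(LINT w:snd (cc (Inr t)) ` K (Inr t)|lborel.
      dbar (\<eta> (Inr t) \<circ> chart_inv (cc (Inr t))) w * \<omega> (cc (Inr t)) w) = 0" for t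
  proof (rule integral_dbar_holomorphic_eq_0[where N = N and S = S])
    show "cc (Inr t) \<in> \<A>" by (simp add: cc_def ch)
    show "compact (K (Inr t))" "K (Inr t) \<subseteq> fst (cc (Inr t))" by (simp_all add: K_def cc_def KK)
    show "\<eta> (Inr t) q = 0" if "q \<in> N" for q using that by (simp add: \<eta>_def eN)
    show "closed S" using S by (rule finite_imp_closed)
  qed (use C1(2) \<eta>0 N hol ch in \<open>simp_all add: cc_def\<close>)
  moreover have "(LINT w:snd (cc (Inl p)) ` K (Inl p)|lborel.
      dbar (\<eta> (Inl p) \<circ> chart_inv (cc (Inl p))) w * \<omega> (cc (Inl p)) w) = R p * bump_const" if p: "p \<in> S" for p
  proof -
    let ?c = "ch p" and ?a = "snd (ch p) p"
    let ?V = "snd ?c ` fst ?c" and ?D = "snd ?c ` (fst ?c - (S - {p}))"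
    have o: "open (fst ?c - (S - {p}))"
      using S open_chart[OF ch(1)] by (intro open_Diff finite_imp_closed) auto
    then have oD: "open ?D" by (intro open_chart_image[OF ch(1)]) auto
    have aD: "?a \<in> ?D" using ch by blast
    have Da: "?D - {?a} = snd ?c ` (fst ?c - S)"
      using p ch(2)[of p] inj_on_chart[OF ch(1), of p] by (auto dest: inj_onD)
    have "((\<lambda>w. (snd ?c (chart_inv ?c w) - ?a) * \<omega> ?c (snd ?c (chart_inv ?c w))) \<longlongrightarrow> R p) (at ?a)"
      by (rule filterlim_compose[OF lim[OF p] filterlim_chart_inv[OF ch]])
    moreover have "\<forall>\<^sub>F w in at ?a. (snd ?c (chart_inv ?c w) - ?a) * \<omega> ?c (snd ?c (chart_inv ?c w)) =
        (w - ?a) * \<omega> ?c w"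
    proof -
      have "\<forall>\<^sub>F w in at ?a. w \<in> ?D"
        using oD aD eventually_at_topological by blast
      then show ?thesis
      proof (rule eventually_mono)
        fix w assume "w \<in> ?D"
        then obtain q where "q \<in> fst ?c" "w = snd ?c q" by blast
        then show "(snd ?c (chart_inv ?c w) - ?a) * \<omega> ?c (snd ?c (chart_inv ?c w)) = (w - ?a) * \<omega> ?c w"
          using ch by simp
      qed
    qed
    ultimately have lim': "((\<lambda>w. (w - ?a) * \<omega> ?c w) \<longlongrightarrow> R p) (at ?a)"
      by (rule Lim_transform_eventually)
    obtain h where h: "h holomorphic_on ?D" "\<And>w. w \<in> ?D - {?a} \<Longrightarrow> \<omega> ?c w = R p / (w - ?a) + h w"
      using holomorphic_simple_pole_split[OF oD aD _ lim'] hol[OF ch(1)] unfolding Da by blast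
    have "(LINT w:cball ?a (2 * \<rho> p)|lborel. dbar (\<eta> (Inl p) \<circ> chart_inv ?c) w * \<omega> ?c w) =
       (LINT w:cball ?a (2 * \<rho> p)|lborel. dbar (bump_at ?a (\<rho> p)) w * \<omega> ?c w)"
    proof (rule set_lebesgue_integral_cong)
      show "\<forall>w. w \<in> cball ?a (2 * \<rho> p) \<longrightarrow>
        dbar (\<eta> (Inl p) \<circ> chart_inv ?c) w * \<omega> ?c w = dbar (bump_at ?a (\<rho> p)) w * \<omega> ?c w"
      proof (intro allI impI)
        fix w assume "w \<in> cball ?a (2 * \<rho> p)"
        then have w: "w \<in> ?V" using sub' by blast
        have "dbar (\<eta> (Inl p) \<circ> chart_inv ?c) w = dbar (bump_at ?a (\<rho> p)) w"
        proof (rule dbar_cong_open[OF _ w])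
          show "open ?V" by (intro open_chart_image ch open_chart) auto
          fix v assume "v \<in> ?V"
          then obtain q where "q \<in> fst ?c" "v = snd ?c q" by blast
          then show "(\<eta> (Inl p) \<circ> chart_inv ?c) v = bump_at ?a (\<rho> p) v"
            using ch by (simp add: \<eta>_def b_def chart_bump_def)
        qed
        then show "dbar (\<eta> (Inl p) \<circ> chart_inv ?c) w * \<omega> ?c w = dbar (bump_at ?a (\<rho> p)) w * \<omega> ?c w"
          by simp
      qed
    qed simp
    also have "\<dots> = R p * bump_const"
      by (rule integral_dbar_bump_at_simple_pole[OF \<rho> oD sub h])
    finally show ?thesis unfolding cc_def K_def sum.case KK(4) .
  qed
  ultimately have "(\<Sum>p\<in>S. R p * bump_const) = 0"
    unfolding sumI by simp
  then show ?thesis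
    using bump_const_nonzero by (simp add: sum_distrib_right[symmetric])
qed

end

section \<open>Local behaviour of functions on the surface\<close>

text \<open>Differentiation under the sign of the Cauchy integral.\<close>

lemma holomorphic_parameter_derivative:
  fixes f ft :: "real \<Rightarrow> complex \<Rightarrow> complex"
  assumes \<delta>: "\<delta> > 0" and \<rho>: "\<rho> > 0"
    and hol: "\<And>t. t \<in> {-\<delta><..<\<delta>} \<Longrightarrow> f t holomorphic_on cball a \<rho>"
    and der: "\<And>t \<zeta>. t \<in> {-\<delta><..<\<delta>} \<Longrightarrow> \<zeta> \<in> sphere a \<rho> \<Longrightarrow>
        ((\<lambda>t. f t \<zeta>) has_vector_derivative ft t \<zeta>) (at t)"
    and cont: "continuous_on ({-\<delta><..<\<delta>} \<times> sphere a \<rho>) (\<lambda>(t, \<zeta>). ft t \<zeta>)"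
  obtains g where "g holomorphic_on ball a \<rho>"
    "\<And>w. w \<in> ball a \<rho> \<Longrightarrow> ((\<lambda>t. f t w) has_vector_derivative g w) (at 0)"
proof -
  let ?I = "{-\<delta><..<\<delta>}" and ?c = "circlepath a \<rho>"
  let ?c' = "\<lambda>s. vector_derivative ?c (at s within {0..1})"
  have cs: "?c s \<in> sphere a \<rho>" if "s \<in> {0..1}" for s
  proof -
    have "?c s \<in> path_image ?c" using that unfolding path_image_def by (rule imageI)
    then show ?thesis using \<rho> by simp
  qed
  have cc: "continuous_on {0..1} ?c"
    using valid_path_imp_path[OF valid_path_circlepath] unfolding path_def .
  have c': "?c' s = 2 * pi * \<i> * \<rho> * exp (2 * of_real pi * \<i> * s)" if "s \<in> {0..1}" for s
    using that by (simp add: vector_derivative_circlepath01)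
  have cc': "continuous_on {0..1} ?c'"
  proof (rule continuous_on_eq)
    show "continuous_on {0..1} (\<lambda>s::real. 2 * pi * \<i> * \<rho> * exp (2 * of_real pi * \<i> * s))"
      by (intro continuous_intros)
  qed (rule c'[symmetric])
  have ne: "?c s \<noteq> w" if "s \<in> {0..1}" "w \<in> ball a \<rho>" for s w
    using cs[OF that(1)] that(2) by auto
  \<comment> \<open>The t-derivative at 0 of Cauchy's integral for \<open>f t w\<close>. It involves
    \<open>ft\<close> only on the circle, where continuity is assumed.\<close>
  define J where "J w = integral {0..1} (\<lambda>s. ft 0 (?c s) / (?c s - w) * ?c' s)" for w
  have derJ: "((\<lambda>t. integral {0..1} (\<lambda>s. f t (?c s) / (?c s - w) * ?c' s)) has_vector_derivative J w) (at 0)"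
    if w: "w \<in> ball a \<rho>" for w
  proof -
    have "((\<lambda>t. integral (cbox 0 1) (\<lambda>s. f t (?c s) / (?c s - w) * ?c' s)) has_vector_derivative
        integral (cbox 0 1) (\<lambda>s. ft 0 (?c s) / (?c s - w) * ?c' s)) (at 0 within ?I)"
    proof (rule leibniz_rule_vector_derivative[
          where fx = "\<lambda>t s. ft t (?c s) / (?c s - w) * ?c' s"])
      fix t s :: real assume ts: "t \<in> ?I" "s \<in> cbox 0 1"
      then have "((\<lambda>t. f t (?c s)) has_vector_derivative ft t (?c s)) (at t)"
        by (intro der cs) auto
      then have "((\<lambda>t. f t (?c s) * (inverse (?c s - w) * ?c' s)) has_vector_derivative
          ft t (?c s) * (inverse (?c s - w) * ?c' s)) (at t)"
        by (rule has_vector_derivative_mult_left)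
      then show "((\<lambda>t. f t (?c s) / (?c s - w) * ?c' s) has_vector_derivative
          ft t (?c s) / (?c s - w) * ?c' s) (at t within ?I)"
        by (simp add: has_vector_derivative_at_within divide_inverse mult.assoc)
    next
      fix t assume t: "t \<in> ?I"
      have "continuous_on (sphere a \<rho>) (f t)"
        using hol[OF t] holomorphic_on_imp_continuous_on continuous_on_subset sphere_cball by blast
      then have "continuous_on {0..1} (\<lambda>s. f t (?c s))"
        by (rule continuous_on_compose2[OF _ cc]) (use cs in auto)
      then show "(\<lambda>s. f t (?c s) / (?c s - w) * ?c' s) integrable_on cbox 0 1"
        using ne w cc cc' by (intro integrable_continuous) (auto intro!: continuous_intros)
    next
      have 1: "continuous_on (?I \<times> cbox 0 1) (\<lambda>x. (fst x, ?c (snd x)))"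
        by (intro continuous_intros continuous_on_compose2[OF cc]) auto
      have 2: "continuous_on (?I \<times> cbox 0 1) (\<lambda>x. ft (fst x) (?c (snd x)))"
        using continuous_on_compose2[OF cont 1] cs by (force simp: case_prod_unfold)
      have 3: "continuous_on (?I \<times> cbox 0 1) (\<lambda>x. ?c (snd x))" "continuous_on (?I \<times> cbox 0 1) (\<lambda>x. ?c' (snd x))"
        by (rule continuous_on_compose2[OF cc], auto intro!: continuous_intros)
           (rule continuous_on_compose2[OF cc'], auto intro!: continuous_intros)
      have "continuous_on (?I \<times> cbox 0 1) (\<lambda>x. ft (fst x) (?c (snd x)) / (?c (snd x) - w) * ?c' (snd x))"
        using ne w by (intro continuous_intros 2 3) auto
      then show "continuous_on (?I \<times> cbox 0 1) (\<lambda>(t, s). ft t (?c s) / (?c s - w) * ?c' s)"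
        by (simp add: case_prod_unfold)
    qed (use \<delta> in simp_all)
    moreover have "at (0::real) within ?I = at 0"
      using \<delta> by (intro at_within_open) auto
    ultimately show ?thesis unfolding J_def cbox_interval by metis
  qed
  have CI: "integral {0..1} (\<lambda>s. f t (?c s) / (?c s - w) * ?c' s) = 2 * of_real pi * \<i> * f t w"
    if "t \<in> ?I" "w \<in> ball a \<rho>" for t w
  proof -
    have "((\<lambda>\<zeta>. f t \<zeta> / (\<zeta> - w)) has_contour_integral (2 * of_real pi * \<i> * f t w)) ?c"
      using hol[OF that(1)] that(2) by (intro Cauchy_integral_circlepath_simple) (auto simp: dist_norm norm_minus_commute)
    then show ?thesis unfolding has_contour_integral_def by (rule integral_unique)
  qed
  have der0: "((\<lambda>t. f t w) has_vector_derivative J w / (2 * of_real pi * \<i>)) (at 0)"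
    if w: "w \<in> ball a \<rho>" for w
  proof -
    define k where "k = 2 * of_real pi * \<i>"
    have "k \<noteq> 0" by (simp add: k_def)
    have "((\<lambda>t. k * f t w) has_vector_derivative J w) (at 0)"
      by (rule has_vector_derivative_transform_within_open[OF derJ[OF w], of ?I])
         (use \<delta> in \<open>simp_all only: CI[OF _ w] k_def, auto\<close>)
    from has_vector_derivative_divide[OF this, of k]
    have "((\<lambda>t. f t w) has_vector_derivative J w / k) (at 0)"
      using \<open>k \<noteq> 0\<close> by simp
    then show ?thesis unfolding k_def .
  qed
  moreover have "(\<lambda>w. J w / (2 * of_real pi * \<i>)) holomorphic_on ball a \<rho>"
  proof -
    have "continuous_on (sphere a \<rho>) (ft 0)"
    proof -
      have "continuous_on (sphere a \<rho>) (\<lambda>\<zeta>. (0::real, \<zeta>))" by (intro continuous_intros)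
      moreover have "(\<lambda>\<zeta>. (0::real, \<zeta>)) ` sphere a \<rho> \<subseteq> ?I \<times> sphere a \<rho>" using \<delta> by auto
      ultimately show ?thesis using continuous_on_compose2[OF cont] by fastforce
    qed
    then have cf: "continuous_on (path_image ?c) (ft 0)" using \<rho> by simp
    have int: "((\<lambda>\<zeta>. ft 0 \<zeta> / (\<zeta> - w) ^ 1) has_contour_integral J w) ?c" if "w \<in> ball a \<rho>" for w
    proof -
      have "continuous_on {0..1} (\<lambda>s. ft 0 (?c s))"
        by (rule continuous_on_compose2[OF \<open>continuous_on (sphere a \<rho>) (ft 0)\<close> cc]) (use cs in auto)
      then have "(\<lambda>s. ft 0 (?c s) / (?c s - w) * ?c' s) integrable_on {0..1}"
        using ne that cc cc' by (intro integrable_continuous_interval) (auto intro!: continuous_intros)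
      then show ?thesis unfolding has_contour_integral_def J_def power_one_right by (rule integrable_integral)
    qed
    \<comment> \<open>As a Cauchy integral of a continuous function on the circle, \<open>J\<close>
      is holomorphic inside.\<close>
    have "(J has_field_derivative (of_nat 1 * contour_integral ?c (\<lambda>u. ft 0 u / (u - w) ^ Suc 1))) (at w)"
      if "w \<in> ball a \<rho>" for w
      by (rule Cauchy_next_derivative_circlepath(2)[OF cf int _ that]) auto
    then have "J holomorphic_on ball a \<rho>"
      using holomorphic_on_open[OF open_ball] by blast
    then show ?thesis by (intro holomorphic_intros) auto
  qed
  ultimately show thesis using that by blast
qed

section \<open>Simple poles as holomorphic extendability\<close>

text \<open>Translates the condition on \<open>zorder\<close> into extendability of
  \<open>(w - a) * f w\<close>, the form in which it survives differentiation in u and conjugation.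
  If there is no pole, \<open>f\<close> has a finite limit, and the extension comes from the
  splitting with residue 0.\<close>

lemma simple_pole_at_extension:
  assumes "f meromorphic_on {a}" "is_pole f a \<longrightarrow> zorder f a = -1"
  obtains r g where "r > 0" "g holomorphic_on ball a r" "\<And>w. w \<in> ball a r - {a} \<Longrightarrow> g w = (w - a) * f w"
proof (cases "is_pole f a")
  case True
  have "\<exists>\<^sub>F w in at a. f w \<noteq> 0"
    using non_zero_neighbour_pole[OF True] by (rule eventually_frequently[OF at_neq_bot])
  then obtain r where r: "r > 0" "zor_poly f a holomorphic_on cball a r"
    "\<forall>w\<in>cball a r - {a}. f w = zor_poly f a w * (w - a) powi zorder f a"
    using zorder_exist[OF meromorphic_on_isolated_singularity meromorphic_on_not_essential, OF assms(1) assms(1)] by blast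
  show thesis
  proof (rule that[OF r(1)])
    show "zor_poly f a holomorphic_on ball a r" using r(2) ball_subset_cball holomorphic_on_subset by blast
    show "zor_poly f a w = (w - a) * f w" if "w \<in> ball a r - {a}" for w
      using r(3) that True assms(2) by (auto simp: power_int_minus divide_inverse)
  qed
next
  case False
  obtain L where L: "f \<midarrow>a\<rightarrow> L"
    using meromorphic_on_not_essential[OF assms(1)] False unfolding not_essential_def by blast
  obtain r where r: "r > 0" "f analytic_on ball a r - {a}"
    using meromorphic_on_isolated_singularity[OF assms(1)] unfolding isolated_singularity_at_def by blast
  then have hol: "f holomorphic_on ball a r - {a}" using analytic_imp_holomorphic by blast
  have "((\<lambda>w. (w - a) * f w) \<longlongrightarrow> (a - a) * L) (at a)"
    by (intro tendsto_intros L)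
  then have lim: "((\<lambda>w. (w - a) * f w) \<longlongrightarrow> 0) (at a)" by simp
  obtain h where h: "h holomorphic_on ball a r" "\<And>w. w \<in> ball a r - {a} \<Longrightarrow> f w = 0 / (w - a) + h w"
    using holomorphic_simple_pole_split[OF open_ball _ hol lim] r(1) by auto
  show thesis
    by (rule that[OF r(1), of "\<lambda>w. (w - a) * h w"]) (use h in \<open>auto intro!: holomorphic_intros\<close>)
qed

text \<open>If \<open>g a = 0\<close>, then \<open>f\<close> tends to the derivative of
  \<open>g\<close> at \<open>a\<close> and has no pole; otherwise \<open>g w / (w - a)\<close>
  exhibits the order -1.\<close>

lemma simple_pole_at_if_extension:
  assumes r: "r > 0" and g: "g holomorphic_on ball a r"
    and f: "\<And>w. w \<in> ball a r - {a} \<Longrightarrow> g w = (w - a) * f w"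
  shows "f meromorphic_on {a}" "is_pole f a \<longrightarrow> zorder f a = -1"
proof -
  have ev: "\<forall>\<^sub>F w in at a. f w = g w / (w - a)"
  proof -
    have "\<forall>\<^sub>F w in at a. w \<in> ball a r - {a}"
      using r eventually_at_ball[of r a UNIV] by (auto simp: eventually_at_filter elim: eventually_mono)
    then show ?thesis by (rule eventually_mono) (use f in auto)
  qed
  have ga: "g analytic_on {a}" using g r analytic_at_ball by blast
  have "(\<lambda>w. g w / (w - a)) meromorphic_on {a}"
    by (intro meromorphic_intros analytic_on_imp_meromorphic_on ga)
  then show "f meromorphic_on {a}"
    using meromorphic_on_cong[of "{a}" f "\<lambda>w. g w / (w - a)" "{a}"] ev by auto
  show "is_pole f a \<longrightarrow> zorder f a = -1"
  proof
    assume "is_pole f a"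
    then have p: "is_pole (\<lambda>w. g w / (w - a)) a"
      using is_pole_cong[OF ev refl] by simp
    have "g a \<noteq> 0"
    proof
      assume ga0: "g a = 0"
      have "(g has_field_derivative deriv g a) (at a)"
        using g r holomorphic_derivI[OF g open_ball] by auto
      then have "(\<lambda>w. g w / (w - a)) \<midarrow>a\<rightarrow> deriv g a"
        using ga0 by (simp add: has_field_derivative_iff)
      then show False using p not_tendsto_and_filterlim_at_infinity[of "at a"] unfolding is_pole_def by auto
    qed
    then have "zorder (\<lambda>w. g w / (w - a)) a = -1"
      using g r by (intro zorder_eqI[OF open_ball _ g]) (auto simp: power_int_minus divide_inverse)
    then show "zorder f a = -1" using zorder_cong[OF ev refl] by simp
  qed
qed

lemma holomorphic_on_locally:
  assumes "\<And>x. x \<in> S \<Longrightarrow> \<exists>T. open T \<and> x \<in> T \<and> f holomorphic_on T"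
  shows "f holomorphic_on S"
  unfolding holomorphic_on_def
proof
  fix x assume "x \<in> S"
  then obtain T where "open T" "x \<in> T" "f holomorphic_on T" using assms by blast
  then have "f field_differentiable (at x)" by (rule holomorphic_on_imp_differentiable_at[rotated 1])
  then show "f field_differentiable (at x within S)" by (rule field_differentiable_at_within)
qed

lemma cnj_image_eq_vimage: "cnj ` S = cnj -` S"
proof safe
  fix x assume "cnj x \<in> S"
  then have "cnj (cnj x) \<in> cnj ` S" by (rule imageI)
  then show "x \<in> cnj ` S" by simp
qed simp

lemma power_int_ratio:
  fixes x y :: complex
  assumes "y \<noteq> 0"
  shows "x powi n = (x / y) powi n * y powi n"
  using assms by (simp add: power_int_mult_distrib[symmetric])

context riemann_surface_atlas
begin

lemma filterlim_chart:
  assumes "c \<in> \<A>" "p \<in> fst c"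
  shows "filterlim (snd c) (at (snd c p)) (at p)"
proof -
  have "isCont (snd c) p"
    using continuous_on_chart[OF assms(1) subset_refl] open_chart[OF assms(1)] assms(2)
    by (simp add: continuous_on_eq_continuous_at)
  then have "(snd c \<longlongrightarrow> snd c p) (at p)" by (simp add: isCont_def)
  moreover have "\<forall>\<^sub>F q in at p. snd c q \<noteq> snd c p"
  proof -
    have "\<forall>\<^sub>F q in at p. q \<in> fst c - {p}"
      using open_chart[OF assms(1)] assms(2) by (intro eventually_at_in_open)
    then show ?thesis by (rule eventually_mono) (use assms in \<open>auto simp: chart_eq_iff\<close>)
  qed
  ultimately show ?thesis by (simp add: filterlim_at)
qed

lemma tendsto_chart:
  assumes "c \<in> \<A>" "open D" "p \<in> D" "D \<subseteq> fst c"
    and "(g \<longlongrightarrow> L) (at (snd c p))" "\<And>q. q \<in> D \<Longrightarrow> q \<noteq> p \<Longrightarrow> F q = g (snd c q)"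
  shows "(F \<longlongrightarrow> L) (at p)"
proof -
  have "p \<in> fst c" using assms(3,4) by blast
  have "((\<lambda>q. g (snd c q)) \<longlongrightarrow> L) (at p)"
    by (rule filterlim_compose[OF assms(5) filterlim_chart[OF assms(1) \<open>p \<in> fst c\<close>]])
  moreover have "\<forall>\<^sub>F q in at p. g (snd c q) = F q"
  proof -
    have "\<forall>\<^sub>F q in at p. q \<in> D - {p}" using assms(2,3) by (intro eventually_at_in_open)
    then show ?thesis by (rule eventually_mono) (use assms(6) in auto)
  qed
  ultimately show ?thesis by (rule Lim_transform_eventually)
qed

section \<open>Orders of functions at points and composition with involutions\<close>

text \<open>Order at least \<open>n\<close>, expressed by existence of a limit of the function
  divided by the n-th power of the coordinate. Limits multiply, so such lower bounds add up for
  products, and the value of the function at \<open>p\<close> itself is irrelevant.\<close>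

definition ord_ge :: "('a \<Rightarrow> complex) \<Rightarrow> 'a \<Rightarrow> int \<Rightarrow> bool" where
  "ord_ge \<phi> p n \<longleftrightarrow> (\<forall>c\<in>\<A>. p \<in> fst c \<longrightarrow>
     (\<exists>L. ((\<lambda>q. (snd c q - snd c p) powi (- n) * \<phi> q) \<longlongrightarrow> L) (at p)))"

lemma holomorphic_fun_onD:
  "holomorphic_fun_on \<A> \<phi> D \<Longrightarrow> c \<in> \<A> \<Longrightarrow> (\<phi> \<circ> chart_inv c) holomorphic_on snd c ` (fst c \<inter> D)"
  unfolding holomorphic_fun_on_def by (rule bspec)

lemma holomorphic_fun_on_has_derivative:
  assumes \<phi>: "holomorphic_fun_on \<A> \<phi> D" and D: "open D" "p \<in> D" and c: "c \<in> \<A>" "p \<in> fst c"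
  shows "((\<phi> \<circ> chart_inv c) has_field_derivative deriv (\<phi> \<circ> chart_inv c) (snd c p)) (at (snd c p))"
proof -
  have "open (snd c ` (fst c \<inter> D))"
    by (rule open_chart_image[OF c(1)]) (use open_chart[OF c(1)] D in auto)
  then show ?thesis
    using holomorphic_derivI[OF holomorphic_fun_onD[OF \<phi> c(1)]] c D by blast
qed

lemma holomorphic_fun_on_tendsto:
  assumes \<phi>: "holomorphic_fun_on \<A> \<phi> D" and D: "open D" "p \<in> D"
  shows "(\<phi> \<longlongrightarrow> \<phi> p) (at p)"
proof -
  obtain c where c: "c \<in> \<A>" "p \<in> fst c" using chart_exists by blast
  have "isCont (\<phi> \<circ> chart_inv c) (snd c p)"
    using holomorphic_fun_on_has_derivative[OF \<phi> D c] DERIV_isCont by blast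
  then have "((\<phi> \<circ> chart_inv c) \<longlongrightarrow> \<phi> p) (at (snd c p))"
    using c by (simp add: isCont_def)
  then show ?thesis
    by (rule tendsto_chart[OF c(1) open_chart[OF c(1)] c(2) subset_refl]) (use c in auto)
qed

lemma ord_ge_0_holomorphic:
  assumes "holomorphic_fun_on \<A> \<phi> D" "open D" "p \<in> D"
  shows "ord_ge \<phi> p 0"
  unfolding ord_ge_def using holomorphic_fun_on_tendsto[OF assms] by auto

lemma ord_ge_1_holomorphic:
  assumes \<phi>: "holomorphic_fun_on \<A> \<phi> D" and D: "open D" "p \<in> D" and 0: "\<phi> p = 0"
  shows "ord_ge \<phi> p 1"
  unfolding ord_ge_def
proof (intro ballI impI)
  fix c assume c: "c \<in> \<A>" "p \<in> fst c"
  have "((\<lambda>w. ((\<phi> \<circ> chart_inv c) w - (\<phi> \<circ> chart_inv c) (snd c p)) / (w - snd c p))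
      \<longlongrightarrow> deriv (\<phi> \<circ> chart_inv c) (snd c p)) (at (snd c p))"
    using holomorphic_fun_on_has_derivative[OF \<phi> D c] by (simp add: has_field_derivative_iff)
  then have "((\<lambda>q. (snd c q - snd c p) powi (- 1) * \<phi> q) \<longlongrightarrow> deriv (\<phi> \<circ> chart_inv c) (snd c p)) (at p)"
    by (rule tendsto_chart[OF c(1) open_chart[OF c(1)] c(2) subset_refl])
       (use c 0 in \<open>auto simp: power_int_minus divide_inverse\<close>)
  then show "\<exists>L. ((\<lambda>q. (snd c q - snd c p) powi (- 1) * \<phi> q) \<longlongrightarrow> L) (at p)" by blast
qed

lemma ord_ge_simple_pole:
  assumes "\<And>c. c \<in> \<A> \<Longrightarrow> p \<in> fst c \<Longrightarrow>
    \<exists>r g. r > 0 \<and> g holomorphic_on ball (snd c p) r \<and>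
      (\<forall>w\<in>ball (snd c p) r - {snd c p}. g w = (w - snd c p) * \<phi> (chart_inv c w))"
  shows "ord_ge \<phi> p (- 1)"
  unfolding ord_ge_def
proof (intro ballI impI)
  fix c assume c: "c \<in> \<A>" "p \<in> fst c"
  then obtain r g where r: "r > 0" "g holomorphic_on ball (snd c p) r"
    and g: "\<And>w. w \<in> ball (snd c p) r - {snd c p} \<Longrightarrow> g w = (w - snd c p) * \<phi> (chart_inv c w)"
    using assms by blast
  define D where "D = fst c \<inter> snd c -` ball (snd c p) r"
  have D: "open D" "p \<in> D" "D \<subseteq> fst c"
    unfolding D_def using continuous_open_preimage[OF continuous_on_chart[OF c(1) subset_refl] open_chart[OF c(1)] open_ball] c r
    by auto
  have "continuous_on (ball (snd c p) r) g" using r(2) holomorphic_on_imp_continuous_on by blast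
  then have "isCont g (snd c p)" using r(1) by (simp add: continuous_on_eq_continuous_at)
  then have "(g \<longlongrightarrow> g (snd c p)) (at (snd c p))" by (simp add: isCont_def)
  then have "((\<lambda>q. (snd c q - snd c p) powi (- (- 1)) * \<phi> q) \<longlongrightarrow> g (snd c p)) (at p)"
  proof (rule tendsto_chart[OF c(1) D])
    fix q assume "q \<in> D" "q \<noteq> p"
    then have "snd c q \<in> ball (snd c p) r - {snd c p}" "q \<in> fst c"
      using c by (auto simp: D_def chart_eq_iff)
    then show "(snd c q - snd c p) powi (- (- 1)) * \<phi> q = g (snd c q)"
      using g[of "snd c q"] c by simp
  qed
  then show "\<exists>L. ((\<lambda>q. (snd c q - snd c p) powi (- (- 1)) * \<phi> q) \<longlongrightarrow> L) (at p)" by blast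
qed

text \<open>The derivative of an injective holomorphic function does not vanish.\<close>

lemma local_coordinate_ratio:
  assumes c: "c \<in> \<A>" and D: "open D" "p \<in> D" "D \<subseteq> fst c"
    and f: "(f \<circ> chart_inv c) holomorphic_on snd c ` D" and inj: "inj_on f D"
  obtains k where "k \<noteq> 0" "((\<lambda>q. (snd c q - snd c p) / (f q - f p)) \<longlongrightarrow> k) (at p)"
proof -
  let ?h = "f \<circ> chart_inv c"
  have o: "open (snd c ` D)" by (rule open_chart_image[OF c D(1,3)])
  have p: "snd c p \<in> snd c ` D" using D(2) by blast
  have "inj_on ?h (snd c ` D)"
  proof (rule inj_onI)
    fix v w assume "v \<in> snd c ` D" "w \<in> snd c ` D" and eq: "?h v = ?h w"
    then obtain q q' where q: "q \<in> D" "v = snd c q" "q' \<in> D" "w = snd c q'" by blast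
    then have "q \<in> fst c" "q' \<in> fst c" using D(3) by auto
    then have "f q = f q'" using eq q c by simp
    then show "v = w" using inj q by (auto dest: inj_onD)
  qed
  then have nz: "deriv ?h (snd c p) \<noteq> 0"
    using holomorphic_injective_imp_regular[OF f o] p by blast
  have pc: "p \<in> fst c" using D by blast
  have "(?h has_field_derivative deriv ?h (snd c p)) (at (snd c p))"
    using holomorphic_derivI[OF f o p] .
  then have "((\<lambda>w. (?h w - ?h (snd c p)) / (w - snd c p)) \<longlongrightarrow> deriv ?h (snd c p)) (at (snd c p))"
    by (simp add: has_field_derivative_iff)
  from tendsto_inverse[OF this nz]
  have "((\<lambda>w. inverse ((?h w - ?h (snd c p)) / (w - snd c p))) \<longlongrightarrow> inverse (deriv ?h (snd c p))) (at (snd c p))" .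
  then have "((\<lambda>q. (snd c q - snd c p) / (f q - f p)) \<longlongrightarrow> inverse (deriv ?h (snd c p))) (at p)"
  proof (rule tendsto_chart[OF c D])
    fix q assume "q \<in> D" "q \<noteq> p"
    then have "q \<in> fst c" using D(3) by blast
    then show "(snd c q - snd c p) / (f q - f p) =
        inverse ((?h (snd c q) - ?h (snd c p)) / (snd c q - snd c p))"
      using c pc by simp
  qed
  then show thesis by (rule that[rotated]) (simp add: nz)
qed

lemma involution_apply: "involution F \<Longrightarrow> F (F q) = q"
  unfolding involution_def by (metis comp_apply id_apply)

lemma involution_inj: "involution F \<Longrightarrow> F p = F q \<longleftrightarrow> p = q"
  using involution_apply by metis

lemma involution_filterlim:
  assumes "continuous_on UNIV F" "involution F"
  shows "filterlim F (at (F p)) (at p)"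
proof -
  have "(F \<longlongrightarrow> F p) (at p)" using assms(1) by (simp add: continuous_on_def)
  moreover have "\<forall>\<^sub>F q in at p. F q \<noteq> F p"
    using assms(2) by (simp add: involution_inj eventually_at_filter)
  ultimately show ?thesis by (simp add: filterlim_at)
qed

lemma open_holomorphic_domain:
  assumes "continuous_on UNIV F" "c \<in> \<A>" "d \<in> \<A>"
  shows "open (fst c \<inter> F -` fst d)" "open (snd c ` (fst c \<inter> F -` fst d))"
proof -
  show "open (fst c \<inter> F -` fst d)"
    using open_chart[OF assms(2)] open_vimage[OF open_chart[OF assms(3)] assms(1)] by blast
  then show "open (snd c ` (fst c \<inter> F -` fst d))"
    by (rule open_chart_image[OF assms(2)]) auto
qed

text \<open>An involution is injective, so read in charts it has nonvanishing derivative. The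
  quotient of the coordinates at \<open>p\<close> and at \<open>\<sigma> p\<close> then has a
  nonzero limit, and its power can be traded for the change of coordinate.\<close>

lemma ord_ge_holomorphic_involution:
  assumes \<sigma>: "holomorphic_map \<A> \<sigma>" "involution \<sigma>" and \<phi>: "ord_ge \<phi> (\<sigma> p) n"
  shows "ord_ge (\<phi> \<circ> \<sigma>) p n"
  unfolding ord_ge_def
proof (intro ballI impI)
  fix c assume c: "c \<in> \<A>" "p \<in> fst c"
  obtain d where d: "d \<in> \<A>" "\<sigma> p \<in> fst d" using chart_exists by blast
  have cont: "continuous_on UNIV \<sigma>" using \<sigma>(1) by (simp add: holomorphic_map_def)
  let ?D = "fst c \<inter> \<sigma> -` fst d"
  have D: "open ?D" "p \<in> ?D" "?D \<subseteq> fst c"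
    using open_holomorphic_domain(1)[OF cont c(1) d(1)] c d by auto
  have hol: "((snd d \<circ> \<sigma>) \<circ> chart_inv c) holomorphic_on snd c ` ?D"
    using \<sigma>(1) c(1) d(1) unfolding holomorphic_map_def by blast
  have inj: "inj_on (snd d \<circ> \<sigma>) ?D"
    using \<sigma>(2) d(1) by (auto simp: inj_on_def chart_eq_iff involution_inj)
  obtain k where k: "k \<noteq> 0" "((\<lambda>q. (snd c q - snd c p) / ((snd d \<circ> \<sigma>) q - (snd d \<circ> \<sigma>) p)) \<longlongrightarrow> k) (at p)"
    by (rule local_coordinate_ratio[OF c(1) D hol inj])
  obtain L where L: "((\<lambda>q. (snd d q - snd d (\<sigma> p)) powi (- n) * \<phi> q) \<longlongrightarrow> L) (at (\<sigma> p))"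
    using \<phi> d unfolding ord_ge_def by blast
  have L': "((\<lambda>q. (snd d (\<sigma> q) - snd d (\<sigma> p)) powi (- n) * \<phi> (\<sigma> q)) \<longlongrightarrow> L) (at p)"
    by (rule filterlim_compose[OF L involution_filterlim[OF cont \<sigma>(2)]])
  have "((\<lambda>q. ((snd c q - snd c p) / ((snd d \<circ> \<sigma>) q - (snd d \<circ> \<sigma>) p)) powi (- n) *
      ((snd d (\<sigma> q) - snd d (\<sigma> p)) powi (- n) * \<phi> (\<sigma> q))) \<longlongrightarrow> k powi (- n) * L) (at p)"
    by (intro tendsto_mult L' tendsto_power_int k)
  moreover have "\<forall>\<^sub>F q in at p. ((snd c q - snd c p) / ((snd d \<circ> \<sigma>) q - (snd d \<circ> \<sigma>) p)) powi (- n) *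
      ((snd d (\<sigma> q) - snd d (\<sigma> p)) powi (- n) * \<phi> (\<sigma> q)) = (snd c q - snd c p) powi (- n) * (\<phi> \<circ> \<sigma>) q"
  proof -
    have "\<forall>\<^sub>F q in at p. q \<in> ?D - {p}" using D(1,2) by (intro eventually_at_in_open)
    then show ?thesis
    proof (rule eventually_mono)
      fix q assume q: "q \<in> ?D - {p}"
      then have "snd d (\<sigma> q) \<noteq> snd d (\<sigma> p)"
        using d \<sigma>(2) by (auto simp: chart_eq_iff involution_inj)
      then have "snd d (\<sigma> q) - snd d (\<sigma> p) \<noteq> 0" by simp
      from power_int_ratio[OF this, of "snd c q - snd c p" "- n"]
      show "((snd c q - snd c p) / ((snd d \<circ> \<sigma>) q - (snd d \<circ> \<sigma>) p)) powi (- n) *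
        ((snd d (\<sigma> q) - snd d (\<sigma> p)) powi (- n) * \<phi> (\<sigma> q)) = (snd c q - snd c p) powi (- n) * (\<phi> \<circ> \<sigma>) q"
        by (simp add: mult.assoc)
    qed
  qed
  ultimately show "\<exists>L. ((\<lambda>q. (snd c q - snd c p) powi (- n) * (\<phi> \<circ> \<sigma>) q) \<longlongrightarrow> L) (at p)"
    by (intro exI) (rule Lim_transform_eventually)
qed

lemma holomorphic_fun_on_subset: "holomorphic_fun_on \<A> \<phi> D \<Longrightarrow> D' \<subseteq> D \<Longrightarrow> holomorphic_fun_on \<A> \<phi> D'"
  unfolding holomorphic_fun_on_def
proof
  fix c assume "\<forall>c\<in>\<A>. (\<phi> \<circ> chart_inv c) holomorphic_on snd c ` (fst c \<inter> D)" "D' \<subseteq> D" "c \<in> \<A>"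
  then have "(\<phi> \<circ> chart_inv c) holomorphic_on snd c ` (fst c \<inter> D)" by blast
  then show "(\<phi> \<circ> chart_inv c) holomorphic_on snd c ` (fst c \<inter> D')"
    by (rule holomorphic_on_subset) (use \<open>D' \<subseteq> D\<close> in blast)
qed

lemma holomorphic_fun_on_compose:
  assumes F: "holomorphic_map \<A> F" and \<phi>: "holomorphic_fun_on \<A> \<phi> D" and D: "open D"
  shows "holomorphic_fun_on \<A> (\<phi> \<circ> F) (F -` D)"
  unfolding holomorphic_fun_on_def
proof (intro ballI holomorphic_on_locally)
  fix c w assume c: "c \<in> \<A>" and "w \<in> snd c ` (fst c \<inter> F -` D)"
  then obtain q where q: "q \<in> fst c" "F q \<in> D" "w = snd c q" by blast
  obtain d where d: "d \<in> \<A>" "F q \<in> fst d" using chart_exists by blast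
  have cont: "continuous_on UNIV F" using F by (simp add: holomorphic_map_def)
  let ?V = "fst c \<inter> F -` (fst d \<inter> D)"
  have oV: "open ?V"
    using open_chart[OF c] open_vimage[OF open_Int[OF open_chart[OF d(1)] D] cont] by blast
  then have o: "open (snd c ` ?V)" by (rule open_chart_image[OF c]) auto
  have "(snd d \<circ> F \<circ> chart_inv c) holomorphic_on snd c ` (fst c \<inter> F -` fst d)"
    using F c d unfolding holomorphic_map_def by blast
  then have h1: "(snd d \<circ> F \<circ> chart_inv c) holomorphic_on snd c ` ?V"
    by (rule holomorphic_on_subset) auto
  have im: "(snd d \<circ> F \<circ> chart_inv c) ` (snd c ` ?V) \<subseteq> snd d ` (fst d \<inter> D)"
    using c by auto
  have "((\<phi> \<circ> chart_inv d) \<circ> (snd d \<circ> F \<circ> chart_inv c)) holomorphic_on snd c ` ?V"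
    by (rule holomorphic_on_compose_gen[OF h1 holomorphic_fun_onD[OF \<phi> d(1)] im])
  then have "(\<phi> \<circ> F \<circ> chart_inv c) holomorphic_on snd c ` ?V"
    by (rule holomorphic_transform) (use c d in auto)
  moreover have "w \<in> snd c ` ?V" using q d by blast
  ultimately show "\<exists>T. open T \<and> w \<in> T \<and> (\<phi> \<circ> F \<circ> chart_inv c) holomorphic_on T"
    using o by blast
qed

text \<open>A conjugation is inserted in the middle: in charts the function is the composite of
  \<open>cnj \<circ> snd d \<circ> F \<circ> chart_inv c\<close>, holomorphic by assumption, with
  \<open>cnj \<circ> (\<phi> \<circ> chart_inv d) \<circ> cnj\<close>, holomorphic by
  reflection.\<close>

lemma holomorphic_fun_on_cnj_antiholomorphic:
  assumes F: "antiholomorphic_map \<A> F" and \<phi>: "holomorphic_fun_on \<A> \<phi> D" and D: "open D"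
  shows "holomorphic_fun_on \<A> (cnj \<circ> \<phi> \<circ> F) (F -` D)"
  unfolding holomorphic_fun_on_def
proof (intro ballI holomorphic_on_locally)
  fix c w assume c: "c \<in> \<A>" and "w \<in> snd c ` (fst c \<inter> F -` D)"
  then obtain q where q: "q \<in> fst c" "F q \<in> D" "w = snd c q" by blast
  obtain d where d: "d \<in> \<A>" "F q \<in> fst d" using chart_exists by blast
  have cont: "continuous_on UNIV F" using F by (simp add: antiholomorphic_map_def)
  let ?V = "fst c \<inter> F -` (fst d \<inter> D)"
  have oV: "open ?V"
    using open_chart[OF c] open_vimage[OF open_Int[OF open_chart[OF d(1)] D] cont] by blast
  then have o: "open (snd c ` ?V)" by (rule open_chart_image[OF c]) auto
  have od: "open (snd d ` (fst d \<inter> D))"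
    by (rule open_chart_image[OF d(1)]) (use open_chart[OF d(1)] D in auto)
  have "(cnj \<circ> snd d \<circ> F \<circ> chart_inv c) holomorphic_on snd c ` (fst c \<inter> F -` fst d)"
    using F c d unfolding antiholomorphic_map_def by blast
  then have h1: "(cnj \<circ> snd d \<circ> F \<circ> chart_inv c) holomorphic_on snd c ` ?V"
    by (rule holomorphic_on_subset) auto
  have im: "(cnj \<circ> snd d \<circ> F \<circ> chart_inv c) ` (snd c ` ?V) \<subseteq> cnj ` (snd d ` (fst d \<inter> D))"
    using c by auto
  have "(cnj \<circ> (\<phi> \<circ> chart_inv d) \<circ> cnj) holomorphic_on cnj ` (snd d ` (fst d \<inter> D))"
  proof (rule holomorphic_on_compose_cnj_cnj)
    show "(\<phi> \<circ> chart_inv d) holomorphic_on cnj ` cnj ` snd d ` (fst d \<inter> D)"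
      using holomorphic_fun_onD[OF \<phi> d(1)] by (simp add: image_image)
    have "cnj ` snd d ` (fst d \<inter> D) = cnj -` (snd d ` (fst d \<inter> D))"
      by (rule cnj_image_eq_vimage)
    then show "open (cnj ` snd d ` (fst d \<inter> D))"
      using open_vimage[OF od continuous_on_cnj[OF continuous_on_id]] by simp
  qed
  from holomorphic_on_compose_gen[OF h1 this im]
  have "(cnj \<circ> \<phi> \<circ> F \<circ> chart_inv c) holomorphic_on snd c ` ?V"
    by (rule holomorphic_transform) (use c d in auto)
  moreover have "w \<in> snd c ` ?V" using q d by blast
  ultimately show "\<exists>T. open T \<and> w \<in> T \<and> (cnj \<circ> \<phi> \<circ> F \<circ> chart_inv c) holomorphic_on T"
    using o by blast
qed

end

section \<open>Bilinear residue identities for Baker--Akhiezer functions\<close>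

text \<open>\<open>G\<close> and \<open>Z\<close> stand for the set of the \<gamma>_s and the set of
  the r_s. The divisor of \<Omega> is recorded pointwise: since \<sigma> is an involution, the
  multiplicity of \<sigma>D at \<open>p\<close> is 1 exactly if \<open>\<sigma> p \<in> G\<close>. A
  point may satisfy both \<open>p \<in> G\<close> and \<open>\<sigma> p \<in> G\<close>, so the
  indicators are added.\<close>

locale spectral_data = riemann_surface_atlas \<A> for \<A> :: "'a::t2_space chart set" +
  fixes P :: "'n::finite \<Rightarrow> 'a" and W :: "'n \<Rightarrow> 'a set" and z :: "'n \<Rightarrow> 'a \<Rightarrow> complex"
    and G Z :: "'a set" and r :: 'a and Q :: "'m::finite \<Rightarrow> 'a"
    and \<sigma> :: "'a \<Rightarrow> 'a" and \<Omega> :: "'a form"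
  assumes compact_surface: "compact (UNIV :: 'a set)"
    and params: "\<And>i. local_parameter_at \<A> (W i) (z i) (P i)"
    and finite_GZ: "finite G" "finite Z"
    and inj_PQ: "inj P" "inj Q"
    and disjoint: "range P \<inter> (G \<union> insert r Z \<union> range Q) = {}" "G \<inter> (insert r Z \<union> range Q) = {}"
      "r \<notin> Z" "insert r Z \<inter> range Q = {}"
    and \<sigma>: "holomorphic_map \<A> \<sigma>" "involution \<sigma>"
    and \<sigma>_fixes: "\<And>m. \<sigma> (Q m) = Q m" "\<And>i. \<sigma> (P i) = P i" "\<sigma> r = r"
    and \<sigma>_params: "\<And>i. \<forall>\<^sub>F S in nhds (P i). z i (\<sigma> S) = - z i S"
    and \<Omega>: "meromorphic_form \<A> \<Omega>"
    and \<Omega>_order: "\<And>c p. c \<in> \<A> \<Longrightarrow> p \<in> fst c \<Longrightarrow> (\<exists>\<^sub>F w in at (snd c p). \<Omega> c w \<noteq> 0) \<and>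
      zorder (\<Omega> c) (snd c p) = of_bool (p \<in> G) + of_bool (\<sigma> p \<in> G) + of_bool (p \<in> range P)
        - of_bool (p \<in> range Q) - of_bool (p = r) - of_bool (p \<in> Z) - of_bool (\<sigma> p \<in> Z)"
begin

definition E :: "'a set" where "E = range P \<union> G"

lemma open_minus_E: "open (- E)"
  unfolding E_def using finite_GZ by (intro open_Compl finite_imp_closed) auto

lemma chart_P: "(W i, z i) \<in> \<A>" "P i \<in> W i" "z i (P i) = 0"
  using params[of i] by (auto simp: local_parameter_at_def)

section \<open>Local behaviour of the 1-form\<close>

lemma meromorphic_\<Omega>:
  assumes "c \<in> \<A>" "p \<in> fst c"
  shows "\<Omega> c meromorphic_on {snd c p}"
proof -
  have "\<Omega> c nicely_meromorphic_on snd c ` fst c" using \<Omega> assms(1) by (simp add: meromorphic_form_def)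
  then have "\<Omega> c meromorphic_on snd c ` fst c" by (simp add: nicely_meromorphic_on_def)
  then show ?thesis by (rule meromorphic_on_subset) (use assms in auto)
qed

text \<open>Nonnegative order excludes a pole, and the normalisation of coefficients at removable
  singularities does the rest.\<close>

lemma analytic_\<Omega>:
  assumes c: "c \<in> \<A>" "p \<in> fst c" and n: "zorder (\<Omega> c) (snd c p) \<ge> 0"
  shows "\<Omega> c analytic_on {snd c p}"
proof (rule nicely_meromorphic_on_imp_analytic_at)
  show "\<Omega> c nicely_meromorphic_on snd c ` fst c" using \<Omega> c(1) by (simp add: meromorphic_form_def)
  show "\<not> is_pole (\<Omega> c) (snd c p)"
    using isolated_pole_imp_neg_zorder[OF meromorphic_on_isolated_singularity[OF meromorphic_\<Omega>[OF c]]] n by linarith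
qed (use c in auto)

lemma \<Omega>_local:
  assumes c: "c \<in> \<A>" "p \<in> fst c"
  obtains k where "k \<noteq> 0" "((\<lambda>w. (w - snd c p) powi (- zorder (\<Omega> c) (snd c p)) * \<Omega> c w) \<longlongrightarrow> k) (at (snd c p))"
proof -
  let ?a = "snd c p" and ?n = "zorder (\<Omega> c) (snd c p)" and ?g = "zor_poly (\<Omega> c) (snd c p)"
  have fr: "\<exists>\<^sub>F w in at ?a. \<Omega> c w \<noteq> 0" using \<Omega>_order[OF c] by simp
  note m = meromorphic_\<Omega>[OF c]
  have "?g ?a \<noteq> 0 \<and> (\<exists>r. r > 0 \<and> ?g holomorphic_on cball ?a r \<and>
      (\<forall>w\<in>cball ?a r - {?a}. \<Omega> c w = ?g w * (w - ?a) powi ?n \<and> ?g w \<noteq> 0))"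
    by (rule zorder_exist[OF meromorphic_on_isolated_singularity[OF m] meromorphic_on_not_essential[OF m] fr])
  then obtain \<rho> where g: "?g ?a \<noteq> 0" and \<rho>: "\<rho> > 0" "?g holomorphic_on cball ?a \<rho>"
    and eq: "\<And>w. w \<in> cball ?a \<rho> - {?a} \<Longrightarrow> \<Omega> c w = ?g w * (w - ?a) powi ?n" by blast
  have "continuous_on (ball ?a \<rho>) ?g"
    using holomorphic_on_imp_continuous_on[OF \<rho>(2)] continuous_on_subset ball_subset_cball by blast
  then have "isCont ?g ?a" using \<rho>(1) by (simp add: continuous_on_eq_continuous_at)
  then have "(?g \<longlongrightarrow> ?g ?a) (at ?a)" by (simp add: isCont_def)
  moreover have "\<forall>\<^sub>F w in at ?a. ?g w = (w - ?a) powi (- ?n) * \<Omega> c w"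
  proof -
    have "\<forall>\<^sub>F w in at ?a. w \<in> ball ?a \<rho> - {?a}" using \<rho>(1) by (intro eventually_at_in_open) auto
    then show ?thesis
    proof (rule eventually_mono)
      fix w assume w: "w \<in> ball ?a \<rho> - {?a}"
      then have "(w - ?a) powi (- ?n) * (w - ?a) powi ?n = 1"
        by (simp add: power_int_minus)
      moreover have "\<Omega> c w = ?g w * (w - ?a) powi ?n" using w by (intro eq) auto
      ultimately show "?g w = (w - ?a) powi (- ?n) * \<Omega> c w" by simp
    qed
  qed
  ultimately have "((\<lambda>w. (w - ?a) powi (- ?n) * \<Omega> c w) \<longlongrightarrow> ?g ?a) (at ?a)"
    by (rule Lim_transform_eventually)
  then show thesis using that g by blast
qed

lemma ord_\<Omega>:
  assumes c: "c \<in> \<A>" "p \<in> fst c"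
  shows "\<exists>k. ((\<lambda>q. (snd c q - snd c p) powi (- zorder (\<Omega> c) (snd c p)) * \<Omega> c (snd c q)) \<longlongrightarrow> k) (at p)"
proof -
  obtain k where "((\<lambda>w. (w - snd c p) powi (- zorder (\<Omega> c) (snd c p)) * \<Omega> c w) \<longlongrightarrow> k) (at (snd c p))"
    using \<Omega>_local[OF c] by blast
  from filterlim_compose[OF this filterlim_chart[OF c]] show ?thesis by (intro exI)
qed

lemma residue_limit:
  assumes c: "c \<in> \<A>" "p \<in> fst c" and n: "zorder (\<Omega> c) (snd c p) = - 1"
  shows "((\<lambda>q. (snd c q - snd c p) * \<Omega> c (snd c q)) \<longlongrightarrow> residue (\<Omega> c) (snd c p)) (at p)"
proof -
  let ?a = "snd c p"
  obtain k where k: "((\<lambda>w. (w - ?a) * \<Omega> c w) \<longlongrightarrow> k) (at ?a)"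
    using \<Omega>_local[OF c] n by auto
  obtain \<rho> where \<rho>: "\<rho> > 0" "\<Omega> c analytic_on ball ?a \<rho> - {?a}"
    using meromorphic_on_isolated_singularity[OF meromorphic_\<Omega>[OF c]] unfolding isolated_singularity_at_def by blast
  have "residue (\<Omega> c) ?a = k"
    by (rule residue_simple'[OF open_ball, of ?a ?a \<rho>])
       (use \<rho> k analytic_imp_holomorphic in \<open>auto simp: mult.commute\<close>)
  then show ?thesis using filterlim_compose[OF k filterlim_chart[OF c]] by simp
qed

text \<open>These points are fixed by \<sigma>, so the conditions on \<open>\<sigma> p\<close>
  reduce to conditions on \<open>p\<close>, which fail by disjointness; a single indicator
  survives.\<close>

lemma zorder_P: "zorder (\<Omega> (W i, z i)) 0 = 1"
  and zorder_Q: "c \<in> \<A> \<Longrightarrow> Q m \<in> fst c \<Longrightarrow> zorder (\<Omega> c) (snd c (Q m)) = - 1"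
  and zorder_r: "c \<in> \<A> \<Longrightarrow> r \<in> fst c \<Longrightarrow> zorder (\<Omega> c) (snd c r) = - 1"
proof -
  have "P i \<notin> G" "P i \<notin> Z" "P i \<noteq> r" "P i \<notin> range Q" using disjoint(1) by blast+
  then show "zorder (\<Omega> (W i, z i)) 0 = 1"
    using \<Omega>_order[OF chart_P(1), of "P i" i] chart_P[of i] by (simp add: \<sigma>_fixes)
  have "Q m \<notin> G" "Q m \<notin> Z" "Q m \<noteq> r" "Q m \<notin> range P" using disjoint by blast+
  then show "c \<in> \<A> \<Longrightarrow> Q m \<in> fst c \<Longrightarrow> zorder (\<Omega> c) (snd c (Q m)) = - 1"
    using \<Omega>_order[of c "Q m"] by (simp add: \<sigma>_fixes)
  have "r \<notin> G" "r \<notin> Z" "r \<notin> range P" "r \<notin> range Q" using disjoint by blast+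
  then show "c \<in> \<A> \<Longrightarrow> r \<in> fst c \<Longrightarrow> zorder (\<Omega> c) (snd c r) = - 1"
    using \<Omega>_order[of c r] by (simp add: \<sigma>_fixes)
qed

text \<open>The form is C_i z dz to leading order in the local parameter z = 1/k_i, so the constant
  C_i is the derivative of its coefficient at 0. It is nonzero because the zero of \<Omega> is
  simple, which later makes the metric nondegenerate wherever f_i does not vanish.\<close>

lemma \<Omega>_P: "((\<lambda>S. \<Omega> (W i, z i) (z i S) / z i S) \<longlongrightarrow> deriv (\<Omega> (W i, z i)) 0) (at (P i))"
  and deriv_\<Omega>_P: "deriv (\<Omega> (W i, z i)) 0 \<noteq> 0"
proof -
  let ?c = "(W i, z i)"
  have c: "?c \<in> \<A>" "P i \<in> fst ?c" "snd ?c (P i) = 0" using chart_P[of i] by auto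
  have an: "\<Omega> ?c analytic_on {0}" using analytic_\<Omega>[OF c(1,2)] zorder_P[of i] c(3) by simp
  obtain k where k: "k \<noteq> 0" "((\<lambda>w. w powi (- 1) * \<Omega> ?c w) \<longlongrightarrow> k) (at 0)"
    using \<Omega>_local[OF c(1,2)] zorder_P[of i] c(3) by auto
  have "isCont (\<Omega> ?c) 0" using an analytic_at_imp_isCont by blast
  then have 1: "(\<Omega> ?c \<longlongrightarrow> \<Omega> ?c 0) (at 0)" by (simp add: isCont_def)
  have "((\<lambda>w::complex. w) \<longlongrightarrow> 0) (at 0)" by (rule tendsto_ident_at)
  from tendsto_mult[OF this k(2)]
  have "((\<lambda>w. w * (w powi (- 1) * \<Omega> ?c w)) \<longlongrightarrow> 0) (at 0)" by simp
  moreover have "\<forall>\<^sub>F w in at (0::complex). w * (w powi (- 1) * \<Omega> ?c w) = \<Omega> ?c w"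
    by (simp add: eventually_at_filter power_int_minus)
  ultimately have "(\<Omega> ?c \<longlongrightarrow> 0) (at 0)" by (rule Lim_transform_eventually)
  then have 0: "\<Omega> ?c 0 = 0" using LIM_unique[OF 1] by blast
  have "(\<Omega> ?c has_field_derivative deriv (\<Omega> ?c) 0) (at 0)"
    using an analytic_on_imp_differentiable_at DERIV_deriv_iff_field_differentiable by blast
  then have d: "((\<lambda>w. \<Omega> ?c w / w) \<longlongrightarrow> deriv (\<Omega> ?c) 0) (at 0)"
    using 0 by (simp add: has_field_derivative_iff)
  moreover have "((\<lambda>w. \<Omega> ?c w / w) \<longlongrightarrow> k) (at 0)"
    using k(2) by (simp add: power_int_minus divide_inverse mult.commute)
  ultimately show "deriv (\<Omega> ?c) 0 \<noteq> 0" using k(1) LIM_unique by blast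
  have "filterlim (z i) (at 0) (at (P i))" using filterlim_chart[OF c(1,2)] c(3) by simp
  from filterlim_compose[OF d this]
  show "((\<lambda>S. \<Omega> ?c (z i S) / z i S) \<longlongrightarrow> deriv (\<Omega> ?c) 0) (at (P i))" .
qed

text \<open>
  The common shape of \<open>\<psi> u\<close> and of its first derivatives in \<open>u\<close>: at \<open>P j\<close> the function is
  \<open>exp (k\<^sub>j u\<^sub>j)\<close> times something with a pole of order at most \<open>n j\<close> and leading coefficient \<open>lc j\<close>.
\<close>

definition ba_like :: "real^'n \<Rightarrow> ('a \<Rightarrow> complex) \<Rightarrow> ('n \<Rightarrow> nat) \<Rightarrow> ('n \<Rightarrow> complex) \<Rightarrow> bool" where
  "ba_like u \<phi> n lc \<longleftrightarrow> holomorphic_fun_on \<A> \<phi> (- E) \<and> (\<forall>p\<in>G. ord_ge \<phi> p (- 1)) \<and> (\<forall>p\<in>Z. \<phi> p = 0) \<and>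
     (\<forall>j. ((\<lambda>S. z j S ^ n j * (exp (- (of_real (u $ j) / z j S)) * \<phi> S)) \<longlongrightarrow> lc j) (at (P j)))"

text \<open>Away from the points \<open>P j\<close> only the prescribed zeros and poles matter; the
  bound is opposite to the contribution of \<open>p\<close> to the order of \<Omega>.\<close>

lemma ba_like_ord:
  assumes "ba_like u \<phi> n lc" "p \<notin> range P"
  shows "ord_ge \<phi> p (of_bool (p \<in> Z) - of_bool (p \<in> G))"
proof (cases "p \<in> G")
  case True
  then have "p \<notin> Z" using disjoint(2) by blast
  then show ?thesis using assms True by (simp add: ba_like_def)
next
  case False
  then have p: "p \<in> - E" using assms(2) by (simp add: E_def)
  have hol: "holomorphic_fun_on \<A> \<phi> (- E)" using assms by (simp add: ba_like_def)
  show ?thesis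
  proof (cases "p \<in> Z")
    case True
    then have "\<phi> p = 0" using assms(1) by (simp add: ba_like_def)
    then show ?thesis using ord_ge_1_holomorphic[OF hol open_minus_E p] True False by simp
  next
    case F: False
    then show ?thesis using ord_ge_0_holomorphic[OF hol open_minus_E p] False by simp
  qed
qed

lemma \<sigma>_P_iff: "\<sigma> p \<in> range P \<longleftrightarrow> p \<in> range P"
proof
  assume "\<sigma> p \<in> range P"
  then obtain i where "\<sigma> p = \<sigma> (P i)" using \<sigma>_fixes(2) by (metis imageE)
  then show "p \<in> range P" using involution_inj[OF \<sigma>(2)] by blast
qed (use \<sigma>_fixes(2) in auto)

lemma \<sigma>_continuous: "continuous_on UNIV \<sigma>"
  using \<sigma>(1) by (simp add: holomorphic_map_def)

section \<open>Residues of the product of two functions, one composed with the involution\<close>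

text \<open>In z = \<open>z j\<close> the leading terms are \<open>lc j\<close> / z^n,
  \<open>lc' j\<close> / (-z)^n' and C z, with the exponentials cancelled; the residue is the limit
  of z times their product, a multiple of z^(2 - n - n'). The power of 0 is 1 if the exponent is 0
  and 0 otherwise: for orders at most 1 there is a residue only if both are 1.\<close>

definition pairing_at_P ::
  "('n \<Rightarrow> nat) \<Rightarrow> ('n \<Rightarrow> complex) \<Rightarrow> ('n \<Rightarrow> nat) \<Rightarrow> ('n \<Rightarrow> complex) \<Rightarrow> 'n \<Rightarrow> complex" where
  "pairing_at_P n lc n' lc' j =
     0 ^ (2 - n j - n' j) * (lc j * ((- 1) ^ n' j * lc' j) * deriv (\<Omega> (W j, z j)) 0)"

lemma pairing_limit_P:
  assumes \<phi>: "ba_like u \<phi> n lc" "ba_like u \<phi>' n' lc'" and le: "n j \<le> 1" "n' j \<le> 1"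
  shows "((\<lambda>S. z j S * (\<phi> S * \<phi>' (\<sigma> S) * \<Omega> (W j, z j) (z j S))) \<longlongrightarrow> pairing_at_P n lc n' lc' j) (at (P j))"
proof -
  let ?e = "\<lambda>S. exp (- (of_real (u $ j) / z j S))"
  have c: "(W j, z j) \<in> \<A>" "P j \<in> fst (W j, z j)" using chart_P[of j] by auto
  have z0: "filterlim (z j) (at 0) (at (P j))" using filterlim_chart[OF c] chart_P(3)[of j] by simp
  have zlim: "(z j \<longlongrightarrow> 0) (at (P j))" and znz: "\<forall>\<^sub>F S in at (P j). z j S \<noteq> 0"
    using z0 by (auto simp: filterlim_at)
  have l1: "((\<lambda>S. z j S ^ n j * (?e S * \<phi> S)) \<longlongrightarrow> lc j) (at (P j))" using \<phi>(1) by (simp add: ba_like_def)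
  have l2: "((\<lambda>S. z j S ^ n' j * (?e S * \<phi>' S)) \<longlongrightarrow> lc' j) (at (P j))" using \<phi>(2) by (simp add: ba_like_def)
  have "filterlim \<sigma> (at (P j)) (at (P j))"
    using involution_filterlim[OF \<sigma>_continuous \<sigma>(2), of "P j"] by (simp add: \<sigma>_fixes)
  from filterlim_compose[OF l2 this]
  have l3: "((\<lambda>S. z j (\<sigma> S) ^ n' j * (?e (\<sigma> S) * \<phi>' (\<sigma> S))) \<longlongrightarrow> lc' j) (at (P j))" .
  have "((\<lambda>S. z j S ^ (2 - n j - n' j) * (z j S ^ n j * (?e S * \<phi> S) *
      ((- 1) ^ n' j * (z j (\<sigma> S) ^ n' j * (?e (\<sigma> S) * \<phi>' (\<sigma> S)))) * (\<Omega> (W j, z j) (z j S) / z j S)))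
      \<longlongrightarrow> pairing_at_P n lc n' lc' j) (at (P j))"
    unfolding pairing_at_P_def
    by (intro tendsto_mult tendsto_power zlim l1 l3 \<Omega>_P tendsto_const)
  moreover have "\<forall>\<^sub>F S in at (P j). z j S ^ (2 - n j - n' j) * (z j S ^ n j * (?e S * \<phi> S) *
      ((- 1) ^ n' j * (z j (\<sigma> S) ^ n' j * (?e (\<sigma> S) * \<phi>' (\<sigma> S)))) * (\<Omega> (W j, z j) (z j S) / z j S)) =
      z j S * (\<phi> S * \<phi>' (\<sigma> S) * \<Omega> (W j, z j) (z j S))"
  proof -
    have "\<forall>\<^sub>F S in at (P j). z j (\<sigma> S) = - z j S"
      using \<sigma>_params[of j] by (auto simp: eventually_at_filter elim: eventually_mono)
    with znz show ?thesis
    proof (rule eventually_elim2)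
      fix S assume nz: "z j S \<noteq> 0" and sg: "z j (\<sigma> S) = - z j S"
      let ?w = "z j S"
      \<comment> \<open>The essential singularities cancel: both functions belong to the same
        \<open>u\<close>, and the local parameter changes sign under \<sigma>.\<close>
      have ee: "?e S * ?e (\<sigma> S) = 1" unfolding sg by (simp add: exp_add[symmetric])
      have pm: "(- 1) ^ n' j * (- ?w) ^ n' j = ?w ^ n' j"
        by (simp add: power_mult_distrib[symmetric])
      \<comment> \<open>The bounds \<open>le\<close> make the truncated subtraction exact. One of
        the two factors \<open>?w\<close> then cancels the division of \<Omega> by its zero.\<close>
      have pp: "?w ^ (2 - n j - n' j) * (?w ^ n j * ?w ^ n' j) = ?w * ?w"
        using le by (simp add: power_add[symmetric] power2_eq_square[symmetric])
      have "?w ^ (2 - n j - n' j) * (?w ^ n j * (?e S * \<phi> S) *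
          ((- 1) ^ n' j * (z j (\<sigma> S) ^ n' j * (?e (\<sigma> S) * \<phi>' (\<sigma> S)))) * (\<Omega> (W j, z j) ?w / ?w)) =
          (?w ^ (2 - n j - n' j) * (?w ^ n j * ((- 1) ^ n' j * (- ?w) ^ n' j))) * (?e S * ?e (\<sigma> S)) *
            (\<phi> S * \<phi>' (\<sigma> S) * (\<Omega> (W j, z j) ?w / ?w))"
        unfolding sg by (simp only: mult_ac)
      also have "\<dots> = ?w * (\<phi> S * \<phi>' (\<sigma> S) * \<Omega> (W j, z j) ?w)"
        unfolding ee pm pp using nz by simp
      finally show "?w ^ (2 - n j - n' j) * (?w ^ n j * (?e S * \<phi> S) *
          ((- 1) ^ n' j * (z j (\<sigma> S) ^ n' j * (?e (\<sigma> S) * \<phi>' (\<sigma> S)))) * (\<Omega> (W j, z j) ?w / ?w)) =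
          ?w * (\<phi> S * \<phi>' (\<sigma> S) * \<Omega> (W j, z j) ?w)" .
    qed
  qed
  ultimately show ?thesis by (rule Lim_transform_eventually)
qed

lemma pairing_limit_residue:
  assumes \<phi>: "ba_like u \<phi> n lc" "ba_like u \<phi>' n' lc'" and p: "p \<in> range Q \<or> p = r"
  shows "\<exists>c\<in>\<A>. p \<in> fst c \<and> ((\<lambda>q. (snd c q - snd c p) * (\<phi> q * \<phi>' (\<sigma> q) * \<Omega> c (snd c q)))
     \<longlongrightarrow> form_residue \<A> \<Omega> p * \<phi> p * \<phi>' p) (at p)"
proof -
  \<comment> \<open>The same choice of chart as in \<open>form_residue\<close>, so that its value is
    literally the residue in this chart.\<close>
  define c where "c = (SOME c. c \<in> \<A> \<and> p \<in> fst c)"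
  have c: "c \<in> \<A>" "p \<in> fst c"
    using someI_ex[of "\<lambda>c. c \<in> \<A> \<and> p \<in> fst c"] chart_exists[of p] unfolding c_def by blast+
  have res: "form_residue \<A> \<Omega> p = residue (\<Omega> c) (snd c p)"
    by (simp add: form_residue_def Let_def c_def)
  have pE: "p \<in> - E" and \<sigma>p: "\<sigma> p = p" using p disjoint \<sigma>_fixes unfolding E_def by blast+
  have hol: "holomorphic_fun_on \<A> \<phi> (- E)" "holomorphic_fun_on \<A> \<phi>' (- E)"
    using \<phi> by (simp_all add: ba_like_def)
  have l1: "(\<phi> \<longlongrightarrow> \<phi> p) (at p)" by (rule holomorphic_fun_on_tendsto[OF hol(1) open_minus_E pE])
  have l2: "(\<phi>' \<longlongrightarrow> \<phi>' p) (at p)" by (rule holomorphic_fun_on_tendsto[OF hol(2) open_minus_E pE])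
  have "filterlim \<sigma> (at p) (at p)"
    using involution_filterlim[OF \<sigma>_continuous \<sigma>(2), of p] by (simp add: \<sigma>p)
  from filterlim_compose[OF l2 this] have l3: "((\<lambda>q. \<phi>' (\<sigma> q)) \<longlongrightarrow> \<phi>' p) (at p)" .
  have "zorder (\<Omega> c) (snd c p) = - 1" using p zorder_Q[OF c(1)] zorder_r[OF c(1)] c(2) by blast
  from tendsto_mult[OF tendsto_mult[OF residue_limit[OF c this] l1] l3]
  have "((\<lambda>q. (snd c q - snd c p) * (\<phi> q * \<phi>' (\<sigma> q) * \<Omega> c (snd c q)))
     \<longlongrightarrow> form_residue \<A> \<Omega> p * \<phi> p * \<phi>' p) (at p)"
    unfolding res by (simp add: mult_ac)
  then show ?thesis using c by blast
qed

text \<open>The lower bounds for the orders of the three factors add up to 0: zeros and poles of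
  \<Omega> compensate the poles in \<open>G\<close> and the zeros in \<open>Z\<close>, both at
  \<open>p\<close> and at \<open>\<sigma> p\<close>. The product is bounded near \<open>p\<close>,
  and the additional coordinate factor tends to 0.\<close>

lemma pairing_limit_regular:
  assumes \<phi>: "ba_like u \<phi> n lc" "ba_like u \<phi>' n' lc'" and p: "p \<notin> range P" "p \<notin> range Q" "p \<noteq> r"
  shows "\<exists>c\<in>\<A>. p \<in> fst c \<and> ((\<lambda>q. (snd c q - snd c p) * (\<phi> q * \<phi>' (\<sigma> q) * \<Omega> c (snd c q))) \<longlongrightarrow> 0) (at p)"
proof -
  obtain c where c: "c \<in> \<A>" "p \<in> fst c" using chart_exists by blast
  define e :: "'a \<Rightarrow> int" where "e x = of_bool (x \<in> Z) - of_bool (x \<in> G)" for x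
  have "ord_ge \<phi> p (e p)" unfolding e_def by (rule ba_like_ord[OF \<phi>(1) p(1)])
  then obtain L1 where L1: "((\<lambda>q. (snd c q - snd c p) powi (- e p) * \<phi> q) \<longlongrightarrow> L1) (at p)"
    using c unfolding ord_ge_def by blast
  have "ord_ge \<phi>' (\<sigma> p) (e (\<sigma> p))"
    unfolding e_def by (rule ba_like_ord[OF \<phi>(2)]) (use p(1) \<sigma>_P_iff in simp)
  then have "ord_ge (\<phi>' \<circ> \<sigma>) p (e (\<sigma> p))" by (rule ord_ge_holomorphic_involution[OF \<sigma>])
  then obtain L2 where L2: "((\<lambda>q. (snd c q - snd c p) powi (- e (\<sigma> p)) * (\<phi>' \<circ> \<sigma>) q) \<longlongrightarrow> L2) (at p)"
    using c unfolding ord_ge_def by blast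
  have n: "zorder (\<Omega> c) (snd c p) = - e p - e (\<sigma> p)"
    using \<Omega>_order[OF c] p by (simp add: e_def)
  have n': "- zorder (\<Omega> c) (snd c p) = e p + e (\<sigma> p)" using n by simp
  obtain L3 where L3: "((\<lambda>q. (snd c q - snd c p) powi (e p + e (\<sigma> p)) * \<Omega> c (snd c q)) \<longlongrightarrow> L3) (at p)"
    using ord_\<Omega>[OF c] unfolding n' by blast
  have "filterlim (snd c) (nhds (snd c p)) (at p)"
    using filterlim_chart[OF c] by (simp add: filterlim_at)
  from tendsto_diff[OF this tendsto_const[of "snd c p"]]
  have L0: "((\<lambda>q. snd c q - snd c p) \<longlongrightarrow> 0) (at p)" by simp
  from tendsto_mult[OF L0 tendsto_mult[OF tendsto_mult[OF L1 L2] L3]]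
  have "((\<lambda>q. (snd c q - snd c p) * ((snd c q - snd c p) powi (- e p) * \<phi> q *
      ((snd c q - snd c p) powi (- e (\<sigma> p)) * (\<phi>' \<circ> \<sigma>) q) *
      ((snd c q - snd c p) powi (e p + e (\<sigma> p)) * \<Omega> c (snd c q)))) \<longlongrightarrow> 0) (at p)" by simp
  moreover have "\<forall>\<^sub>F q in at p. (snd c q - snd c p) * ((snd c q - snd c p) powi (- e p) * \<phi> q *
      ((snd c q - snd c p) powi (- e (\<sigma> p)) * (\<phi>' \<circ> \<sigma>) q) *
      ((snd c q - snd c p) powi (e p + e (\<sigma> p)) * \<Omega> c (snd c q))) =
      (snd c q - snd c p) * (\<phi> q * \<phi>' (\<sigma> q) * \<Omega> c (snd c q))"
  proof -
    have "\<forall>\<^sub>F q in at p. snd c q \<noteq> snd c p" using filterlim_chart[OF c] by (simp add: filterlim_at)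
    then show ?thesis
    proof (rule eventually_mono)
      fix q assume "snd c q \<noteq> snd c p"
      then have x: "snd c q - snd c p \<noteq> 0" by simp
      let ?x = "snd c q - snd c p"
      have 1: "?x powi (- e p) * (?x powi (- e (\<sigma> p)) * ?x powi (e p + e (\<sigma> p))) = 1"
        using x by (simp add: power_int_add[symmetric] del: power_int_minus)
      have "?x * (?x powi (- e p) * \<phi> q * (?x powi (- e (\<sigma> p)) * (\<phi>' \<circ> \<sigma>) q) *
          (?x powi (e p + e (\<sigma> p)) * \<Omega> c (snd c q))) =
          (?x powi (- e p) * (?x powi (- e (\<sigma> p)) * ?x powi (e p + e (\<sigma> p)))) *
          (?x * (\<phi> q * \<phi>' (\<sigma> q) * \<Omega> c (snd c q)))"
        by (simp only: mult_ac o_apply)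
      then show "?x * (?x powi (- e p) * \<phi> q * (?x powi (- e (\<sigma> p)) * (\<phi>' \<circ> \<sigma>) q) *
          (?x powi (e p + e (\<sigma> p)) * \<Omega> c (snd c q))) = ?x * (\<phi> q * \<phi>' (\<sigma> q) * \<Omega> c (snd c q))"
        unfolding 1 by simp
    qed
  qed
  ultimately have "((\<lambda>q. (snd c q - snd c p) * (\<phi> q * \<phi>' (\<sigma> q) * \<Omega> c (snd c q))) \<longlongrightarrow> 0) (at p)"
    by (rule Lim_transform_eventually)
  then show ?thesis using c by blast
qed

text \<open>The residue theorem for \<phi>(S) \<phi>'(\<sigma> S) \<Omega> at a common
  \<open>u\<close>. Since \<sigma> fixes the \<open>Q m\<close> and \<open>r\<close>, both functions
  are evaluated at the same point there. The sphere equation and the metric are both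
  instances.\<close>

theorem pairing_sum_eq_0:
  assumes \<phi>: "ba_like u \<phi> n lc" "ba_like u \<phi>' n' lc'" and le: "\<And>j. n j \<le> 1" "\<And>j. n' j \<le> 1"
  shows "(\<Sum>m\<in>UNIV. form_residue \<A> \<Omega> (Q m) * \<phi> (Q m) * \<phi>' (Q m)) + form_residue \<A> \<Omega> r * \<phi> r * \<phi>' r +
    (\<Sum>j\<in>UNIV. pairing_at_P n lc n' lc' j) = 0"
proof -
  \<comment> \<open>All points where one of the three factors may be singular. Those outside
    \<open>range P\<close>, \<open>range Q\<close> and \<open>{r}\<close> carry residue 0.\<close>
  define S where "S = range P \<union> (range Q \<union> {r}) \<union> (G \<union> \<sigma> ` G \<union> Z \<union> \<sigma> ` Z)"
  define \<omega> where "\<omega> c w = (\<phi> \<circ> chart_inv c) w * ((\<phi>' \<circ> \<sigma>) \<circ> chart_inv c) w * \<Omega> c w" for c w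
  define R where "R p = (if p \<in> range P then pairing_at_P n lc n' lc' (inv_into UNIV P p)
     else if p \<in> range Q \<union> {r} then form_residue \<A> \<Omega> p * \<phi> p * \<phi>' p else 0)" for p
  have finS: "finite S" using finite_GZ by (simp add: S_def)
  have hol: "holomorphic_fun_on \<A> \<phi> (- S)" "holomorphic_fun_on \<A> (\<phi>' \<circ> \<sigma>) (- S)"
  proof -
    have h: "holomorphic_fun_on \<A> \<phi> (- E)" "holomorphic_fun_on \<A> \<phi>' (- E)"
      using \<phi> by (simp_all add: ba_like_def)
    show "holomorphic_fun_on \<A> \<phi> (- S)"
      by (rule holomorphic_fun_on_subset[OF h(1)]) (auto simp: S_def E_def)
    show "holomorphic_fun_on \<A> (\<phi>' \<circ> \<sigma>) (- S)"
    proof (rule holomorphic_fun_on_subset[OF holomorphic_fun_on_compose[OF \<sigma>(1) h(2) open_minus_E]])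
      show "- S \<subseteq> \<sigma> -` (- E)"
      proof
        fix p assume p: "p \<in> - S"
        have "\<sigma> p \<notin> range P" using p \<sigma>_P_iff by (simp add: S_def)
        moreover have "\<sigma> p \<notin> G"
        proof
          assume "\<sigma> p \<in> G"
          then have "\<sigma> (\<sigma> p) \<in> \<sigma> ` G" by (rule imageI)
          then show False using p by (simp add: S_def involution_apply[OF \<sigma>(2)])
        qed
        ultimately show "p \<in> \<sigma> -` (- E)" by (simp add: E_def)
      qed
    qed
  qed
  have \<omega>_chart: "\<omega> c (snd c q) = \<phi> q * \<phi>' (\<sigma> q) * \<Omega> c (snd c q)" if "c \<in> \<A>" "q \<in> fst c" for c q
    using that by (simp add: \<omega>_def)
  have "(\<Sum>p\<in>S. R p) = 0"
  proof (rule sum_residues_eq_0[OF compact_surface finS])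
    fix c assume c: "c \<in> \<A>"
    have "\<Omega> c holomorphic_on snd c ` (fst c - S)"
    proof (rule analytic_imp_holomorphic, subst analytic_on_analytic_at, rule ballI)
      fix w assume "w \<in> snd c ` (fst c - S)"
      then obtain p where p: "p \<in> fst c" "p \<notin> S" "w = snd c p" by blast
      have np: "p \<notin> range P" "p \<notin> range Q" "p \<noteq> r" "p \<notin> G" "p \<notin> Z" "\<sigma> p \<notin> Z"
        using p(2) involution_apply[OF \<sigma>(2), of p] by (auto simp: S_def image_iff)
      then show "\<Omega> c analytic_on {w}"
        unfolding p(3) by (intro analytic_\<Omega>[OF c p(1)]) (use \<Omega>_order[OF c p(1)] in simp)
    qed
    then show "\<omega> c holomorphic_on snd c ` (fst c - S)"
      unfolding \<omega>_def[abs_def] Diff_eq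
      by (intro holomorphic_on_mult holomorphic_fun_onD[OF hol(1) c] holomorphic_fun_onD[OF hol(2) c])
  next
    fix c d q assume c: "c \<in> \<A>" "d \<in> \<A>" "q \<in> fst c" "q \<in> fst d"
    have "\<Omega> c (snd c q) = \<Omega> d (transition c d (snd c q)) * deriv (transition c d) (snd c q)"
      using \<Omega> c unfolding meromorphic_form_def by blast
    then show "\<omega> c (snd c q) = \<omega> d (snd d q) * deriv (transition c d) (snd c q)"
      using c by (simp add: \<omega>_chart)
  next
    fix p assume "p \<in> S"
    have "\<exists>c\<in>\<A>. p \<in> fst c \<and> ((\<lambda>q. (snd c q - snd c p) * (\<phi> q * \<phi>' (\<sigma> q) * \<Omega> c (snd c q))) \<longlongrightarrow> R p) (at p)"
    proof -
      consider j where "p = P j" | "p \<notin> range P" "p \<in> range Q \<union> {r}" | "p \<notin> range P" "p \<notin> range Q \<union> {r}" by blast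
      then show ?thesis
      proof cases
        case 1
        have "R p = pairing_at_P n lc n' lc' j" using inj_PQ(1) by (simp add: R_def 1)
        then show ?thesis
          using pairing_limit_P[OF \<phi> le, of j] chart_P[of j] 1 by (intro bexI[of _ "(W j, z j)"]) simp_all
      next
        case 2
        then have R: "R p = form_residue \<A> \<Omega> p * \<phi> p * \<phi>' p" by (simp add: R_def)
        have "p \<in> range Q \<or> p = r" using 2(2) by blast
        then show ?thesis unfolding R by (rule pairing_limit_residue[OF \<phi>])
      next
        case 3
        then have R: "R p = 0" by (simp add: R_def)
        show ?thesis unfolding R by (rule pairing_limit_regular[OF \<phi>]) (use 3 in auto)
      qed
    qed
    then obtain c where c: "c \<in> \<A>" "p \<in> fst c"
      and lim: "((\<lambda>q. (snd c q - snd c p) * (\<phi> q * \<phi>' (\<sigma> q) * \<Omega> c (snd c q))) \<longlongrightarrow> R p) (at p)" by blast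
    have "\<forall>\<^sub>F q in at p. q \<in> fst c - {p}" using open_chart[OF c(1)] c(2) by (intro eventually_at_in_open)
    then have "\<forall>\<^sub>F q in at p. (snd c q - snd c p) * (\<phi> q * \<phi>' (\<sigma> q) * \<Omega> c (snd c q)) =
        (snd c q - snd c p) * \<omega> c (snd c q)"
      by (rule eventually_mono) (simp add: \<omega>_chart[OF c(1)])
    from Lim_transform_eventually[OF lim this] c
    show "\<exists>c\<in>\<A>. p \<in> fst c \<and> ((\<lambda>q. (snd c q - snd c p) * \<omega> c (snd c q)) \<longlongrightarrow> R p) (at p)" by blast
  qed
  also have "(\<Sum>p\<in>S. R p) = (\<Sum>p\<in>range P \<union> (range Q \<union> {r}). R p)"
    by (rule sum.mono_neutral_right[OF finS]) (auto simp: S_def R_def)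
  also have "\<dots> = (\<Sum>p\<in>range P. R p) + (\<Sum>p\<in>range Q \<union> {r}. R p)"
    using disjoint(1) by (intro sum.union_disjoint) auto
  also have "(\<Sum>p\<in>range Q \<union> {r}. R p) = (\<Sum>p\<in>range Q. R p) + (\<Sum>p\<in>{r}. R p)"
    using disjoint(4) by (intro sum.union_disjoint) auto
  also have "(\<Sum>p\<in>range P. R p) = (\<Sum>j\<in>UNIV. pairing_at_P n lc n' lc' j)"
    using inj_PQ(1) by (simp add: sum.reindex R_def)
  also have "(\<Sum>p\<in>range Q. R p) = (\<Sum>m\<in>UNIV. form_residue \<A> \<Omega> (Q m) * \<phi> (Q m) * \<phi>' (Q m))"
  proof -
    have "Q m \<notin> range P" for m using disjoint(1) by blast
    then show ?thesis using inj_PQ(2) by (simp add: sum.reindex R_def)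
  qed
  also have "(\<Sum>p\<in>{r}. R p) = form_residue \<A> \<Omega> r * \<phi> r * \<phi>' r"
  proof -
    have "r \<notin> range P" using disjoint(1) by blast
    then show ?thesis by (simp add: R_def)
  qed
  finally show ?thesis by (simp add: add_ac)
qed

section \<open>Expansions at the essential singularities and derivatives in the parameters\<close>

text \<open>Transported to the chart, the series converges to \<open>F\<close> on a punctured disc
  around 0, so the limit is its constant term.\<close>

lemma power_series_tendsto_P:
  assumes "\<forall>\<^sub>F S in at (P j). (\<lambda>m. b m * z j S ^ m) sums F S"
  shows "(F \<longlongrightarrow> b 0) (at (P j))"
proof -
  let ?c = "(W j, z j)"
  have c: "?c \<in> \<A>" "P j \<in> fst ?c" "snd ?c (P j) = 0" using chart_P[of j] by auto
  have "filterlim (chart_inv ?c) (at (P j)) (at 0)" using filterlim_chart_inv[OF c(1,2)] c(3) by simp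
  from eventually_compose_filterlim[OF assms this]
  have 1: "\<forall>\<^sub>F w in at 0. (\<lambda>m. b m * z j (chart_inv ?c w) ^ m) sums F (chart_inv ?c w)" .
  have "open (snd ?c ` fst ?c)" by (rule open_chart_image[OF c(1) open_chart[OF c(1)] subset_refl])
  moreover have "0 \<in> snd ?c ` fst ?c" using c(2,3) by (metis imageI)
  ultimately have "\<forall>\<^sub>F w in at 0. w \<in> snd ?c ` fst ?c"
    using eventually_at_topological by blast
  with 1 have "\<forall>\<^sub>F w in at 0. (\<lambda>m. b m * w ^ m) sums F (chart_inv ?c w)"
  proof (rule eventually_elim2)
    fix w assume s: "(\<lambda>m. b m * z j (chart_inv ?c w) ^ m) sums F (chart_inv ?c w)" and "w \<in> snd ?c ` fst ?c"
    then obtain q where "q \<in> fst ?c" "w = snd ?c q" by blast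
    then have "z j (chart_inv ?c w) = w" using chart_inv_chart[OF c(1)] by simp
    then show "(\<lambda>m. b m * w ^ m) sums F (chart_inv ?c w)" using s by simp
  qed
  then obtain s where s: "s > 0" "\<And>w. w \<noteq> 0 \<Longrightarrow> norm w < s \<Longrightarrow> (\<lambda>m. b m * w ^ m) sums F (chart_inv ?c w)"
    unfolding eventually_at by (auto simp: dist_norm)
  have "((\<lambda>w. F (chart_inv ?c w)) \<longlongrightarrow> b 0) (at (snd ?c (P j)))"
    unfolding c(3) by (rule powser_limit_0_strong[OF s])
  then show ?thesis
    by (rule tendsto_chart[OF c(1) open_chart[OF c(1)] c(2) subset_refl])
       (use chart_inv_chart[OF c(1)] in simp)
qed

text \<open>Serves two situations: at regular points \<open>\<kappa> = 1\<close> and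
  \<open>B\<close> is empty; at a simple pole \<kappa> is the local coordinate, \<open>B\<close> is
  the pole, and \<open>F v\<close> is the holomorphic extension of the product. The circle avoids
  its centre in both cases, so joint continuity of the u-derivatives is available on it.\<close>

lemma partial_holomorphic:
  assumes c: "c \<in> \<A>" and U: "open U" "u \<in> U" and fam: "smooth_family U E \<psi>"
    and D: "D \<subseteq> snd c ` fst c" and \<rho>: "\<rho> > 0" "cball a \<rho> \<subseteq> D" and B: "B \<subseteq> {a}"
    and avoid: "\<And>w. w \<in> D - B \<Longrightarrow> chart_inv c w \<notin> E"
    and F: "\<And>v. v \<in> U \<Longrightarrow> F v holomorphic_on D"
    and eq: "\<And>v w. v \<in> U \<Longrightarrow> w \<in> D - B \<Longrightarrow> F v w = \<kappa> w * \<psi> v (chart_inv c w)"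
    and \<kappa>: "continuous_on D \<kappa>"
  obtains g where "g holomorphic_on ball a \<rho>"
    "\<And>w. w \<in> ball a \<rho> - B \<Longrightarrow> g w = \<kappa> w * partial i (\<lambda>v. \<psi> v (chart_inv c w)) u"
proof -
  let ?l = "\<lambda>t::real. u + t *\<^sub>R axis i 1"
  have cl: "continuous_on UNIV ?l" by (intro continuous_intros)
  have "open (?l -` U)" by (rule open_vimage[OF U(1) cl])
  moreover have "0 \<in> ?l -` U" using U(2) by simp
  ultimately obtain \<delta> where \<delta>: "\<delta> > 0" "ball 0 \<delta> \<subseteq> ?l -` U" using open_contains_ball by blast
  have lU: "?l t \<in> U" if "t \<in> {-\<delta><..<\<delta>}" for t
    using \<delta>(2) that by (auto simp: subset_iff dist_real_def)
  have sD: "w \<in> D - B" if "w \<in> sphere a \<rho>" for w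
    using that \<rho> B by (auto simp: subset_iff)
  have dd: "(\<lambda>v. \<psi> v S) differentiable (at v)" if "v \<in> U" "S \<notin> E" for v S
    using fam that smooth_on_differentiable unfolding smooth_family_def by blast
  have der1: "((\<lambda>t. F (?l t) w) has_vector_derivative \<kappa> w * partial i (\<lambda>v. \<psi> v (chart_inv c w)) (?l t)) (at t)"
    if t: "t \<in> {-\<delta><..<\<delta>}" and w: "w \<in> D - B" for t w
  proof -
    have "((\<lambda>t. \<kappa> w * \<psi> (?l t) (chart_inv c w)) has_vector_derivative
        \<kappa> w * partial i (\<lambda>v. \<psi> v (chart_inv c w)) (?l t)) (at t)"
      by (intro has_vector_derivative_mult_right has_vector_derivative_partial dd lU t avoid w)
    then show ?thesis
      by (rule has_vector_derivative_transform_within_open[where S = "{-\<delta><..<\<delta>}"])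
         (use t eq[OF lU w] in auto)
  qed
  obtain g where g: "g holomorphic_on ball a \<rho>"
    "\<And>w. w \<in> ball a \<rho> \<Longrightarrow> ((\<lambda>t. F (?l t) w) has_vector_derivative g w) (at 0)"
  proof (rule holomorphic_parameter_derivative[OF \<delta>(1) \<rho>(1),
      where f = "\<lambda>t. F (?l t)" and a = a and ft = "\<lambda>t w. \<kappa> w * partial i (\<lambda>v. \<psi> v (chart_inv c w)) (?l t)"])
    show "F (?l t) holomorphic_on cball a \<rho>" if "t \<in> {-\<delta><..<\<delta>}" for t
      using F[OF lU[OF that]] \<rho>(2) by (rule holomorphic_on_subset)
    show "((\<lambda>t. F (?l t) \<zeta>) has_vector_derivative \<kappa> \<zeta> * partial i (\<lambda>v. \<psi> v (chart_inv c \<zeta>)) (?l t)) (at t)"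
      if "t \<in> {-\<delta><..<\<delta>}" "\<zeta> \<in> sphere a \<rho>" for t \<zeta>
      by (rule der1[OF that(1) sD[OF that(2)]])
    let ?X = "{-\<delta><..<\<delta>} \<times> sphere a \<rho>"
    have sub: "sphere a \<rho> \<subseteq> D" using sD by blast
    have fc: "continuous_on (U \<times> (- E)) (\<lambda>(u, S). partial i (\<lambda>v. \<psi> v S) u)"
    proof -
      have "continuous_on (U \<times> (- E)) (\<lambda>(u, S). iter_partial [i] (\<lambda>v. \<psi> v S) u)"
        using fam unfolding smooth_family_def by blast
      then show ?thesis by simp
    qed
    have ci: "continuous_on (sphere a \<rho>) (chart_inv c)"
      by (rule continuous_on_chart_inv[OF c]) (use sub D in blast)
    have cm: "continuous_on ?X (\<lambda>x. (?l (fst x), chart_inv c (snd x)))"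
      by (intro continuous_intros continuous_on_compose2[OF ci]) auto
    have im: "(\<lambda>x. (?l (fst x), chart_inv c (snd x))) ` ?X \<subseteq> U \<times> (- E)"
    proof (rule image_subsetI)
      fix x assume "x \<in> ?X"
      then show "(?l (fst x), chart_inv c (snd x)) \<in> U \<times> (- E)"
        using lU[of "fst x"] avoid[OF sD, of "snd x"] by (simp add: mem_Times_iff)
    qed
    have 1: "continuous_on ?X (\<lambda>x. partial i (\<lambda>v. \<psi> v (chart_inv c (snd x))) (?l (fst x)))"
      using continuous_on_compose2[OF fc cm im] by (simp add: case_prod_unfold)
    have "continuous_on ?X (\<lambda>x. \<kappa> (snd x))"
      by (rule continuous_on_compose2[OF continuous_on_subset[OF \<kappa> sub]]) (auto intro!: continuous_intros)
    from continuous_on_mult[OF this 1]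
    show "continuous_on ?X (\<lambda>(t, \<zeta>). \<kappa> \<zeta> * partial i (\<lambda>v. \<psi> v (chart_inv c \<zeta>)) (?l t))"
      by (simp add: case_prod_unfold)
  qed blast
  show thesis
  proof (rule that[OF g(1)])
    fix w assume w: "w \<in> ball a \<rho> - B"
    then have "w \<in> D - B" using \<rho>(2) by (auto simp: subset_iff)
    from der1[OF _ this, of 0] \<delta>(1)
    have "((\<lambda>t. F (?l t) w) has_vector_derivative \<kappa> w * partial i (\<lambda>v. \<psi> v (chart_inv c w)) u) (at 0)" by simp
    then show "g w = \<kappa> w * partial i (\<lambda>v. \<psi> v (chart_inv c w)) u"
      using g(2)[of w] w vector_derivative_unique_at by blast
  qed
qed

text \<open>The domain of the extension depends on the chart and on \<open>E\<close> but not on the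
  function. A whole family of functions can therefore be extended to one common disc, as
  differentiation in the parameter requires.\<close>

lemma simple_pole_chart_split:
  assumes \<phi>: "holomorphic_fun_on \<A> \<phi> (- E)" and c: "c \<in> \<A>" "p \<in> fst c"
    and lim: "((\<lambda>q. (snd c q - snd c p) * \<phi> q) \<longlongrightarrow> L) (at p)"
  obtains F where "F holomorphic_on snd c ` (fst c - (E - {p}))"
    "\<And>w. w \<in> snd c ` (fst c - (E - {p})) - {snd c p} \<Longrightarrow> F w = (w - snd c p) * \<phi> (chart_inv c w)"
proof -
  let ?V = "fst c - (E - {p})" and ?a = "snd c p"
  have "finite E" using finite_GZ by (simp add: E_def)
  then have oV: "open ?V" using open_chart[OF c(1)] by (intro open_Diff finite_imp_closed) auto
  then have oD: "open (snd c ` ?V)" by (rule open_chart_image[OF c(1)]) auto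
  have aD: "?a \<in> snd c ` ?V" using c by blast
  have "snd c ` ?V - {?a} \<subseteq> snd c ` (fst c \<inter> - E)"
    by blast
  then have hol: "(\<phi> \<circ> chart_inv c) holomorphic_on snd c ` ?V - {?a}"
    using holomorphic_fun_onD[OF \<phi> c(1)] holomorphic_on_subset by blast
  have "((\<lambda>w. (snd c (chart_inv c w) - ?a) * \<phi> (chart_inv c w)) \<longlongrightarrow> L) (at ?a)"
    by (rule filterlim_compose[OF lim filterlim_chart_inv[OF c]])
  moreover have "\<forall>\<^sub>F w in at ?a. (snd c (chart_inv c w) - ?a) * \<phi> (chart_inv c w) = (w - ?a) * (\<phi> \<circ> chart_inv c) w"
  proof -
    have "\<forall>\<^sub>F w in at ?a. w \<in> snd c ` ?V" using oD aD eventually_at_topological by blast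
    then show ?thesis by (rule eventually_mono) (use c in auto)
  qed
  ultimately have lim': "((\<lambda>w. (w - ?a) * (\<phi> \<circ> chart_inv c) w) \<longlongrightarrow> L) (at ?a)"
    by (rule Lim_transform_eventually)
  obtain h where h: "h holomorphic_on snd c ` ?V"
    "\<And>w. w \<in> snd c ` ?V - {?a} \<Longrightarrow> (\<phi> \<circ> chart_inv c) w = L / (w - ?a) + h w"
    using holomorphic_simple_pole_split[OF oD aD hol lim'] by blast
  show thesis
  proof (rule that[of "\<lambda>w. L + (w - ?a) * h w"])
    show "(\<lambda>w. L + (w - ?a) * h w) holomorphic_on snd c ` ?V" using h(1) by (intro holomorphic_intros)
    fix w assume w: "w \<in> snd c ` ?V - {?a}"
    then have "w - ?a \<noteq> 0" by auto
    moreover have "\<phi> (chart_inv c w) = L / (w - ?a) + h w" using h(2)[OF w] by simp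
    ultimately show "L + (w - ?a) * h w = (w - ?a) * \<phi> (chart_inv c w)" by (simp add: distrib_left)
  qed
qed

lemma open_punctured_chart:
  assumes "c \<in> \<A>"
  shows "open (fst c - (E - {p}))"
proof -
  have "finite E" using finite_GZ by (simp add: E_def)
  then show ?thesis using open_chart[OF assms] by (intro open_Diff finite_imp_closed) auto
qed

end

lemma partial_exp_component:
  "partial i (\<lambda>v::real^'n::finite. exp (- (of_real (v $ j) / \<zeta>)) :: complex) u =
     - (of_bool (i = j) / \<zeta>) * exp (- (of_real (u $ j) / \<zeta>))"
  "(\<lambda>v::real^'n. exp (- (of_real (v $ j) / \<zeta>)) :: complex) differentiable (at u)"
proof -
  have bl: "bounded_linear (\<lambda>v::real^'n. - ((of_real (v $ j) :: complex) / \<zeta>))"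
    using bounded_linear_minus[OF bounded_linear_compose[OF bounded_linear_divide
        bounded_linear_compose[OF bounded_linear_of_real bounded_linear_vec_nth[of j]]]] .
  have "((\<lambda>v::real^'n. - ((of_real (v $ j) :: complex) / \<zeta>)) has_derivative (\<lambda>v. - (of_real (v $ j) / \<zeta>))) (at u)"
    by (rule bounded_linear_imp_has_derivative[OF bl])
  moreover have "(exp has_derivative (*) (exp (- ((of_real (u $ j) :: complex) / \<zeta>)))) (at (- (of_real (u $ j) / \<zeta>)))"
    using DERIV_exp has_field_derivative_imp_has_derivative by blast
  ultimately have d: "((\<lambda>v::real^'n. exp (- (of_real (v $ j) / \<zeta>)) :: complex) has_derivative
      (\<lambda>h. exp (- (of_real (u $ j) / \<zeta>)) * (- (of_real (h $ j) / \<zeta>)))) (at u)"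
    by (rule has_derivative_compose)
  show "partial i (\<lambda>v::real^'n. exp (- (of_real (v $ j) / \<zeta>)) :: complex) u =
     - (of_bool (i = j) / \<zeta>) * exp (- (of_real (u $ j) / \<zeta>))"
    using partial_eq[OF d, of i] by (simp add: axis_def of_bool_def)
  show "(\<lambda>v::real^'n. exp (- (of_real (v $ j) / \<zeta>)) :: complex) differentiable (at u)"
    using d by (auto simp: differentiable_def)
qed

section \<open>The Baker-Akhiezer family and its first derivatives\<close>

locale ba_family = spectral_data \<A> P W z G Z r Q \<sigma> \<Omega>
  for \<A> :: "'a::t2_space chart set" and P :: "'n::finite \<Rightarrow> 'a" and W :: "'n \<Rightarrow> 'a set"
    and z :: "'n \<Rightarrow> 'a \<Rightarrow> complex" and G Z :: "'a set" and r :: 'a and Q :: "'m::finite \<Rightarrow> 'a"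
    and \<sigma> :: "'a \<Rightarrow> 'a" and \<Omega> :: "'a form" +
  fixes h :: real and U :: "(real^'n) set" and \<psi> :: "real^'n \<Rightarrow> 'a \<Rightarrow> complex"
    and a :: "'n \<Rightarrow> nat \<Rightarrow> real^'n \<Rightarrow> complex"
  assumes U: "open U"
    and \<psi>: "\<And>u. u \<in> U \<Longrightarrow> baker_akhiezer \<A> P z G r Z (of_real h) u (\<psi> u)"
    and \<psi>_smooth: "smooth_family U (range P \<union> G) \<psi>"
    and \<psi>_termwise: "termwise_expansions P z U \<psi> a"
begin

lemma \<psi>_holomorphic: "u \<in> U \<Longrightarrow> holomorphic_fun_on \<A> (\<psi> u) (- E)"
  using \<psi> by (simp add: baker_akhiezer_def E_def)

lemma \<psi>_ord_pole:
  assumes "u \<in> U" "p \<in> G"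
  shows "ord_ge (\<psi> u) p (- 1)"
proof (rule ord_ge_simple_pole)
  fix c assume c: "c \<in> \<A>" "p \<in> fst c"
  have "at_most_simple_pole_at \<A> (\<psi> u) p" using \<psi>[OF assms(1)] assms(2) by (simp add: baker_akhiezer_def)
  then have "(\<psi> u \<circ> chart_inv c) meromorphic_on {snd c p}"
    "is_pole (\<psi> u \<circ> chart_inv c) (snd c p) \<longrightarrow> zorder (\<psi> u \<circ> chart_inv c) (snd c p) = - 1"
    using c unfolding at_most_simple_pole_at_def by blast+
  note ext = simple_pole_at_extension[OF this]
  obtain r g where "r > 0" "g holomorphic_on ball (snd c p) r"
    "\<And>w. w \<in> ball (snd c p) r - {snd c p} \<Longrightarrow> g w = (w - snd c p) * (\<psi> u \<circ> chart_inv c) w"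
    using ext by blast
  then show "\<exists>r g. r > 0 \<and> g holomorphic_on ball (snd c p) r \<and>
      (\<forall>w\<in>ball (snd c p) r - {snd c p}. g w = (w - snd c p) * \<psi> u (chart_inv c w))"
    by (intro exI[of _ r] exI[of _ g]) simp
qed

lemma \<psi>_pole_limit:
  assumes "u \<in> U" "p \<in> G" "c \<in> \<A>" "p \<in> fst c"
  shows "\<exists>L. ((\<lambda>q. (snd c q - snd c p) * \<psi> u q) \<longlongrightarrow> L) (at p)"
  using \<psi>_ord_pole[OF assms(1,2)] assms(3,4) unfolding ord_ge_def by simp

lemma \<psi>_zero: "u \<in> U \<Longrightarrow> p \<in> Z \<Longrightarrow> \<psi> u p = 0" and \<psi>_r: "u \<in> U \<Longrightarrow> \<psi> u r = of_real h"
  using \<psi> by (simp_all add: baker_akhiezer_def)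

lemma \<psi>_differentiable: "u \<in> U \<Longrightarrow> S \<notin> E \<Longrightarrow> (\<lambda>v. \<psi> v S) differentiable (at u)"
  using \<psi>_smooth smooth_on_differentiable unfolding smooth_family_def E_def by blast

lemma \<psi>_expansion:
  assumes "u \<in> U"
  shows "((\<lambda>S. exp (- (of_real (u $ j) / z j S)) * \<psi> u S) \<longlongrightarrow> a j 0 u) (at (P j))"
    and "((\<lambda>S. partial i (\<lambda>v. exp (- (of_real (v $ j) / z j S)) * \<psi> v S) u) \<longlongrightarrow> partial i (a j 0) u) (at (P j))"
proof -
  have *: "\<forall>\<^sub>F S in at (P j). (\<lambda>m. iter_partial is (a j m) u * z j S ^ m) sums
      iter_partial is (\<lambda>v. exp (- (of_real (v $ j) / z j S)) * \<psi> v S) u" for "is"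
    using \<psi>_termwise assms unfolding termwise_expansions_def by blast
  show "((\<lambda>S. exp (- (of_real (u $ j) / z j S)) * \<psi> u S) \<longlongrightarrow> a j 0 u) (at (P j))"
    using power_series_tendsto_P[OF *[of "[]"]] by simp
  show "((\<lambda>S. partial i (\<lambda>v. exp (- (of_real (v $ j) / z j S)) * \<psi> v S) u) \<longlongrightarrow> partial i (a j 0) u) (at (P j))"
    using power_series_tendsto_P[OF *[of "[i]"]] by simp
qed

lemma ba_like_\<psi>:
  assumes "u \<in> U"
  shows "ba_like u (\<psi> u) (\<lambda>_. 0) (\<lambda>j. a j 0 u)"
  unfolding ba_like_def
  using \<psi>_holomorphic[OF assms] \<psi>_ord_pole[OF assms] \<psi>_zero[OF assms] \<psi>_expansion(1)[OF assms] by simp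

lemma partial_\<psi>_holomorphic:
  assumes u: "u \<in> U"
  shows "holomorphic_fun_on \<A> (\<lambda>S. partial i (\<lambda>v. \<psi> v S) u) (- E)"
  unfolding holomorphic_fun_on_def
proof (intro ballI holomorphic_on_locally)
  fix c w assume c: "c \<in> \<A>" and "w \<in> snd c ` (fst c \<inter> - E)"
  then obtain p where p: "p \<in> fst c \<inter> - E" "w = snd c p" by blast
  let ?V = "fst c \<inter> - E"
  have oV: "open ?V" using open_chart[OF c] open_minus_E by blast
  obtain \<rho> where \<rho>: "\<rho> > 0" "cball (snd c p) (2 * \<rho>) \<subseteq> snd c ` ?V"
    by (rule exists_chart_radius[OF c p(1) oV]) auto
  have sub: "cball (snd c p) \<rho> \<subseteq> snd c ` ?V" using \<rho> subset_cball[of \<rho> "2 * \<rho>" "snd c p"] by simp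
  obtain g where g: "g holomorphic_on ball (snd c p) \<rho>"
    "\<And>w. w \<in> ball (snd c p) \<rho> - {} \<Longrightarrow> g w = 1 * partial i (\<lambda>v. \<psi> v (chart_inv c w)) u"
  proof (rule partial_holomorphic[OF c U u \<psi>_smooth[folded E_def] _ \<rho>(1) sub,
        where B = "{}" and F = "\<lambda>v. \<psi> v \<circ> chart_inv c" and \<kappa> = "\<lambda>_. 1" and i = i])
    show "(\<psi> v \<circ> chart_inv c) holomorphic_on snd c ` ?V" if "v \<in> U" for v
      by (rule holomorphic_fun_onD[OF \<psi>_holomorphic[OF that] c])
    show "chart_inv c w \<notin> E" if "w \<in> snd c ` ?V - {}" for w
      using that c by auto
  qed auto
  have "((\<lambda>S. partial i (\<lambda>v. \<psi> v S) u) \<circ> chart_inv c) holomorphic_on ball (snd c p) \<rho>"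
    by (rule holomorphic_transform[OF g(1)]) (use g(2) in simp)
  then show "\<exists>T. open T \<and> w \<in> T \<and> ((\<lambda>S. partial i (\<lambda>v. \<psi> v S) u) \<circ> chart_inv c) holomorphic_on T"
    using \<rho>(1) p(2) by (intro exI[of _ "ball (snd c p) \<rho>"]) simp
qed

lemma partial_\<psi>_ord_pole:
  assumes u: "u \<in> U" and p: "p \<in> G"
  shows "ord_ge (\<lambda>S. partial i (\<lambda>v. \<psi> v S) u) p (- 1)"
proof (rule ord_ge_simple_pole)
  fix c assume c: "c \<in> \<A>" "p \<in> fst c"
  let ?V = "fst c - (E - {p})" and ?a = "snd c p"
  obtain \<rho> where \<rho>: "\<rho> > 0" "cball ?a (2 * \<rho>) \<subseteq> snd c ` ?V"
    by (rule exists_chart_radius[OF c(1) _ open_punctured_chart[OF c(1)], of p p]) (use c in auto)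
  have sub: "cball ?a \<rho> \<subseteq> snd c ` ?V" using \<rho> subset_cball[of \<rho> "2 * \<rho>" ?a] by simp
  have "\<exists>F. F holomorphic_on snd c ` ?V \<and>
      (\<forall>w\<in>snd c ` ?V - {?a}. F w = (w - ?a) * \<psi> v (chart_inv c w))" if v: "v \<in> U" for v
  proof -
    obtain L where L: "((\<lambda>q. (snd c q - snd c p) * \<psi> v q) \<longlongrightarrow> L) (at p)"
      using \<psi>_pole_limit[OF v p c] by blast
    show ?thesis by (rule simple_pole_chart_split[OF \<psi>_holomorphic[OF v] c L]) blast
  qed
  then obtain F where F: "\<And>v. v \<in> U \<Longrightarrow> F v holomorphic_on snd c ` ?V"
    "\<And>v w. v \<in> U \<Longrightarrow> w \<in> snd c ` ?V - {?a} \<Longrightarrow> F v w = (w - ?a) * \<psi> v (chart_inv c w)"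
    by metis
  obtain g where g: "g holomorphic_on ball ?a \<rho>"
    "\<And>w. w \<in> ball ?a \<rho> - {?a} \<Longrightarrow> g w = (w - ?a) * partial i (\<lambda>v. \<psi> v (chart_inv c w)) u"
  proof (rule partial_holomorphic[OF c(1) U u \<psi>_smooth[folded E_def] _ \<rho>(1) sub,
        where B = "{?a}" and F = F and \<kappa> = "\<lambda>w. w - ?a" and i = i])
    show "chart_inv c w \<notin> E" if w: "w \<in> snd c ` ?V - {?a}" for w
    proof -
      obtain q where "q \<in> ?V" "w = snd c q" using w by blast
      moreover from this w have "q \<noteq> p" by blast
      ultimately show ?thesis using c(1) by simp
    qed
    show "continuous_on (snd c ` ?V) (\<lambda>w. w - ?a)" by (intro continuous_intros)
  qed (use F in auto)
  show "\<exists>r g. r > 0 \<and> g holomorphic_on ball ?a r \<and>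
      (\<forall>w\<in>ball ?a r - {?a}. g w = (w - ?a) * partial i (\<lambda>v. \<psi> v (chart_inv c w)) u)"
    using \<rho>(1) g by blast
qed

lemma partial_constant:
  assumes "u \<in> U" "\<And>v. v \<in> U \<Longrightarrow> \<psi> v p = k"
  shows "partial i (\<lambda>v. \<psi> v p) u = 0"
proof -
  have "partial i (\<lambda>v. \<psi> v p) u = partial i (\<lambda>_. k) u"
    by (rule partial_cong_open[OF U assms])
  also have "\<dots> = 0" using partial_eq[OF has_derivative_const] by blast
  finally show ?thesis .
qed

text \<open>Differentiating exp(k_j u_j) brings down k_j if \<open>i = j\<close>: the order rises by
  one and the leading coefficient is again that of \<psi>. For \<open>i \<noteq> j\<close> the
  exponential is constant in the variable, and only the coefficient is differentiated.\<close>

lemma ba_like_partial_\<psi>: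
  assumes u: "u \<in> U"
  shows "ba_like u (\<lambda>S. partial i (\<lambda>v. \<psi> v S) u) (\<lambda>j. of_bool (i = j))
    (\<lambda>j. if i = j then a j 0 u else partial i (a j 0) u)"
  unfolding ba_like_def
proof (intro conjI ballI allI)
  show "holomorphic_fun_on \<A> (\<lambda>S. partial i (\<lambda>v. \<psi> v S) u) (- E)"
    by (rule partial_\<psi>_holomorphic[OF u])
  show "ord_ge (\<lambda>S. partial i (\<lambda>v. \<psi> v S) u) p (- 1)" if "p \<in> G" for p
    by (rule partial_\<psi>_ord_pole[OF u that])
  show "partial i (\<lambda>v. \<psi> v p) u = 0" if "p \<in> Z" for p
    by (rule partial_constant[OF u \<psi>_zero[OF _ that]])
  fix j
  let ?e = "\<lambda>S. exp (- (of_real (u $ j) / z j S))"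
  have c: "(W j, z j) \<in> \<A>" "P j \<in> fst (W j, z j)" using chart_P[of j] by auto
  have "filterlim (z j) (at 0) (at (P j))" using filterlim_chart[OF c] chart_P(3)[of j] by simp
  then have zlim: "(z j \<longlongrightarrow> 0) (at (P j))" and znz: "\<forall>\<^sub>F S in at (P j). z j S \<noteq> 0"
    by (auto simp: filterlim_at)
  have notE: "\<forall>\<^sub>F S in at (P j). S \<notin> E"
  proof -
    have "\<forall>\<^sub>F S in at (P j). S \<in> (W j - (E - {P j})) - {P j}"
      using open_punctured_chart[OF c(1), of "P j"] c(2) by (intro eventually_at_in_open) auto
    then show ?thesis by (rule eventually_mono) auto
  qed
  \<comment> \<open>The termwise expansion controls the derivative of the regularised function; the
    product rule \<open>Yeq\<close> converts it into information on the derivative of \<psi>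
    itself.\<close>
  define Y where "Y S = partial i (\<lambda>v. exp (- (of_real (v $ j) / z j S)) * \<psi> v S) u" for S
  have Y: "(Y \<longlongrightarrow> partial i (a j 0) u) (at (P j))"
    unfolding Y_def[abs_def] by (rule \<psi>_expansion(2)[OF u])
  have Yeq: "Y S = ?e S * partial i (\<lambda>v. \<psi> v S) u - of_bool (i = j) / z j S * (?e S * \<psi> u S)" if "S \<notin> E" for S
    unfolding Y_def
    using partial_bilinear[OF bounded_bilinear_mult partial_exp_component(2)[where j = j and \<zeta> = "z j S"]
        \<psi>_differentiable[OF u that], where i = i]
    by (simp add: partial_exp_component(1) mult.assoc)
  have e0: "((\<lambda>S. ?e S * \<psi> u S) \<longlongrightarrow> a j 0 u) (at (P j))" by (rule \<psi>_expansion(1)[OF u])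
  show "((\<lambda>S. z j S ^ of_bool (i = j) * (?e S * partial i (\<lambda>v. \<psi> v S) u)) \<longlongrightarrow>
      (if i = j then a j 0 u else partial i (a j 0) u)) (at (P j))"
  proof (cases "i = j")
    case True
    from tendsto_add[OF tendsto_mult[OF zlim Y] e0]
    have "((\<lambda>S. z j S * Y S + ?e S * \<psi> u S) \<longlongrightarrow> a j 0 u) (at (P j))" by simp
    moreover have "\<forall>\<^sub>F S in at (P j). z j S * Y S + ?e S * \<psi> u S = z j S * (?e S * partial i (\<lambda>v. \<psi> v S) u)"
      using znz notE by (rule eventually_elim2) (simp add: Yeq True right_diff_distrib)
    ultimately have "((\<lambda>S. z j S * (?e S * partial i (\<lambda>v. \<psi> v S) u)) \<longlongrightarrow> a j 0 u) (at (P j))"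
      by (rule Lim_transform_eventually)
    then show ?thesis using True by simp
  next
    case False
    have "\<forall>\<^sub>F S in at (P j). Y S = ?e S * partial i (\<lambda>v. \<psi> v S) u"
      using notE by (rule eventually_mono) (simp add: Yeq False)
    from Lim_transform_eventually[OF Y this] show ?thesis using False by simp
  qed
qed

section \<open>The quadratic identities and reality\<close>

text \<open>Without a derivative both orders at \<open>P j\<close> are 0, so the product keeps the
  zero of \<Omega> and no residue arises there.\<close>

lemma sum_\<psi>_squared:
  assumes "u \<in> U"
  shows "(\<Sum>m\<in>UNIV. form_residue \<A> \<Omega> (Q m) * \<psi> u (Q m) * \<psi> u (Q m)) = - ((of_real h)\<^sup>2 * form_residue \<A> \<Omega> r)"
  using pairing_sum_eq_0[OF ba_like_\<psi>[OF assms] ba_like_\<psi>[OF assms]] \<psi>_r[OF assms]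
  by (simp add: pairing_at_P_def power2_eq_square mult_ac eq_neg_iff_add_eq_0)

text \<open>The term at \<open>r\<close> drops out because \<psi> is constant in u there. At
  \<open>P j\<close> both factors have order 1 only if \<open>i = j\<close> and
  \<open>k = j\<close>; the sign of that residue is turned by moving it to the right-hand
  side.\<close>

lemma sum_partial_\<psi>_product:
  assumes "u \<in> U"
  shows "(\<Sum>m\<in>UNIV. form_residue \<A> \<Omega> (Q m) * partial i (\<lambda>v. \<psi> v (Q m)) u * partial k (\<lambda>v. \<psi> v (Q m)) u) =
    (if i = k then (a i 0 u)\<^sup>2 * deriv (\<Omega> (W i, z i)) 0 else 0)"
proof -
  let ?n = "\<lambda>i j. of_bool (i = j) :: nat"
  let ?l = "\<lambda>i j. if i = j then a j 0 u else partial i (a j 0) u"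
  have r0: "partial i (\<lambda>v. \<psi> v r) u = 0" for i
    by (rule partial_constant[OF assms \<psi>_r])
  have pp: "pairing_at_P (?n i) (?l i) (?n k) (?l k) j =
      (if i = k \<and> j = i then - ((a i 0 u)\<^sup>2 * deriv (\<Omega> (W i, z i)) 0) else 0)" for j
    by (auto simp: pairing_at_P_def power2_eq_square)
  have "(\<Sum>m\<in>UNIV. form_residue \<A> \<Omega> (Q m) * partial i (\<lambda>v. \<psi> v (Q m)) u * partial k (\<lambda>v. \<psi> v (Q m)) u) +
      form_residue \<A> \<Omega> r * partial i (\<lambda>v. \<psi> v r) u * partial k (\<lambda>v. \<psi> v r) u +
      (\<Sum>j\<in>UNIV. pairing_at_P (?n i) (?l i) (?n k) (?l k) j) = 0"
    by (rule pairing_sum_eq_0[OF ba_like_partial_\<psi>[OF assms] ba_like_partial_\<psi>[OF assms]]) simp_all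
  then show ?thesis
    unfolding pp r0 by (cases "i = k") (simp_all add: sum.delta)
qed

text \<open>\<tau> fixes the divisors and conjugates the local parameters, while \<open>u\<close>
  and \<open>h\<close> are real, so each condition is reproduced. By uniqueness \<psi> then agrees
  with this function, hence is real at every fixed point of \<tau> where the two can be
  compared.\<close>

lemma cnj_\<psi>_baker_akhiezer:
  assumes \<tau>: "antiholomorphic_map \<A> \<tau>" "involution \<tau>"
    and fixes_\<tau>: "\<And>i. \<tau> (P i) = P i" "\<And>p. p \<in> G \<Longrightarrow> \<tau> p = p" "\<tau> r = r" "\<And>p. p \<in> Z \<Longrightarrow> \<tau> p = p"
    and \<tau>_params: "\<And>i. \<forall>\<^sub>F S in nhds (P i). z i (\<tau> S) = cnj (z i S)"
    and u: "u \<in> U"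
  shows "baker_akhiezer \<A> P z G r Z (of_real h) u (cnj \<circ> \<psi> u \<circ> \<tau>)"
  unfolding baker_akhiezer_def
proof (intro conjI allI ballI)
  have cont: "continuous_on UNIV \<tau>" using \<tau>(1) by (simp add: antiholomorphic_map_def)
  note \<tau>_lim = involution_filterlim[OF cont \<tau>(2)]
  have hol: "holomorphic_fun_on \<A> (cnj \<circ> \<psi> u \<circ> \<tau>) (- E)"
  proof (rule holomorphic_fun_on_subset[OF
        holomorphic_fun_on_cnj_antiholomorphic[OF \<tau>(1) \<psi>_holomorphic[OF u] open_minus_E]])
    show "- E \<subseteq> \<tau> -` (- E)"
    proof
      fix p assume p: "p \<in> - E"
      have "\<tau> p \<notin> E"
      proof
        assume e: "\<tau> p \<in> E"
        then have "\<tau> (\<tau> p) = \<tau> p" using fixes_\<tau>(1,2) by (auto simp: E_def)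
        then show False using e p involution_apply[OF \<tau>(2), of p] by simp
      qed
      then show "p \<in> \<tau> -` (- E)" by simp
    qed
  qed
  then show "holomorphic_fun_on \<A> (cnj \<circ> \<psi> u \<circ> \<tau>) (- (range P \<union> G))" by (simp add: E_def)
  show "(cnj \<circ> \<psi> u \<circ> \<tau>) r = of_real h" using fixes_\<tau>(3) \<psi>_r[OF u] by simp
  show "(cnj \<circ> \<psi> u \<circ> \<tau>) p = 0" if "p \<in> Z" for p using fixes_\<tau>(4)[OF that] \<psi>_zero[OF u that] by simp
  show "\<exists>b. ba_expansion P z u (cnj \<circ> \<psi> u \<circ> \<tau>) j b" for j
  proof -
    obtain b where "ba_expansion P z u (\<psi> u) j b" using \<psi>[OF u] unfolding baker_akhiezer_def by blast
    then have "\<forall>\<^sub>F S in at (P j). (\<lambda>m. b m * z j S ^ m) sums (exp (- (of_real (u $ j) / z j S)) * \<psi> u S)"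
      by (simp add: ba_expansion_def)
    moreover have "filterlim \<tau> (at (P j)) (at (P j))" using \<tau>_lim[of "P j"] fixes_\<tau>(1) by simp
    ultimately have 1: "\<forall>\<^sub>F S in at (P j). (\<lambda>m. b m * z j (\<tau> S) ^ m) sums
        (exp (- (of_real (u $ j) / z j (\<tau> S))) * \<psi> u (\<tau> S))"
      by (rule eventually_compose_filterlim)
    have "\<forall>\<^sub>F S in at (P j). z j (\<tau> S) = cnj (z j S)"
      using \<tau>_params[of j] by (auto simp: eventually_at_filter elim: eventually_mono)
    with 1 have "\<forall>\<^sub>F S in at (P j). (\<lambda>m. cnj (b m) * z j S ^ m) sums
        (exp (- (of_real (u $ j) / z j S)) * (cnj \<circ> \<psi> u \<circ> \<tau>) S)"
    proof (rule eventually_elim2)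
      fix S assume s: "(\<lambda>m. b m * z j (\<tau> S) ^ m) sums (exp (- (of_real (u $ j) / z j (\<tau> S))) * \<psi> u (\<tau> S))"
        and "z j (\<tau> S) = cnj (z j S)"
      then have "(\<lambda>m. cnj (b m * cnj (z j S) ^ m)) sums cnj (exp (- (of_real (u $ j) / cnj (z j S))) * \<psi> u (\<tau> S))"
        by (subst sums_cnj) simp
      then show "(\<lambda>m. cnj (b m) * z j S ^ m) sums (exp (- (of_real (u $ j) / z j S)) * (cnj \<circ> \<psi> u \<circ> \<tau>) S)"
        by (simp add: exp_cnj)
    qed
    then show ?thesis unfolding ba_expansion_def by (intro exI[of _ "\<lambda>m. cnj (b m)"])
  qed
  show "at_most_simple_pole_at \<A> (cnj \<circ> \<psi> u \<circ> \<tau>) p" if p: "p \<in> G" for p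
    unfolding at_most_simple_pole_at_def
  proof (intro ballI impI)
    fix c assume c: "c \<in> \<A>" "p \<in> fst c"
    have \<tau>p: "\<tau> p = p" by (rule fixes_\<tau>(2)[OF p])
    \<comment> \<open>Near \<open>p\<close> the function \<open>?f\<close> is another holomorphic
      coordinate, so its quotient with \<open>snd c\<close> has a limit; this carries the bound on
      the pole of \<psi> over to the conjugated function.\<close>
    let ?D = "fst c \<inter> \<tau> -` fst c" and ?f = "cnj \<circ> snd c \<circ> \<tau>"
    have D: "open ?D" "p \<in> ?D" "?D \<subseteq> fst c"
      using open_holomorphic_domain(1)[OF cont c(1) c(1)] c \<tau>p by auto
    have "(?f \<circ> chart_inv c) holomorphic_on snd c ` ?D"
      using \<tau>(1) c(1) unfolding antiholomorphic_map_def by (simp add: o_assoc)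
    moreover have "inj_on ?f ?D"
      using \<tau>(2) c(1) by (auto simp: inj_on_def chart_eq_iff involution_inj)
    ultimately obtain k where k: "((\<lambda>q. (snd c q - snd c p) / (?f q - ?f p)) \<longlongrightarrow> k) (at p)"
      using local_coordinate_ratio[OF c(1) D] by blast
    obtain L where L: "((\<lambda>q. (snd c q - snd c p) * \<psi> u q) \<longlongrightarrow> L) (at p)"
      using \<psi>_pole_limit[OF u p c] by blast
    have "filterlim \<tau> (at p) (at p)" using \<tau>_lim[of p] by (simp add: \<tau>p)
    from tendsto_cnj[OF filterlim_compose[OF L this]]
    have "((\<lambda>q. cnj ((snd c (\<tau> q) - snd c p) * \<psi> u (\<tau> q))) \<longlongrightarrow> cnj L) (at p)" .
    from tendsto_mult[OF k this]
    have "((\<lambda>q. (snd c q - snd c p) / (?f q - ?f p) * cnj ((snd c (\<tau> q) - snd c p) * \<psi> u (\<tau> q))) \<longlongrightarrow> k * cnj L) (at p)" .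
    moreover have "\<forall>\<^sub>F q in at p. (snd c q - snd c p) / (?f q - ?f p) * cnj ((snd c (\<tau> q) - snd c p) * \<psi> u (\<tau> q)) =
        (snd c q - snd c p) * (cnj \<circ> \<psi> u \<circ> \<tau>) q"
    proof -
      have "\<forall>\<^sub>F q in at p. q \<in> ?D - {p}" using D(1,2) by (intro eventually_at_in_open)
      then show ?thesis
      proof (rule eventually_mono)
        fix q assume q: "q \<in> ?D - {p}"
        then have "\<tau> q \<noteq> p" using involution_inj[OF \<tau>(2), of q p] \<tau>p by simp
        then have "snd c (\<tau> q) \<noteq> snd c p" using q c by (simp add: chart_eq_iff)
        then have "cnj (snd c (\<tau> q) - snd c p) \<noteq> 0" by simp
        moreover have "?f q - ?f p = cnj (snd c (\<tau> q) - snd c p)" by (simp add: \<tau>p)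
        ultimately show "(snd c q - snd c p) / (?f q - ?f p) * cnj ((snd c (\<tau> q) - snd c p) * \<psi> u (\<tau> q)) =
            (snd c q - snd c p) * (cnj \<circ> \<psi> u \<circ> \<tau>) q" by (simp only: complex_cnj_mult o_apply) simp
      qed
    qed
    ultimately have "((\<lambda>q. (snd c q - snd c p) * (cnj \<circ> \<psi> u \<circ> \<tau>) q) \<longlongrightarrow> k * cnj L) (at p)"
      by (rule Lim_transform_eventually)
    note split = simple_pole_chart_split[OF hol c this]
    obtain F where F: "F holomorphic_on snd c ` (fst c - (E - {p}))"
      "\<And>w. w \<in> snd c ` (fst c - (E - {p})) - {snd c p} \<Longrightarrow> F w = (w - snd c p) * (cnj \<circ> \<psi> u \<circ> \<tau>) (chart_inv c w)"
      using split by blast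
    obtain \<rho> where \<rho>: "\<rho> > 0" "cball (snd c p) (2 * \<rho>) \<subseteq> snd c ` (fst c - (E - {p}))"
      by (rule exists_chart_radius[OF c(1) _ open_punctured_chart[OF c(1)], of p p]) (use c in auto)
    have sub: "ball (snd c p) \<rho> \<subseteq> snd c ` (fst c - (E - {p}))"
      using \<rho> subset_cball[of \<rho> "2 * \<rho>" "snd c p"] ball_subset_cball[of "snd c p" \<rho>] by (simp add: subset_iff)
    note ext = simple_pole_at_if_extension[OF \<rho>(1) holomorphic_on_subset[OF F(1) sub],
        of "(cnj \<circ> \<psi> u \<circ> \<tau>) \<circ> chart_inv c"]
    have "F w = (w - snd c p) * ((cnj \<circ> \<psi> u \<circ> \<tau>) \<circ> chart_inv c) w" if "w \<in> ball (snd c p) \<rho> - {snd c p}" for w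
    proof -
      have "w \<in> snd c ` (fst c - (E - {p})) - {snd c p}" using that sub by blast
      from F(2)[OF this] show ?thesis by simp
    qed
    from ext[OF this]
    show "(cnj \<circ> \<psi> u \<circ> \<tau> \<circ> chart_inv c) meromorphic_on {snd c p} \<and>
      (is_pole (cnj \<circ> \<psi> u \<circ> \<tau> \<circ> chart_inv c) (snd c p)
         \<longrightarrow> zorder (cnj \<circ> \<psi> u \<circ> \<tau> \<circ> chart_inv c) (snd c p) = - 1)"
      by (rule conjI)
  qed
qed

end

section \<open>From the divisor and the reality conditions to coordinates on the sphere\<close>

text \<open>Distinctness of the points turns a sum of point divisors into the indicator of their
  set.\<close>

lemma sum_indicator_inj:
  assumes "finite I" "inj_on f I"
  shows "(\<Sum>s\<in>I. if f s = p then 1 else 0 :: int) = of_bool (p \<in> f ` I)"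
proof (cases "p \<in> f ` I")
  case True
  then obtain t where t: "t \<in> I" "p = f t" by blast
  then have "(\<Sum>s\<in>I. if f s = p then 1 else 0 :: int) = (\<Sum>s\<in>I. if s = t then 1 else 0)"
    using assms(2) by (intro sum.cong refl) (auto dest: inj_onD)
  then show ?thesis using t assms(1) True by simp
next
  case False
  then have "(\<Sum>s\<in>I. if f s = p then 1 else 0 :: int) = 0" by (intro sum.neutral) auto
  then show ?thesis using False by simp
qed

lemma lookup_frag_of: "Poly_Mapping.lookup (frag_of c) p = (if c = p then 1 else 0)"
  by (simp add: lookup_single when_def)

theorem corollary1:
  fixes \<A> :: "'a::t2_space chart set"
    and g l :: nat
    and P :: "'n::finite \<Rightarrow> 'a" and W :: "'n \<Rightarrow> 'a set" and z :: "'n \<Rightarrow> 'a \<Rightarrow> complex"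
    and \<gamma> :: "nat \<Rightarrow> 'a" and r :: 'a and rs :: "nat \<Rightarrow> 'a"
    and Q :: "'m::finite \<Rightarrow> 'a"
    and h :: real and U :: "(real^'n) set"
    and \<psi> :: "real^'n \<Rightarrow> 'a \<Rightarrow> complex" and a :: "'n \<Rightarrow> nat \<Rightarrow> real^'n \<Rightarrow> complex"
    and \<sigma> \<tau> :: "'a \<Rightarrow> 'a" and \<Omega> :: "'a form"
  assumes surface: "riemann_surface \<A>" "compact (UNIV :: 'a set)" "connected (UNIV :: 'a set)"
      "has_genus (euclidean :: 'a topology) g"
    and params: "\<And>i. local_parameter_at \<A> (W i) (z i) (P i)"
    and card_Q: "CARD('m) = CARD('n) + 1"
    and inj_points: "inj P" "inj Q" "inj_on \<gamma> {1..g+l}" "inj_on rs {1..l}"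
    and distinct_P: "range P \<inter> (\<gamma> ` {1..g+l} \<union> insert r (rs ` {1..l}) \<union> range Q) = {}"
    and distinct_\<gamma>: "\<gamma> ` {1..g+l} \<inter> (insert r (rs ` {1..l}) \<union> range Q) = {}"
    and distinct_R: "r \<notin> rs ` {1..l}" "insert r (rs ` {1..l}) \<inter> range Q = {}"
    and U: "open U" "connected U"
    and h: "h \<noteq> 0"
    and \<psi>: "\<And>u. u \<in> U \<Longrightarrow>
        baker_akhiezer \<A> P z (\<gamma> ` {1..g+l}) r (rs ` {1..l}) (of_real h) u (\<psi> u)"
    and \<psi>_unique: "\<And>u \<phi> S. \<lbrakk>u \<in> U;
        baker_akhiezer \<A> P z (\<gamma> ` {1..g+l}) r (rs ` {1..l}) (of_real h) u \<phi>;
        S \<notin> range P \<union> \<gamma> ` {1..g+l}\<rbrakk> \<Longrightarrow> \<phi> S = \<psi> u S"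
    and \<psi>_smooth: "smooth_family U (range P \<union> \<gamma> ` {1..g+l}) \<psi>"
    and \<psi>_termwise: "termwise_expansions P z U \<psi> a"
    and \<sigma>: "holomorphic_map \<A> \<sigma>" "involution \<sigma>"
    and \<sigma>_fixes: "\<And>m. \<sigma> (Q m) = Q m" "\<And>i. \<sigma> (P i) = P i" "\<sigma> r = r"
    and \<sigma>_params: "\<And>i. \<forall>\<^sub>F S in nhds (P i). z i (\<sigma> S) = - z i S"
    and \<Omega>: "meromorphic_form \<A> \<Omega>"
    and \<Omega>_divisor: "form_has_divisor \<A> \<Omega>
        ((\<Sum>s=1..g+l. frag_of (\<gamma> s)) + (\<Sum>s=1..g+l. frag_of (\<sigma> (\<gamma> s))) + (\<Sum>i\<in>UNIV. frag_of (P i))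
          - (\<Sum>m\<in>UNIV. frag_of (Q m)) - (frag_of r + (\<Sum>s=1..l. frag_of (rs s)))
          - (\<Sum>s=1..l. frag_of (\<sigma> (rs s))))"
    and \<tau>: "antiholomorphic_map \<A> \<tau>" "involution \<tau>"
    and \<tau>_fixes: "\<And>i. \<tau> (P i) = P i" "\<And>s. s \<in> {1..g+l} \<Longrightarrow> \<tau> (\<gamma> s) = \<gamma> s" "\<tau> r = r"
      "\<And>s. s \<in> {1..l} \<Longrightarrow> \<tau> (rs s) = rs s" "\<And>m. \<tau> (Q m) = Q m"
    and \<tau>_params: "\<And>i. \<forall>\<^sub>F S in nhds (P i). z i (\<tau> S) = cnj (z i S)"
    and A_pos: "\<And>m. form_residue \<A> \<Omega> (Q m) \<in> \<real>" "\<And>m. Re (form_residue \<A> \<Omega> (Q m)) > 0"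
    and B: "(of_real h)\<^sup>2 * form_residue \<A> \<Omega> r = -1"
  shows "\<exists>(x :: real^'n \<Rightarrow> real^'m) (H :: 'n \<Rightarrow> real^'n \<Rightarrow> real).
      (\<forall>u\<in>U. \<forall>m. of_real (x u $ m) = csqrt (form_residue \<A> \<Omega> (Q m)) * \<psi> u (Q m)) \<and>
      (\<forall>u\<in>U. \<forall>i. of_real (H i u) = csqrt ((a i 0 u)\<^sup>2 * deriv (\<Omega> (W i, z i)) 0)) \<and>
      orthogonal_sphere_coordinates U x H \<and>
      lame_equations 1 {u \<in> U. \<forall>i. a i 0 u \<noteq> 0} H"
proof -
  let ?G = "\<gamma> ` {1..g+l}" and ?Z = "rs ` {1..l}"
  \<comment> \<open>Moves \<sigma> from the points of the divisor to the point of evaluation, so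
    that injectivity of \<gamma> and \<open>rs\<close> applies to the images as well.\<close>
  have inv: "\<sigma> x = p \<longleftrightarrow> x = \<sigma> p" for x p
    using \<sigma>(2) unfolding involution_def by (metis comp_apply id_apply)
  have lookup: "Poly_Mapping.lookup
      ((\<Sum>s=1..g+l. frag_of (\<gamma> s)) + (\<Sum>s=1..g+l. frag_of (\<sigma> (\<gamma> s))) + (\<Sum>i\<in>UNIV. frag_of (P i))
          - (\<Sum>m\<in>UNIV. frag_of (Q m)) - (frag_of r + (\<Sum>s=1..l. frag_of (rs s)))
          - (\<Sum>s=1..l. frag_of (\<sigma> (rs s)))) p =
      of_bool (p \<in> ?G) + of_bool (\<sigma> p \<in> ?G) + of_bool (p \<in> range P)
        - of_bool (p \<in> range Q) - of_bool (p = r) - of_bool (p \<in> ?Z) - of_bool (\<sigma> p \<in> ?Z)" for p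
    unfolding lookup_add lookup_minus lookup_sum lookup_frag_of inv[of _ p]
      sum_indicator_inj[OF finite_atLeastAtMost inj_points(3)] sum_indicator_inj[OF finite inj_points(1)]
      sum_indicator_inj[OF finite inj_points(2)] sum_indicator_inj[OF finite_atLeastAtMost inj_points(4)]
    by auto
  interpret ba_family \<A> P W z ?G ?Z r Q \<sigma> \<Omega> h U \<psi> a
  proof
    show "(\<exists>\<^sub>F w in at (snd c p). \<Omega> c w \<noteq> 0) \<and>
      zorder (\<Omega> c) (snd c p) = of_bool (p \<in> ?G) + of_bool (\<sigma> p \<in> ?G) + of_bool (p \<in> range P)
        - of_bool (p \<in> range Q) - of_bool (p = r) - of_bool (p \<in> ?Z) - of_bool (\<sigma> p \<in> ?Z)"
      if "c \<in> \<A>" "p \<in> fst c" for c p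
    proof -
      from bspec[OF bspec[OF \<Omega>_divisor[unfolded form_has_divisor_def] that(1)] that(2)]
      show ?thesis unfolding lookup .
    qed
  qed (use surface params inj_points distinct_P distinct_\<gamma> distinct_R \<sigma> \<sigma>_fixes \<sigma>_params \<Omega> U \<psi>
        \<psi>_smooth \<psi>_termwise in simp_all)
  define A where "A m = Re (form_residue \<A> \<Omega> (Q m))" for m
  have A: "form_residue \<A> \<Omega> (Q m) = of_real (A m)" "A m > 0" for m
    using A_pos by (simp_all add: A_def)
  have QE: "Q m \<notin> range P \<union> ?G" for m
    using distinct_P distinct_\<gamma> by blast
  have \<psi>_real: "\<psi> u (Q m) = of_real (Re (\<psi> u (Q m)))" if u: "u \<in> U" for u m
  proof -
    have "baker_akhiezer \<A> P z ?G r ?Z (of_real h) u (cnj \<circ> \<psi> u \<circ> \<tau>)"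
      by (rule cnj_\<psi>_baker_akhiezer[OF \<tau> \<tau>_fixes(1) _ \<tau>_fixes(3) _ \<tau>_params u]) (use \<tau>_fixes(2,4) in auto)
    from \<psi>_unique[OF u this, of "Q m"] QE[of m]
    have "cnj (\<psi> u (Q m)) = \<psi> u (Q m)" by (simp add: \<tau>_fixes(5))
    then show ?thesis by (metis Reals_cnj_iff of_real_Re)
  qed
  \<comment> \<open>Real parts give the right type; \<open>\<psi>_real\<close> shows that they lose
    nothing.\<close>
  define x :: "real^'n \<Rightarrow> real^'m" where "x u = (\<chi> m. sqrt (A m) * Re (\<psi> u (Q m)))" for u
  define H where "H i u = sqrt (Re ((a i 0 u)\<^sup>2 * deriv (\<Omega> (W i, z i)) 0))" for i u
  have s\<psi>: "smooth_on U (\<lambda>u. \<psi> u (Q m))" for m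
    using \<psi>_smooth QE[of m] unfolding smooth_family_def by blast
  have bl: "bounded_linear (\<lambda>w. sqrt (A m) * Re w)" for m
    by (rule bounded_linear_compose[OF bounded_linear_mult_right bounded_linear_Re])
  have bl': "bounded_linear (\<lambda>w. (sqrt (A m) * Re w) *\<^sub>R (axis m 1 :: real^'m))" for m
    by (rule bounded_linear_compose[OF bounded_linear_scaleR_left bl])
  \<comment> \<open>Written as a sum of bounded linear images of the complex functions \<psi>(u,
    Q_m), so that smoothness transfers coordinate by coordinate.\<close>
  have "x = (\<lambda>u. \<Sum>m\<in>UNIV. (sqrt (A m) * Re (\<psi> u (Q m))) *\<^sub>R axis m 1)"
    by (rule ext) (simp add: x_def vec_eq_iff axis_def if_distrib cong: if_cong)
  moreover have "smooth_on U (\<lambda>u. \<Sum>m\<in>UNIV. (sqrt (A m) * Re (\<psi> u (Q m))) *\<^sub>R (axis m 1 :: real^'m))"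
    by (rule smooth_on_sum[OF U(1)], rule smooth_on_bounded_linear[OF U(1) bl' s\<psi>])
  ultimately have sx: "smooth_on U x" by simp
  have px: "partial i x u $ m = sqrt (A m) * Re (partial i (\<lambda>v. \<psi> v (Q m)) u)" if u: "u \<in> U" for i u m
  proof -
    have "partial i x u $ m = partial i (\<lambda>v. x v $ m) u"
      by (rule partial_bounded_linear[OF bounded_linear_vec_nth smooth_on_differentiable[OF sx u], symmetric])
    also have "\<dots> = sqrt (A m) * Re (partial i (\<lambda>v. \<psi> v (Q m)) u)"
      unfolding x_def vec_lambda_beta by (rule partial_bounded_linear[OF bl smooth_on_differentiable[OF s\<psi> u]])
    finally show ?thesis .
  qed
  have p_real: "partial i (\<lambda>v. \<psi> v (Q m)) u = of_real (Re (partial i (\<lambda>v. \<psi> v (Q m)) u))" if u: "u \<in> U" for i u m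
  proof -
    have "Im (partial i (\<lambda>v. \<psi> v (Q m)) u) = partial i (\<lambda>v. Im (\<psi> v (Q m))) u"
      by (rule partial_bounded_linear[OF bounded_linear_Im smooth_on_differentiable[OF s\<psi> u], symmetric])
    also have "\<dots> = partial i (\<lambda>_. 0) u"
      by (rule partial_cong_open[OF U(1) u]) (metis Im_complex_of_real \<psi>_real)
    also have "\<dots> = 0" using partial_eq[OF has_derivative_const] by blast
    finally show ?thesis by (simp add: complex_eq_iff)
  qed
  have sq: "sqrt (A m) * sqrt (A m) = A m" for m using A(2)[of m] by simp
  have sphere: "x u \<bullet> x u = 1" if u: "u \<in> U" for u
  proof -
    have "of_real (x u \<bullet> x u) = (\<Sum>m\<in>UNIV. form_residue \<A> \<Omega> (Q m) * \<psi> u (Q m) * \<psi> u (Q m))"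
      unfolding inner_vec_def of_real_sum
    proof (rule sum.cong[OF refl])
      fix m
      have "x u $ m \<bullet> x u $ m = (sqrt (A m) * sqrt (A m)) * Re (\<psi> u (Q m)) * Re (\<psi> u (Q m))"
        by (simp only: x_def vec_lambda_beta inner_real_def mult_ac)
      then show "of_real (x u $ m \<bullet> x u $ m) = form_residue \<A> \<Omega> (Q m) * \<psi> u (Q m) * \<psi> u (Q m)"
        unfolding sq A(1) using \<psi>_real[OF u, of m] by (metis of_real_mult)
    qed
    also have "\<dots> = 1" using sum_\<psi>_squared[OF u] B by simp
    finally show ?thesis by (metis of_real_eq_1_iff)
  qed
  have metric: "of_real (partial i x u \<bullet> partial k x u) =
      (if i = k then (a i 0 u)\<^sup>2 * deriv (\<Omega> (W i, z i)) 0 else 0)" if u: "u \<in> U" for i k u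
    unfolding sum_partial_\<psi>_product[OF u, symmetric] inner_vec_def of_real_sum
  proof (rule sum.cong[OF refl])
    fix m
    let ?p = "\<lambda>i. Re (partial i (\<lambda>v. \<psi> v (Q m)) u)"
    have "partial i x u $ m \<bullet> partial k x u $ m = (sqrt (A m) * sqrt (A m)) * ?p i * ?p k"
      by (simp only: px[OF u] inner_real_def mult_ac)
    then show "of_real (partial i x u $ m \<bullet> partial k x u $ m) =
        form_residue \<A> \<Omega> (Q m) * partial i (\<lambda>v. \<psi> v (Q m)) u * partial k (\<lambda>v. \<psi> v (Q m)) u"
      unfolding sq A(1) using p_real[OF u, of i m] p_real[OF u, of k m] by (metis of_real_mult)
  qed
  \<comment> \<open>The right-hand side is a nonnegative real number, so f_i^2 C_i is one too; this
    makes its complex square root agree with the real number \<open>H i u\<close>.\<close>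
  have metric_self: "(a i 0 u)\<^sup>2 * deriv (\<Omega> (W i, z i)) 0 = of_real (partial i x u \<bullet> partial i x u)"
    if "u \<in> U" for i u using metric[OF that, of i i] by simp
  have H: "H i u = sqrt (partial i x u \<bullet> partial i x u)" if "u \<in> U" for i u
    by (simp add: H_def metric_self[OF that])
  have orth: "partial i x u \<bullet> partial k x u = 0" if "u \<in> U" "i \<noteq> k" for i k u
    using metric[OF that(1), of i k] that(2) by simp
  define V where "V = {u \<in> U. \<forall>i. a i 0 u \<noteq> 0}"
  have sa: "smooth_on U (a i 0)" for i using \<psi>_termwise by (simp add: termwise_expansions_def)
  have "open {u \<in> U. a i 0 u \<noteq> 0}" for i
  proof -
    have "continuous_on U (a i 0)"
      using smooth_on_differentiable[OF sa]
      by (intro continuous_at_imp_continuous_on ballI differentiable_imp_continuous_within) auto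
    from continuous_open_preimage[OF this U(1), of "- {0}"] show ?thesis
      by (simp add: Int_def vimage_def open_Compl)
  qed
  then have "open (U \<inter> (\<Inter>i. {u \<in> U. a i 0 u \<noteq> 0}))" using U(1) by (intro open_Int open_INT) auto
  moreover have "U \<inter> (\<Inter>i. {u \<in> U. a i 0 u \<noteq> 0}) = V" by (auto simp: V_def)
  ultimately have V: "open V" by simp
  have VU: "V \<subseteq> U" by (auto simp: V_def)
  have "lame_equations 1 V H"
  proof (rule lame_equations_sphere[OF card_Q V smooth_on_subset[OF sx VU]])
    fix u i assume u: "u \<in> V"
    \<comment> \<open>On \<open>V\<close> the coefficient f_i is nonzero, and C_i is nonzero since
      \<Omega> has a simple zero at \<open>P i\<close>; a squared length that is nonzero is
      positive.\<close>
    then have "of_real (partial i x u \<bullet> partial i x u) \<noteq> (0 :: complex)"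
      using metric_self[of u i, symmetric] deriv_\<Omega>_P[of i] VU by (auto simp: V_def)
    then show "partial i x u \<bullet> partial i x u > 0" by simp
  qed (use VU sphere orth H in blast)+
  moreover have "orthogonal_sphere_coordinates U x H"
    unfolding orthogonal_sphere_coordinates_def
    using sx sphere orth H by (auto simp: norm_eq_1)
  moreover have "of_real (x u $ m) = csqrt (form_residue \<A> \<Omega> (Q m)) * \<psi> u (Q m)" if "u \<in> U" for u m
  proof -
    have csqrt: "csqrt (form_residue \<A> \<Omega> (Q m)) = of_real (sqrt (A m))"
      unfolding A(1) by (rule of_real_sqrt[symmetric, OF less_imp_le[OF A(2)]])
    show ?thesis
      unfolding csqrt by (simp only: x_def vec_lambda_beta of_real_mult \<psi>_real[OF that, symmetric])
  qed
  moreover have "of_real (H i u) = csqrt ((a i 0 u)\<^sup>2 * deriv (\<Omega> (W i, z i)) 0)" if "u \<in> U" for u i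
    unfolding metric_self[OF that] H[OF that] by (rule of_real_sqrt) simp
  ultimately show ?thesis unfolding V_def by blast
qed

end
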